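(* Let $k$ be a number field and $Q(T)\in k[T]$ an irreducible degree 3 polynomial such that the elliptic curve $C:Y^2=Q(T)$ fulfills $W(C/k)=-1$, but $W(C/L)=+1$ for every quadratic extension $L/k$. Set $F=k(T)(\sqrt{Q(T)})$ and $P(U,T,Y)=Y^2-UQ(T)$. Then, under the Birch and Swinnerton-Dyer conjecture, we have: (1) the extension $F/k(T)$ is strongly $k$-parametric but neither weakly $k(U)$-parametric nor $k(U)$-parametric; (2) the polynomial $Y^2-Q(T)$ is strongly $k$-parametric but not $k(U)$-parametric; (3) for all but finitely many $u_0\in\mathbb{Z}$, the polynomial $P(u_0,T,Y)$ has a zero in $k^2$, but $P$, viewed as a polynomial in $T$ and $Y$, has no zero in $k(U)^2$; (4) hypothesis (WH) (see context) fails for the number field $k$ and the sole $k(U)$-regular Galois cover $f:X\to\mathbb{P}^1_{k(U)}$ given by the polynomial $P(U,T,Y)$, i.e., $X$ is the smooth projective curve over $k(U)$ with affine equation $Y^2=UQ(T)$ and $f$ is the $T$-coordinate: no $\mathbb{C}(U)$-rational point of $X$ is unramified w.r.t. $f$, but it is not true that, for infinitely many $u_0\in k$, the cover $f$ has good reduction at $U=u_0$ and the reduced curve $X|_{u_0}$ has no $k$-rational point that is unramified w.r.t. $f|_{u_0}$.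
   Context: $W(C/K)\in\{\pm1\}$ is the (global) root number of an elliptic curve $C$ over a number field $K$. The number field $k$ is viewed as a subfield of $\mathbb{C}$; $U$ is an indeterminate. The Birch and Swinnerton-Dyer conjecture is used for elliptic curves over number fields: for every elliptic curve $C$ over a number field $K$, $L(C/K,s)$ has an analytic continuation to $\mathbb{C}$ (with, as usual, the expected functional equation of sign $W(C/K)$), and its order of vanishing at $s=1$ equals the rank of $C(K)$. For a field $L$ and finite group $G$, ${\sf R}_G(L)$ (resp. ${\sf R}_{\leq G}(L)$) is the set of all Galois field extensions $E/L$ of group $G$ (resp. of group contained in $G$). For a finite Galois extension $F/k(T)$ of group $G$, its branch point set ${\bf t}$ is the set of $t\in\mathbb{P}^1(\overline{k})$ ramified in $F\overline{k}/\overline{k}(T)$; for $t_0\in\mathbb{P}^1(k)$, the specialization $F_{t_0}/k$ is the residue field extension at any prime ideal containing $T-t_0$ (resp. $1/T$ if $t_0=\infty$) of the integral closure of $k[T]$ (resp. $k[1/T]$) in $F$; and ${\sf SP}(F/k(T))=\{F_{t_0}/k: t_0\in\mathbb{P}^1(k)\setminus{\bf t}\}$. For an overfield $L\supseteq k$, $F/k(T)$ is $L$-parametric (resp. strongly $L$-parametric) if ${\sf SP}(FL/L(T))\supseteq{\sf R}_G(L)$ (resp. ${\sf SP}(FL/L(T))={\sf R}_{\leq G}(L)$). A finite extension $E/k(U)$ (or $F/k(T)$) is $k$-regular if $E\cap\overline{k}=k$ (resp. $F\cap\overline{k}=k$). For $k\subseteq\mathbb{C}$ and $F/k(T)$ $k$-regular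 of group $G$, $F/k(T)$ is weakly $k(U)$-parametric if every $k$-regular $E/k(U)\in{\sf R}_G(k(U))$ is a specialization of $F(U)/k(U)(T)$ after base change $\mathbb{C}/k$, i.e., $E\mathbb{C}/\mathbb{C}(U)\in{\sf SP}(F\mathbb{C}(U)/\mathbb{C}(U)(T))$. A monic separable polynomial $P(T,Y)\in k[T][Y]$ of group $G$ over $k(T)$ is $L$-parametric (resp. strongly $L$-parametric) if, for every $E/L\in{\sf R}_G(L)$ (resp. $E/L\in{\sf R}_{\leq G}(L)$), there is $t_0\in L$ such that $E$ is the splitting field over $L$ of $P(t_0,Y)$. Hypothesis (WH): Let $k$ be a number field and let $f_i:X_i\to\mathbb{P}^1_{k(U)}$, $i=1,\dots,N$, be $k(U)$-regular covers (finite covers by smooth projective geometrically irreducible curves). Assume that no curve $X_i$ has a $\mathbb{C}(U)$-rational point that is unramified w.r.t. $f_i$, $i=1,\dots,N$. Then, for infinitely many $u_0\in k$, the covers $f_1,\dots,f_N$ have good reduction at $U=u_0$ and no reduced curve $X_i|_{u_0}$ has a $k$-rational point that is unramified w.r.t. the cover $f_i|_{u_0}:X_i|_{u_0}\to\mathbb{P}^1_k$, $i=1,\dots,N$. Here good reduction at $U=u_0$ is in the standard sense: the normalization of $\mathbb{P}^1$ over the local ring of $k[U]$ at $\langle U-u_0\rangle$ in the function field of $X_i$ has smooth geometrically irreducible special fibre $X_i|_{u_0}$, and $f_i|_{u_0}$ is the induced cover. *)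

theory Defs
  imports
    "HOL-Algebra.Algebra"
    "HOL-Algebra.Algebraic_Closure_Type"
    "HOL-Complex_Analysis.Complex_Analysis"
begin

hide_const (open) up_ring.coeff

section \<open>Subfields and subrings of a field type\<close>

text \<open>
  All rings and fields are subsets of some field type; \<open>on A\<close> is the corresponding
  HOL-Algebra ring with carrier \<open>A\<close>.
\<close>

abbreviation univ_ring :: "'a::field ring" where
  "univ_ring \<equiv> ring_of_type_algebra"

abbreviation on :: "'a::field set \<Rightarrow> 'a ring" where
  "on A \<equiv> univ_ring\<lparr>carrier := A\<rparr>"

definition coeffs_in :: "'a::field set \<Rightarrow> 'a poly \<Rightarrow> bool" where
  "coeffs_in A p \<longleftrightarrow> (\<forall>i. coeff p i \<in> A)"

definition irreducible_over :: "'a::field set \<Rightarrow> 'a poly \<Rightarrow> bool" where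
  "irreducible_over K p \<longleftrightarrow> coeffs_in K p \<and> degree p > 0 \<and>
     (\<forall>g h. coeffs_in K g \<longrightarrow> coeffs_in K h \<longrightarrow> p = g * h \<longrightarrow> degree g = 0 \<or> degree h = 0)"

definition adjoin :: "'a::field set \<Rightarrow> 'a set \<Rightarrow> 'a set" where
  "adjoin K S = generate_field univ_ring (K \<union> S)"

abbreviation (input) compositum :: "'a::field set \<Rightarrow> 'a set \<Rightarrow> 'a set" where
  "compositum E F \<equiv> adjoin E F"

definition alg_closure_in :: "'a::field set \<Rightarrow> 'a set" where
  "alg_closure_in K = {x. \<exists>p. p \<noteq> 0 \<and> coeffs_in K p \<and> poly p x = 0}"

definition poly_ring :: "'a::field set \<Rightarrow> 'a \<Rightarrow> 'a set" where
  "poly_ring A x = {poly p x | p. coeffs_in A p}"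

definition integral_closure :: "'a::field set \<Rightarrow> 'a set \<Rightarrow> 'a set" where
  "integral_closure A E = {x \<in> E. \<exists>p. lead_coeff p = 1 \<and> coeffs_in A p \<and> poly p x = 0}"

definition splitting_field :: "'a::field set \<Rightarrow> 'a poly \<Rightarrow> 'a set" where
  "splitting_field L p = adjoin L {y. poly p y = 0}"

text \<open>
  For a prime ideal \<open>M\<close> of \<open>B\<close>: the set \<open>S\<close> generates the maximal ideal of the
  localization of \<open>B\<close> at \<open>M\<close>.
\<close>

definition generates_locally :: "'a::field set \<Rightarrow> 'a set \<Rightarrow> 'a set \<Rightarrow> bool" where
  "generates_locally B M S \<longleftrightarrow>
     S \<subseteq> M \<and> (\<forall>b\<in>M. \<exists>s\<in>B - M. s * b \<in> genideal (on B) S)"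

definition number_field :: "complex set \<Rightarrow> bool" where
  "number_field K \<longleftrightarrow> subfield K univ_ring \<and> ring.finite_dimension univ_ring \<rat> K"

definition quadratic_extension :: "complex set \<Rightarrow> complex set \<Rightarrow> bool" where
  "quadratic_extension K L \<longleftrightarrow>
     subfield K univ_ring \<and> subfield L univ_ring \<and> K \<subseteq> L \<and> ring.dimension univ_ring 2 K L"


section \<open>Elliptic curves\<close>

datatype 'a weierstrass = Weierstrass (a1: 'a) (a2: 'a) (a3: 'a) (a4: 'a) (a6: 'a)

definition weierstrass_coeffs :: "'a weierstrass \<Rightarrow> 'a set" where
  "weierstrass_coeffs E = {a1 E, a2 E, a3 E, a4 E, a6 E}"

definition discriminant :: "'a::field weierstrass \<Rightarrow> 'a" where
  "discriminant E =
     (let b2 = a1 E ^ 2 + 4 * a2 E;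
          b4 = 2 * a4 E + a1 E * a3 E;
          b6 = a3 E ^ 2 + 4 * a6 E;
          b8 = a1 E ^ 2 * a6 E + 4 * a2 E * a6 E - a1 E * a3 E * a4 E + a2 E * a3 E ^ 2 - a4 E ^ 2
      in - (b2 ^ 2 * b8) - 8 * b4 ^ 3 - 27 * b6 ^ 2 + 9 * b2 * b4 * b6)"

definition weierstrass_eq :: "'a::field weierstrass \<Rightarrow> 'a \<Rightarrow> 'a \<Rightarrow> 'a" where
  "weierstrass_eq E x y =
     y ^ 2 + a1 E * x * y + a3 E * y - (x ^ 3 + a2 E * x ^ 2 + a4 E * x + a6 E)"

definition elliptic_curve :: "'a::field set \<Rightarrow> 'a weierstrass \<Rightarrow> bool" where
  "elliptic_curve K E \<longleftrightarrow> weierstrass_coeffs E \<subseteq> K \<and> discriminant E \<noteq> 0"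

text \<open>
  For \<open>Q = a T\<^sup>3 + b T\<^sup>2 + c T + d\<close> the curve \<open>Y\<^sup>2 = Q(T)\<close> is brought into Weierstrass form by
  \<open>x = a T\<close>, \<open>y = a Y\<close>.
\<close>

definition cubic_curve :: "'a::field poly \<Rightarrow> 'a weierstrass" where
  "cubic_curve Q = Weierstrass 0 (coeff Q 2) 0 (coeff Q 3 * coeff Q 1) (coeff Q 3 ^ 2 * coeff Q 0)"


subsection \<open>The Mordell--Weil group\<close>

datatype 'a curve_point = Origin | Point 'a 'a

fun curve_add :: "'a::field weierstrass \<Rightarrow> 'a curve_point \<Rightarrow> 'a curve_point \<Rightarrow> 'a curve_point" where
  "curve_add E Origin R = R"
| "curve_add E (Point x y) Origin = Point x y"
| "curve_add E (Point x1 y1) (Point x2 y2) =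
     (if x1 = x2 \<and> y1 + y2 + a1 E * x2 + a3 E = 0 then Origin
      else
       (let d = 2 * y1 + a1 E * x1 + a3 E;
            l = (if x1 = x2 then (3 * x1 ^ 2 + 2 * a2 E * x1 + a4 E - a1 E * y1) / d
                 else (y2 - y1) / (x2 - x1));
            n = (if x1 = x2 then (- (x1 ^ 3) + a4 E * x1 + 2 * a6 E - a3 E * y1) / d
                 else (y1 * x2 - y2 * x1) / (x2 - x1));
            x3 = l ^ 2 + a1 E * l - a2 E - x1 - x2
        in Point x3 (- (l + a1 E) * x3 - n - a3 E)))"

definition mordell_weil_group :: "'a::field set \<Rightarrow> 'a weierstrass \<Rightarrow> 'a curve_point monoid" where
  "mordell_weil_group K E =
     \<lparr>carrier = insert Origin {Point x y | x y. x \<in> K \<and> y \<in> K \<and> weierstrass_eq E x y = 0},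
      monoid.mult = curve_add E, one = Origin\<rparr>"

definition int_independent :: "('a, 'b) monoid_scheme \<Rightarrow> 'a set \<Rightarrow> bool" where
  "int_independent G S \<longleftrightarrow>
     (\<forall>n :: 'a \<Rightarrow> int. finprod G (\<lambda>g. g [^]\<^bsub>G\<^esub> n g) S = \<one>\<^bsub>G\<^esub> \<longrightarrow> (\<forall>g\<in>S. n g = 0))"

definition has_rank :: "('a, 'b) monoid_scheme \<Rightarrow> nat \<Rightarrow> bool" where
  "has_rank G r \<longleftrightarrow>
     (\<exists>S\<subseteq>carrier G. finite S \<and> card S = r \<and> int_independent G S) \<and>
     (\<forall>S\<subseteq>carrier G. finite S \<longrightarrow> int_independent G S \<longrightarrow> card S \<le> r)"


subsection \<open>The L-function\<close>

definition integers_of :: "complex set \<Rightarrow> complex set" where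
  "integers_of K = {x \<in> K. algebraic_int x}"

definition finite_places :: "complex set \<Rightarrow> complex set set" where
  "finite_places K = {P. primeideal P (on (integers_of K)) \<and> P \<noteq> {0}}"

definition place_norm :: "complex set \<Rightarrow> complex set \<Rightarrow> nat" where
  "place_norm K P = card (carrier (on (integers_of K) Quot P))"

definition local_ring :: "complex set \<Rightarrow> complex set \<Rightarrow> complex set" where
  "local_ring K P = {a / b | a b. a \<in> integers_of K \<and> b \<in> integers_of K - P}"

definition local_ideal :: "complex set \<Rightarrow> complex set \<Rightarrow> complex set" where
  "local_ideal K P = {a / b | a b. a \<in> P \<and> b \<in> integers_of K - P}"

text \<open>The second curve is the first one after \<open>x = u\<^sup>2 x' + r\<close>, \<open>y = u\<^sup>3 y' + u\<^sup>2 s x' + t\<close>.\<close>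

definition weierstrass_iso :: "'a::field set \<Rightarrow> 'a weierstrass \<Rightarrow> 'a weierstrass \<Rightarrow> bool" where
  "weierstrass_iso K E E' \<longleftrightarrow> (\<exists>u\<in>K. \<exists>r\<in>K. \<exists>s\<in>K. \<exists>t\<in>K. u \<noteq> 0 \<and>
     u * a1 E' = a1 E + 2 * s \<and>
     u ^ 2 * a2 E' = a2 E - s * a1 E + 3 * r - s ^ 2 \<and>
     u ^ 3 * a3 E' = a3 E + r * a1 E + 2 * t \<and>
     u ^ 4 * a4 E' = a4 E - s * a3 E + 2 * r * a2 E - (t + r * s) * a1 E + 3 * r ^ 2 - 2 * s * t \<and>
     u ^ 6 * a6 E' = a6 E + r * a4 E + r ^ 2 * a2 E + r ^ 3 - t * a3 E - t ^ 2 - r * t * a1 E)"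

definition integral_model ::
    "complex set \<Rightarrow> complex set \<Rightarrow> complex weierstrass \<Rightarrow> complex weierstrass \<Rightarrow> bool" where
  "integral_model K P E E' \<longleftrightarrow>
     weierstrass_coeffs E' \<subseteq> local_ring K P \<and> weierstrass_iso K E E'"

definition minimal_model ::
    "complex set \<Rightarrow> complex set \<Rightarrow> complex weierstrass \<Rightarrow> complex weierstrass \<Rightarrow> bool" where
  "minimal_model K P E E' \<longleftrightarrow> integral_model K P E E' \<and>
     (\<forall>E''. integral_model K P E E'' \<longrightarrow> discriminant E'' / discriminant E' \<in> local_ring K P)"

text \<open>Number of affine points, over the residue field, of the reduction of an integral model.\<close>

definition reduced_point_count :: "complex set \<Rightarrow> complex set \<Rightarrow> complex weierstrass \<Rightarrow> nat" where
  "reduced_point_count K P E =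
     (let residue = (\<lambda>x. local_ideal K P +>\<^bsub>on (local_ring K P)\<^esub> x) in
      card ((\<lambda>(x, y). (residue x, residue y)) `
        {(x, y). x \<in> local_ring K P \<and> y \<in> local_ring K P \<and> weierstrass_eq E x y \<in> local_ideal K P}))"

text \<open>
  The trace of Frobenius \<open>q + 1 - #E(\<F>\<^sub>q)\<close>, where all points of the reduced minimal model are
  counted, including a singular one: at bad places this is \<open>1\<close>, \<open>-1\<close>, \<open>0\<close> for split multiplicative,
  non-split multiplicative and additive reduction.
\<close>

definition frobenius_trace :: "complex set \<Rightarrow> complex set \<Rightarrow> complex weierstrass \<Rightarrow> int" where
  "frobenius_trace K P E = int (place_norm K P) -
     int (reduced_point_count K P (SOME E'. minimal_model K P E E'))"

definition good_place :: "complex set \<Rightarrow> complex set \<Rightarrow> complex weierstrass \<Rightarrow> bool" where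
  "good_place K P E \<longleftrightarrow> (\<exists>E'. minimal_model K P E E' \<and> discriminant E' \<notin> local_ideal K P)"

definition euler_factor ::
    "complex set \<Rightarrow> complex weierstrass \<Rightarrow> complex \<Rightarrow> complex set \<Rightarrow> complex" where
  "euler_factor K E s P =
     (let q = complex_of_nat (place_norm K P) in
      1 / (1 - of_int (frobenius_trace K P E) * q powr (- s) +
           (if good_place K P E then q powr (1 - 2 * s) else 0)))"

definition L_continuation ::
    "complex set \<Rightarrow> complex weierstrass \<Rightarrow> (complex \<Rightarrow> complex) \<Rightarrow> bool" where
  "L_continuation K E f \<longleftrightarrow> f holomorphic_on UNIV \<and>
     (\<forall>s. Re s > 3 / 2 \<longrightarrow>
       ((\<lambda>S. \<Prod>P\<in>S. euler_factor K E s P) \<longlongrightarrow> f s) (finite_subsets_at_top (finite_places K)))"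

definition completed_L ::
    "complex set \<Rightarrow> nat \<Rightarrow> (complex \<Rightarrow> complex) \<Rightarrow> complex \<Rightarrow> complex" where
  "completed_L K A f s =
     of_nat A powr (s / 2) *
     (complex_of_real (2 * pi) powr (- s) * Gamma s) ^ ring.dim univ_ring \<rat> K * f s"

text \<open>
  The functional equation of sign \<open>w\<close>. The positive integer \<open>A\<close> stands for the norm of the
  conductor times the square of the discriminant of \<open>K\<close>. If \<open>f\<close> is not identically zero, both \<open>A\<close>
  and \<open>w\<close> are determined by \<open>f\<close>. The poles of the Gamma factors, where the library's \<open>Gamma\<close> has
  the value 0, are left out.
\<close>

definition functional_equation :: "complex set \<Rightarrow> (complex \<Rightarrow> complex) \<Rightarrow> int \<Rightarrow> bool" where
  "functional_equation K f w \<longleftrightarrow>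
     (\<exists>A>0. \<forall>s. s \<notin> \<int>\<^sub>\<le>\<^sub>0 \<longrightarrow> 2 - s \<notin> \<int>\<^sub>\<le>\<^sub>0 \<longrightarrow>
        completed_L K A f (2 - s) = of_int w * completed_L K A f s)"

text \<open>
  The root number is the sign of the functional equation; \<open>BSD_conjecture\<close> below includes the
  existence of the continuation and of that equation.
\<close>

definition root_number :: "complex set \<Rightarrow> complex weierstrass \<Rightarrow> int" where
  "root_number K E = (THE w. w \<in> {1, -1} \<and>
     (\<exists>f. L_continuation K E f \<and> functional_equation K f w))"

definition BSD_conjecture :: bool where
  "BSD_conjecture \<longleftrightarrow> (\<forall>K E. number_field K \<longrightarrow> elliptic_curve K E \<longrightarrow>
     (\<exists>f r. L_continuation K E f \<and> functional_equation K f (root_number K E) \<and>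
        (\<exists>s. f s \<noteq> 0) \<and> zorder f 1 = int r \<and> has_rank (mordell_weil_group K E) r))"


section \<open>Galois extensions and specializations\<close>

text \<open>
  In what follows \<open>'a\<close> is meant to be algebraically closed, so that the finite Galois extensions of
  a subfield \<open>L\<close> are, up to \<open>L\<close>-isomorphism and without repetition, subfields of \<open>'a\<close>.
\<close>

definition Gal :: "'a::field set \<Rightarrow> 'a set \<Rightarrow> ('a \<Rightarrow> 'a) monoid" where
  "Gal E L = (BijGroup E)
     \<lparr>carrier := {\<sigma> \<in> Bij E. \<sigma> \<in> ring_hom (on E) (on E) \<and> (\<forall>x\<in>L. \<sigma> x = x)}\<rparr>"

definition galois_extension :: "'a::field set \<Rightarrow> 'a set \<Rightarrow> bool" where
  "galois_extension L E \<longleftrightarrow>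
     subfield L univ_ring \<and> subfield E univ_ring \<and> L \<subseteq> E \<and> ring.finite_dimension univ_ring L E \<and>
     {x \<in> E. \<forall>\<sigma>\<in>carrier (Gal E L). \<sigma> x = x} = L"

definition R_eq :: "('g, 'h) monoid_scheme \<Rightarrow> 'a::field set \<Rightarrow> 'a set set" where
  "R_eq G L = {E. galois_extension L E \<and> Gal E L \<cong> G}"

definition R_le :: "('g, 'h) monoid_scheme \<Rightarrow> 'a::field set \<Rightarrow> 'a set set" where
  "R_le G L = {E. galois_extension L E \<and> (\<exists>H. subgroup H G \<and> Gal E L \<cong> G\<lparr>carrier := H\<rparr>)}"

definition regular_over :: "'a::field set \<Rightarrow> 'a set \<Rightarrow> bool" where
  "regular_over k E \<longleftrightarrow> E \<inter> alg_closure_in k = k"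

datatype 'a proj_point = Affine 'a | Infty

definition proj_line :: "'a set \<Rightarrow> 'a proj_point set" where
  "proj_line L = insert Infty (Affine ` L)"

fun chart :: "'a::field \<Rightarrow> 'a proj_point \<Rightarrow> 'a" where
  "chart T (Affine t) = T"
| "chart T Infty = inverse T"

fun local_parameter :: "'a::field \<Rightarrow> 'a proj_point \<Rightarrow> 'a" where
  "local_parameter T (Affine t) = T - t"
| "local_parameter T Infty = inverse T"

definition chart_closure :: "'a::field set \<Rightarrow> 'a \<Rightarrow> 'a set \<Rightarrow> 'a proj_point \<Rightarrow> 'a set" where
  "chart_closure L T F t = integral_closure (poly_ring L (chart T t)) F"

definition ramified_at :: "'a::field set \<Rightarrow> 'a \<Rightarrow> 'a set \<Rightarrow> 'a proj_point \<Rightarrow> bool" where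
  "ramified_at L T F t \<longleftrightarrow>
     (\<exists>M. primeideal M (on (chart_closure L T F t)) \<and> local_parameter T t \<in> M \<and>
          \<not> generates_locally (chart_closure L T F t) M {local_parameter T t})"

definition branch_points :: "'a::field set \<Rightarrow> 'a \<Rightarrow> 'a set \<Rightarrow> 'a proj_point set" where
  "branch_points L T F =
     {t \<in> proj_line (alg_closure_in L).
        ramified_at (alg_closure_in L) T (compositum F (alg_closure_in L)) t}"

definition is_specialization ::
    "'a::field set \<Rightarrow> 'a \<Rightarrow> 'a set \<Rightarrow> 'a proj_point \<Rightarrow> 'a set \<Rightarrow> bool" where
  "is_specialization L T F t E \<longleftrightarrow> subfield E univ_ring \<and> L \<subseteq> E \<and>
     (let R = on (chart_closure L T F t) in
      \<exists>M. primeideal M R \<and> local_parameter T t \<in> M \<and>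
        (\<exists>\<psi> \<in> ring_iso (R Quot M) (on E). \<forall>c\<in>L. \<psi> (M +>\<^bsub>R\<^esub> c) = c))"

definition SP :: "'a::field set \<Rightarrow> 'a \<Rightarrow> 'a set \<Rightarrow> 'a set set" where
  "SP L T F = {E. \<exists>t \<in> proj_line L - branch_points L T F. is_specialization L T F t E}"

definition parametric_ext :: "'a::field set \<Rightarrow> 'a set \<Rightarrow> 'a \<Rightarrow> 'a set \<Rightarrow> bool" where
  "parametric_ext k L T F \<longleftrightarrow> R_eq (Gal F (adjoin k {T})) L \<subseteq> SP L T (compositum F L)"

definition strongly_parametric_ext :: "'a::field set \<Rightarrow> 'a set \<Rightarrow> 'a \<Rightarrow> 'a set \<Rightarrow> bool" where
  "strongly_parametric_ext k L T F \<longleftrightarrow> SP L T (compositum F L) = R_le (Gal F (adjoin k {T})) L"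

text \<open>Polynomials in \<open>T\<close> and \<open>Y\<close> have outer variable \<open>Y\<close> and inner variable \<open>T\<close>.\<close>

definition eval_inner :: "'a::field poly poly \<Rightarrow> 'a \<Rightarrow> 'a poly" where
  "eval_inner P t = map_poly (\<lambda>c. poly c t) P"

definition poly_group :: "'a::field set \<Rightarrow> 'a \<Rightarrow> 'a poly poly \<Rightarrow> ('a \<Rightarrow> 'a) monoid" where
  "poly_group k T P = Gal (splitting_field (adjoin k {T}) (eval_inner P T)) (adjoin k {T})"

definition parametric_poly :: "'a::field set \<Rightarrow> 'a set \<Rightarrow> 'a \<Rightarrow> 'a poly poly \<Rightarrow> bool" where
  "parametric_poly k L T P \<longleftrightarrow>
     (\<forall>E \<in> R_eq (poly_group k T P) L. \<exists>t0\<in>L. E = splitting_field L (eval_inner P t0))"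

definition strongly_parametric_poly :: "'a::field set \<Rightarrow> 'a set \<Rightarrow> 'a \<Rightarrow> 'a poly poly \<Rightarrow> bool" where
  "strongly_parametric_poly k L T P \<longleftrightarrow>
     (\<forall>E \<in> R_le (poly_group k T P) L. \<exists>t0\<in>L. E = splitting_field L (eval_inner P t0))"


section \<open>The ambient field: an algebraic closure of C(U)(T)\<close>

type_synonym ambient = "complex poly fract poly fract alg_closure"

definition const :: "complex \<Rightarrow> ambient" where
  "const c = to_ac (to_fract [:to_fract [:c:]:])"

definition U_var :: ambient where
  "U_var = to_ac (to_fract [:to_fract [:0, 1:]:])"

definition T_var :: ambient where
  "T_var = to_ac (to_fract [:0, 1:])"

abbreviation Cx :: "ambient set" where
  "Cx \<equiv> range const"

definition weakly_parametric_ext :: "ambient set \<Rightarrow> ambient set \<Rightarrow> bool" where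
  "weakly_parametric_ext k F \<longleftrightarrow>
     (\<forall>E \<in> R_eq (Gal F (adjoin k {T_var})) (adjoin k {U_var}). regular_over k E \<longrightarrow>
        compositum E Cx \<in> SP (adjoin Cx {U_var}) T_var (compositum F (adjoin Cx {U_var})))"


section \<open>Covers of the projective line and hypothesis (WH)\<close>

text \<open>
  A cover \<open>X \<rightarrow> P\<^sup>1\<close> over a field \<open>L\<close> is given by its function field \<open>M \<supseteq> L(T)\<close>: \<open>X\<close> is the
  normalization of \<open>P\<^sup>1\<close> in \<open>M\<close>, which is covered by the spectra of the integral closures of \<open>L[T]\<close>
  and \<open>L[1/T]\<close>. An \<open>L\<close>-rational point is an \<open>L\<close>-homomorphism from one of these rings to \<open>L\<close>.
\<close>

definition regular_cover :: "'a::field set \<Rightarrow> 'a \<Rightarrow> 'a set \<Rightarrow> bool" where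
  "regular_cover L T M \<longleftrightarrow> subfield L univ_ring \<and> subfield M univ_ring \<and> adjoin L {T} \<subseteq> M \<and>
     ring.finite_dimension univ_ring (adjoin L {T}) M \<and> regular_over L M"

definition has_unramified_point :: "'a::field set \<Rightarrow> 'a \<Rightarrow> 'a set \<Rightarrow> bool" where
  "has_unramified_point L T M \<longleftrightarrow>
     (\<exists>x \<in> {T, inverse T}. let B = integral_closure (poly_ring L x) M in
        \<exists>\<phi> \<in> ring_hom (on B) (on L). (\<forall>c\<in>L. \<phi> c = c) \<and>
          generates_locally B (a_kernel (on B) (on L) \<phi>) {x - \<phi> x})"

text \<open>The local ring of \<open>k[U]\<close> at \<open>U - u0\<close>, and the charts of the normalization of \<open>P\<^sup>1\<close> over it.\<close>

definition base_local_ring :: "ambient set \<Rightarrow> ambient \<Rightarrow> ambient set" where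
  "base_local_ring k u0 =
     {poly p U_var / poly q U_var | p q. coeffs_in k p \<and> coeffs_in k q \<and> poly q u0 \<noteq> 0}"

definition model_chart :: "ambient set \<Rightarrow> ambient \<Rightarrow> ambient set \<Rightarrow> ambient \<Rightarrow> ambient set" where
  "model_chart k u0 N x = integral_closure (poly_ring (base_local_ring k u0) x) N"

text \<open>
  For a chart \<open>B\<close> of the model and \<open>k'\<close> the algebraic closure of \<open>k\<close>, let \<open>R\<close> be the ring generated
  by \<open>B\<close> and \<open>k'\<close>. As \<open>N\<close> is regular over \<open>k(U)\<close>, it is \<open>B \<otimes>\<^sub>k k'\<close>, and \<open>R / (U - u0)\<close> is the
  geometric special fibre. This fibre is smooth and irreducible iff \<open>R / (U - u0)\<close> is a
  domain all of whose localizations at maximal ideals have a principal maximal ideal.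
\<close>

definition good_reduction :: "ambient set \<Rightarrow> ambient \<Rightarrow> ambient set \<Rightarrow> bool" where
  "good_reduction k u0 N \<longleftrightarrow>
     (\<forall>x \<in> {T_var, inverse T_var}.
        let R = generate_ring univ_ring (model_chart k u0 N x \<union> alg_closure_in k) in
        primeideal (genideal (on R) {U_var - u0}) (on R) \<and>
        (\<forall>M. maximalideal M (on R) \<longrightarrow> U_var - u0 \<in> M \<longrightarrow>
           (\<exists>\<pi>\<in>M. generates_locally R M {U_var - u0, \<pi>})))"

text \<open>
  A \<open>k\<close>-rational point of the special fibre is a \<open>k\<close>-homomorphism from a chart to \<open>k\<close> that kills
  \<open>U - u0\<close>; it is unramified iff \<open>T - T(point)\<close> (or \<open>1/T\<close>) generates its maximal ideal on the
  special fibre, i.e. together with \<open>U - u0\<close> on the model.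
\<close>

definition reduction_has_unramified_point :: "ambient set \<Rightarrow> ambient \<Rightarrow> ambient set \<Rightarrow> bool" where
  "reduction_has_unramified_point k u0 N \<longleftrightarrow>
     (\<exists>x \<in> {T_var, inverse T_var}. let B = model_chart k u0 N x in
        \<exists>\<phi> \<in> ring_hom (on B) (on k). (\<forall>c\<in>k. \<phi> c = c) \<and> \<phi> U_var = u0 \<and>
          generates_locally B (a_kernel (on B) (on k) \<phi>) {U_var - u0, x - \<phi> x})"

definition WH :: "ambient set \<Rightarrow> ambient set list \<Rightarrow> bool" where
  "WH k Ns \<longleftrightarrow>
     ((\<forall>N \<in> set Ns. \<not> has_unramified_point (adjoin Cx {U_var}) T_var (compositum N Cx)) \<longrightarrow>
      infinite {u0 \<in> k. \<forall>N \<in> set Ns.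
        good_reduction k u0 N \<and> \<not> reduction_has_unramified_point k u0 N})"

end

theory Submission
  imports Defs "Jordan_Normal_Form.Char_Poly"
begin

text \<open>
  Since the sign of the functional equation is the parity of the rank, the rank of \<open>C\<close> is odd
  over \<open>k\<close> and even over \<open>L = k(\<surd>d)\<close>. So \<open>C(L) \<noteq> C(k)\<close>, and the difference of a point of \<open>C(L)\<close>
  outside \<open>C(k)\<close> and its conjugate is a \<open>k\<close>-rational point of the twist \<open>d Y\<^sup>2 = Q(T)\<close>; as \<open>Q\<close> has no
  root in \<open>k\<close>, every extension of \<open>k\<close> of degree at most 2 is a specialization of \<open>F/k(T)\<close>.
  Over \<open>\<complex>(U)\<close>, on the other hand, the twist \<open>U Y\<^sup>2 = Q(T)\<close> has no points with \<open>Y \<noteq> 0\<close>: they would give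
  a non-constant map from a rational curve to \<open>C\<close>. Hence \<open>k(U)(\<surd>U)\<close> is not a specialization,
  whereas \<open>Y\<^sup>2 = u\<^sub>0 Q(T)\<close> has unramified \<open>k\<close>-rational points for all \<open>u\<^sub>0 \<noteq> 0\<close> in \<open>k\<close>.
\<close>

section \<open>Subrings, subfields and integral closures\<close>

text \<open>The function fields in play are quadratic over a rational function field
  \<open>K(x)\<close>, so all is done in coordinates \<open>a + b * z\<close>: Galois extensions
  with group of order at most 2 become adjunctions of square roots, and the integral closure of
  \<open>K[x]\<close> in \<open>K(x)(Z)\<close>, where \<open>Z^2 = R(x)\<close> with
  \<open>R\<close> squarefree, is \<open>K[x] + K[x] Z\<close>. Residue fields and rational points
  are evaluations at solutions of \<open>z^2 = R(x0)\<close>, and a rational point is ramified when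
  \<open>z = 0\<close>. The chart at infinity is a second instance of this; as \<open>Q\<close> has
  odd degree, infinity is a branch point with trivial residue extension.

  The obstacle is the model over the local ring of \<open>k[U]\<close> at \<open>u0\<close>, whose
  charts are integral closures over a two-dimensional ring. They are not determined; their elements
  are only shown to have denominator \<open>D = U Q(T)\<close> in the coordinate of
  \<open>Z\<close>, which is enough because \<open>D\<close> has the nonzero value
  \<open>y^2\<close> at the point \<open>(t, y)\<close> to be lifted. This excludes every
  \<open>u0 \<noteq> 0\<close> of \<open>k\<close> from the set in (WH), whatever the reduction at
  \<open>u0\<close>, so that this set is contained in \<open>{0}\<close>.\<close>

lemma univ_ring_simps [simp]:
  "carrier (univ_ring :: 'a::field ring) = UNIV"
  "x \<otimes>\<^bsub>univ_ring\<^esub> y = (x * y :: 'a)"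
  "\<one>\<^bsub>univ_ring\<^esub> = (1 :: 'a)"
  "\<zero>\<^bsub>univ_ring\<^esub> = (0 :: 'a)"
  "x \<oplus>\<^bsub>univ_ring\<^esub> y = (x + y :: 'a)"
  by (simp_all add: ring_of_type_algebra_def)

lemma univ_ring_a_inv [simp]: "\<ominus>\<^bsub>univ_ring\<^esub> x = - (x :: 'a::field)"
proof -
  interpret Ring.field "univ_ring :: 'a ring" by (rule field_from_type_algebra)
  show ?thesis using minus_equality[of "-x" x] by simp
qed

lemma univ_ring_m_inv [simp]: "x \<noteq> 0 \<Longrightarrow> inv\<^bsub>univ_ring\<^esub> x = inverse (x :: 'a::field)"
proof -
  interpret Ring.field "univ_ring :: 'a ring" by (rule field_from_type_algebra)
  show "x \<noteq> 0 \<Longrightarrow> ?thesis" using inv_unique'[of x "inverse x"] by simp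
qed

lemma subring_univ_iff:
  "subring A (univ_ring :: 'a::field ring) \<longleftrightarrow>
     1 \<in> A \<and> (\<forall>x\<in>A. - x \<in> A) \<and> (\<forall>x\<in>A. \<forall>y\<in>A. x + y \<in> A) \<and> (\<forall>x\<in>A. \<forall>y\<in>A. x * y \<in> A)"
proof -
  interpret Ring.field "univ_ring :: 'a ring" by (rule field_from_type_algebra)
  show ?thesis
    using subringI[of A] subringE[of A "univ_ring :: 'a ring"] by (auto simp: Ball_def)
qed

lemma subfield_univ_iff:
  "subfield K (univ_ring :: 'a::field ring) \<longleftrightarrow>
     subring K univ_ring \<and> (\<forall>x\<in>K. inverse x \<in> K)"
proof -
  interpret Ring.field "univ_ring :: 'a ring" by (rule field_from_type_algebra)
  show ?thesis
  proof
    assume K: "subfield K univ_ring"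
    have "inverse x \<in> K" if "x \<in> K" for x
    proof (cases "x = 0")
      case False
      then show ?thesis using subfield_m_inv(1)[OF K, of x] that by simp
    qed (use that in auto)
    then show "subring K univ_ring \<and> (\<forall>x\<in>K. inverse x \<in> K)"
      using subfieldE(1)[OF K] by blast
  next
    assume K: "subring K univ_ring \<and> (\<forall>x\<in>K. inverse x \<in> K)"
    show "subfield K univ_ring" by (rule subfieldI') (use K in auto)
  qed
qed

lemma subring_closed:
  assumes "subring A (univ_ring :: 'a::field ring)"
  shows "0 \<in> A" "1 \<in> A" "x \<in> A \<Longrightarrow> - x \<in> A" "x \<in> A \<Longrightarrow> y \<in> A \<Longrightarrow> x + y \<in> A"
    "x \<in> A \<Longrightarrow> y \<in> A \<Longrightarrow> x - y \<in> A" "x \<in> A \<Longrightarrow> y \<in> A \<Longrightarrow> x * y \<in> A" "x \<in> A \<Longrightarrow> x ^ n \<in> A"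
    "of_nat m \<in> A" "numeral w \<in> A"
proof -
  have *: "1 \<in> A" "\<And>x. x \<in> A \<Longrightarrow> - x \<in> A" "\<And>x y. x \<in> A \<Longrightarrow> y \<in> A \<Longrightarrow> x + y \<in> A"
      "\<And>x y. x \<in> A \<Longrightarrow> y \<in> A \<Longrightarrow> x * y \<in> A"
    using assms unfolding subring_univ_iff by auto
  show z: "0 \<in> A" using *(3)[OF *(1) *(2)[OF *(1)]] by simp
  show "x \<in> A \<Longrightarrow> x ^ n \<in> A" by (induction n) (auto intro: *)
  have n: "of_nat m \<in> A" for m by (induction m) (auto intro: * z)
  show "of_nat m \<in> A" by (rule n)
  show "numeral w \<in> A" using n[of "numeral w"] by simp
  show "x \<in> A \<Longrightarrow> y \<in> A \<Longrightarrow> x - y \<in> A" using *(3)[of x "- y"] *(2)[of y] by simp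
qed (use assms in \<open>auto simp: subring_univ_iff\<close>)

lemma subfield_closed:
  assumes "subfield K (univ_ring :: 'a::field ring)"
  shows "0 \<in> K" "1 \<in> K" "x \<in> K \<Longrightarrow> - x \<in> K" "x \<in> K \<Longrightarrow> y \<in> K \<Longrightarrow> x + y \<in> K"
    "x \<in> K \<Longrightarrow> y \<in> K \<Longrightarrow> x - y \<in> K" "x \<in> K \<Longrightarrow> y \<in> K \<Longrightarrow> x * y \<in> K" "x \<in> K \<Longrightarrow> x ^ n \<in> K"
    "of_nat m \<in> K" "numeral w \<in> K" "x \<in> K \<Longrightarrow> inverse x \<in> K" "x \<in> K \<Longrightarrow> y \<in> K \<Longrightarrow> x / y \<in> K"
proof -
  have sr: "subring K univ_ring" and inv: "\<And>x. x \<in> K \<Longrightarrow> inverse x \<in> K"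
    using assms unfolding subfield_univ_iff by auto
  note cl = subring_closed[OF sr]
  show "0 \<in> K" "1 \<in> K" "x \<in> K \<Longrightarrow> - x \<in> K" "x \<in> K \<Longrightarrow> y \<in> K \<Longrightarrow> x + y \<in> K"
    "x \<in> K \<Longrightarrow> y \<in> K \<Longrightarrow> x - y \<in> K" "x \<in> K \<Longrightarrow> y \<in> K \<Longrightarrow> x * y \<in> K" "x \<in> K \<Longrightarrow> x ^ n \<in> K"
    "of_nat m \<in> K" "numeral w \<in> K" by (fact cl)+
  show "x \<in> K \<Longrightarrow> inverse x \<in> K" by (fact inv)
  show "x \<in> K \<Longrightarrow> y \<in> K \<Longrightarrow> x / y \<in> K"
    unfolding field_class.field_divide_inverse by (intro cl(6) inv)
qed

lemma subfieldI_univ: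
  assumes "1 \<in> K" "\<And>x. x \<in> K \<Longrightarrow> - x \<in> K" "\<And>x y. x \<in> K \<Longrightarrow> y \<in> K \<Longrightarrow> x + y \<in> K"
    "\<And>x y. x \<in> K \<Longrightarrow> y \<in> K \<Longrightarrow> x * y \<in> K" "\<And>x. x \<in> K \<Longrightarrow> inverse x \<in> K"
  shows "subfield K (univ_ring :: 'a::field ring)"
  unfolding subfield_univ_iff subring_univ_iff by (intro conjI ballI assms)

lemma subfield_subring: "subfield K (univ_ring :: 'a::field ring) \<Longrightarrow> subring K univ_ring"
  by (simp add: subfield_univ_iff)

lemma coeffs_in_pCons [simp]: "coeffs_in A (pCons c p) \<longleftrightarrow> c \<in> A \<and> coeffs_in (A :: 'a::field set) p"
  by (auto simp: coeffs_in_def coeff_pCons split: nat.splits)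

lemma coeffs_in_mono: "coeffs_in A p \<Longrightarrow> A \<subseteq> B \<Longrightarrow> coeffs_in B p"
  by (auto simp: coeffs_in_def)

lemma coeffs_in_closed:
  assumes A: "subring A (univ_ring :: 'a::field ring)"
  shows "coeffs_in A 0" "coeffs_in A 1"
    "coeffs_in A p \<Longrightarrow> coeffs_in A (- p)"
    "coeffs_in A p \<Longrightarrow> coeffs_in A q \<Longrightarrow> coeffs_in A (p + q)"
    "coeffs_in A p \<Longrightarrow> coeffs_in A q \<Longrightarrow> coeffs_in A (p - q)"
    "coeffs_in A p \<Longrightarrow> coeffs_in A q \<Longrightarrow> coeffs_in A (p * q)"
    "coeffs_in A p \<Longrightarrow> coeffs_in A (p ^ n)"
    "c \<in> A \<Longrightarrow> coeffs_in A p \<Longrightarrow> coeffs_in A (smult c p)"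
    "c \<in> A \<Longrightarrow> coeffs_in A (monom c n)"
proof -
  note cl = subring_closed[OF A]
  have sum: "(\<And>i. i \<in> I \<Longrightarrow> f i \<in> A) \<Longrightarrow> sum f I \<in> A" for f :: "nat \<Rightarrow> 'a" and I
    by (induction I rule: infinite_finite_induct) (auto intro: cl)
  have mult: "coeffs_in A p \<Longrightarrow> coeffs_in A q \<Longrightarrow> coeffs_in A (p * q)" for p q
    by (auto simp: coeffs_in_def coeff_mult intro!: sum cl)
  show one: "coeffs_in A 1" by (auto simp: coeffs_in_def intro: cl)
  show "coeffs_in A p \<Longrightarrow> coeffs_in A q \<Longrightarrow> coeffs_in A (p * q)" by (rule mult)
  show "coeffs_in A p \<Longrightarrow> coeffs_in A (p ^ n)" by (induction n) (auto intro: one mult)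
  show "coeffs_in A 0" using cl(1) by (simp add: coeffs_in_def)
  show "coeffs_in A p \<Longrightarrow> coeffs_in A (- p)"
    "coeffs_in A p \<Longrightarrow> coeffs_in A q \<Longrightarrow> coeffs_in A (p + q)"
    "coeffs_in A p \<Longrightarrow> coeffs_in A q \<Longrightarrow> coeffs_in A (p - q)"
    "c \<in> A \<Longrightarrow> coeffs_in A p \<Longrightarrow> coeffs_in A (smult c p)"
    "c \<in> A \<Longrightarrow> coeffs_in A (monom c n)"
    unfolding coeffs_in_def using cl(1,3-6) by simp_all
qed

lemma coeffs_in_sum:
  assumes "subring A (univ_ring :: 'a::field ring)" "\<And>i. i \<in> I \<Longrightarrow> coeffs_in A (f i)"
  shows "coeffs_in A (sum f I)"
  using assms(2) by (induction I rule: infinite_finite_induct) (auto intro: coeffs_in_closed[OF assms(1)])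

lemma coeffs_in_prod:
  assumes "subring A (univ_ring :: 'a::field ring)" "\<And>i. i \<in> I \<Longrightarrow> coeffs_in A (f i)"
  shows "coeffs_in A (prod f I)"
  using assms(2) by (induction I rule: infinite_finite_induct) (auto intro: coeffs_in_closed[OF assms(1)])

lemma poly_in_subring:
  assumes "subring A (univ_ring :: 'a::field ring)" "coeffs_in A p" "x \<in> A"
  shows "poly p x \<in> A"
  using assms(2) by (induction p) (auto intro: subring_closed[OF assms(1)] assms(3))

lemma poly_ringI: "coeffs_in A p \<Longrightarrow> poly p x \<in> poly_ring A x"
  unfolding poly_ring_def by blast

lemma poly_ringE: assumes "a \<in> poly_ring A x" obtains p where "coeffs_in A p" "a = poly p x"
  using assms unfolding poly_ring_def by blast

lemma subring_poly_ring:
  assumes A: "subring A (univ_ring :: 'a::field ring)"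
  shows "subring (poly_ring A x) univ_ring"
  unfolding subring_univ_iff
proof (intro conjI ballI)
  show "1 \<in> poly_ring A x" using poly_ringI[OF coeffs_in_closed(2)[OF A], of x] by simp
next
  fix a assume "a \<in> poly_ring A x"
  then obtain p where p: "coeffs_in A p" "a = poly p x" by (rule poly_ringE)
  show "- a \<in> poly_ring A x" using poly_ringI[OF coeffs_in_closed(3)[OF A p(1)], of x] p(2) by simp
  fix b assume "b \<in> poly_ring A x"
  then obtain q where q: "coeffs_in A q" "b = poly q x" by (rule poly_ringE)
  show "a + b \<in> poly_ring A x" "a * b \<in> poly_ring A x"
    using poly_ringI[OF coeffs_in_closed(4)[OF A p(1) q(1)], of x]
      poly_ringI[OF coeffs_in_closed(6)[OF A p(1) q(1)], of x] p(2) q(2) by simp_all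
qed

lemma coeffs_in_0 [simp]: "coeffs_in A 0 \<longleftrightarrow> (0::'a::field) \<in> A"
  by (simp add: coeffs_in_def)

lemma const_in_poly_ring: "a \<in> A \<Longrightarrow> (0::'a::field) \<in> A \<Longrightarrow> a \<in> poly_ring A x"
  unfolding poly_ring_def by (auto intro!: exI[of _ "[:a:]"])

lemma var_in_poly_ring: "(0::'a::field) \<in> A \<Longrightarrow> 1 \<in> A \<Longrightarrow> x \<in> poly_ring A x"
  unfolding poly_ring_def by (auto intro!: exI[of _ "[:0,1:]"])

lemma poly_ring_subset:
  assumes "subring B univ_ring" "A \<subseteq> B" "x \<in> B" shows "poly_ring A x \<subseteq> B"
  unfolding poly_ring_def using poly_in_subring[OF assms(1) coeffs_in_mono[OF _ assms(2)] assms(3)] by auto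

lemma adjoin_subfield: "subfield (adjoin K S) (univ_ring :: 'a::field ring)"
  unfolding adjoin_def
  by (rule field.generate_field_is_subfield[OF field_from_type_algebra]) simp

lemma adjoin_superset: "K \<union> S \<subseteq> adjoin K S"
  unfolding adjoin_def by (auto intro: generate_field.incl)

lemma adjoin_least:
  "subfield E (univ_ring :: 'a::field ring) \<Longrightarrow> K \<subseteq> E \<Longrightarrow> S \<subseteq> E \<Longrightarrow> adjoin K S \<subseteq> E"
  unfolding adjoin_def
  by (rule field.generate_field_min_subfield1[OF field_from_type_algebra]) auto

lemma adjoin_eqI:
  "subfield E (univ_ring :: 'a::field ring) \<Longrightarrow> K \<subseteq> E \<Longrightarrow> S \<subseteq> E \<Longrightarrow> E \<subseteq> adjoin K S \<Longrightarrow> adjoin K S = E"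
  using adjoin_least by blast

text \<open>The determinant trick: an eigenvalue is a root of the characteristic polynomial, which
  is monic, and the Leibniz formula builds its coefficients from the entries of the matrix by ring
  operations of \<open>A\<close>.\<close>

lemma integral_if_eigenvector:
  fixes v :: "nat \<Rightarrow> 'a::field"
  assumes A: "subring A (univ_ring :: 'a ring)"
    and M: "\<And>i j. i < n \<Longrightarrow> j < n \<Longrightarrow> M i j \<in> A"
    and ev: "\<And>i. i < n \<Longrightarrow> (\<Sum>j<n. M i j * v j) = z * v i"
    and v: "i0 < n" "v i0 \<noteq> 0"
  shows "\<exists>p. lead_coeff p = 1 \<and> coeffs_in A p \<and> poly p z = 0"
proof -
  let ?M = "mat n n (\<lambda>(i,j). M i j)"
  have M': "?M \<in> carrier_mat n n" by simp
  have "eigenvector ?M (vec n v) z"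
    unfolding eigenvector_def
  proof (intro conjI)
    show "vec n v \<in> carrier_vec (dim_row ?M)" by simp
    show "vec n v \<noteq> 0\<^sub>v (dim_row ?M)"
    proof
      assume "vec n v = 0\<^sub>v (dim_row ?M)"
      then have "vec_index (vec n v) i0 = vec_index (0\<^sub>v n) i0" by simp
      then show False using v by simp
    qed
    show "?M *\<^sub>v vec n v = z \<cdot>\<^sub>v vec n v"
    proof (rule eq_vecI)
      fix i assume "i < dim_vec (z \<cdot>\<^sub>v vec n v)"
      then have i: "i < n" by simp
      then show "vec_index (?M *\<^sub>v vec n v) i = vec_index (z \<cdot>\<^sub>v vec n v) i"
        using ev[OF i] by (simp add: scalar_prod_def lessThan_atLeast0)
    qed simp
  qed
  then have "poly (char_poly ?M) z = 0"
    using eigenvalue_root_char_poly[OF M'] unfolding eigenvalue_def by blast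
  moreover have "lead_coeff (char_poly ?M) = 1"
    using degree_monic_char_poly[OF M'] by simp
  moreover have "coeffs_in A (char_poly ?M)"
  proof -
    have "coeffs_in A (signof p * (\<Prod>i = 0..<n. (char_poly_matrix ?M) $$ (i, p i)))"
      if "p permutes {0..<n}" for p
    proof (intro coeffs_in_closed(6)[OF A] coeffs_in_prod[OF A])
      show "coeffs_in A (signof p)"
        using coeffs_in_closed(2,3)[OF A] by (auto simp: sign_def)
      fix i assume "i \<in> {0..<n}"
      then have i: "i < n" "p i < n" using permutes_in_image[OF that, of i] by auto
      have "coeffs_in A [:0, 1:]" using subring_closed[OF A] coeffs_in_closed(1)[OF A] by auto
      then show "coeffs_in A ((char_poly_matrix ?M) $$ (i, p i))"
        using i M[OF i] subring_closed[OF A] coeffs_in_closed[OF A]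
        by (auto simp: char_poly_matrix_def)
    qed
    moreover have "char_poly_matrix ?M \<in> carrier_mat n n" using M' by simp
    ultimately show ?thesis
      unfolding char_poly_def Determinant.det_def'[OF \<open>char_poly_matrix ?M \<in> carrier_mat n n\<close>]
      by (intro coeffs_in_sum[OF A]) auto
  qed
  ultimately show ?thesis by blast
qed

text \<open>Allows an arbitrary finite index set, so that the monomials \<open>x ^ a * y ^ b\<close>
  can be indexed by pairs of exponents; the enumeration \<open>h\<close> turns \<open>M\<close> into
  a square matrix.\<close>

lemma integral_if_stable_span:
  fixes v :: "'i \<Rightarrow> 'a::field"
  assumes A: "subring A (univ_ring :: 'a ring)" and I: "finite I"
    and M: "\<And>i j. i \<in> I \<Longrightarrow> j \<in> I \<Longrightarrow> M i j \<in> A"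
    and ev: "\<And>i. i \<in> I \<Longrightarrow> z * v i = (\<Sum>j\<in>I. M i j * v j)"
    and v: "i0 \<in> I" "v i0 \<noteq> 0"
  shows "\<exists>p. lead_coeff p = 1 \<and> coeffs_in A p \<and> poly p z = 0"
proof -
  obtain h where h: "bij_betw h {0..<card I} I" using ex_bij_betw_nat_finite[OF I] by blast
  have hI: "i < card I \<Longrightarrow> h i \<in> I" for i using bij_betwE[OF h] by simp
  obtain n0 where n0: "n0 < card I" "h n0 = i0"
    using h v(1) by (metis atLeastLessThan_iff bij_betw_iff_bijections)
  show ?thesis
  proof (rule integral_if_eigenvector[OF A, where M = "\<lambda>i j. M (h i) (h j)" and v = "\<lambda>i. v (h i)"
    and n = "card I" and z = z])
    show "(\<Sum>j<card I. M (h i) (h j) * v (h j)) = z * v (h i)" if "i < card I" for i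
      unfolding ev[OF hI[OF that]] lessThan_atLeast0
      by (rule sum.reindex_bij_betw[OF h, of "\<lambda>j. M (h i) j * v j"])
  qed (use hI M n0 v in auto)
qed

text \<open>
  The products \<open>x\<^sup>i y\<^sup>j\<close> are the entries of an eigenvector, for the eigenvalue \<open>x + y\<close> or
  \<open>x y\<close>, of a matrix over \<open>A\<close>, whose characteristic polynomial is monic over \<open>A\<close>.
\<close>

lemma integral_add_mult:
  fixes x y :: "'a::field"
  assumes A: "subring A (univ_ring :: 'a ring)"
    and p: "lead_coeff p = 1" "coeffs_in A p" "poly p x = 0"
    and q: "lead_coeff q = 1" "coeffs_in A q" "poly q y = 0"
  shows "\<exists>r. lead_coeff r = 1 \<and> coeffs_in A r \<and> poly r (x + y) = 0"
    and "\<exists>r. lead_coeff r = 1 \<and> coeffs_in A r \<and> poly r (x * y) = 0"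
proof -
  note cl = subring_closed[OF A]
  have sum: "(\<And>i. i \<in> I \<Longrightarrow> f i \<in> A) \<Longrightarrow> sum f I \<in> A" for f :: "'i \<Rightarrow> 'a" and I
    by (induction I rule: infinite_finite_induct) (auto intro: cl)
  \<comment> \<open>Companion matrix: multiplication by a root \<open>t\<close> shifts
    \<open>t ^ a\<close> to \<open>t ^ (a + 1)\<close>, except in the last row, where the equation
    of \<open>t\<close> rewrites the top power by lower ones.\<close>
  define C where "C = (\<lambda>(p :: 'a poly) a c. if Suc a < degree p then (if c = Suc a then 1 else 0)
    else - coeff p c)"
  have C_A: "C r a c \<in> A" if "coeffs_in A r" for r a c
    using that unfolding C_def coeffs_in_def by (auto intro: cl)
  have deg: "degree r > 0" if "lead_coeff r = 1" "poly r t = 0" for r :: "'a poly" and t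
    using that by (metis degree_eq_zeroE gr0I lead_coeff_pCons(2) one_neq_zero poly_const_conv
      coeff_pCons_0 degree_pCons_0)
  have C_ev: "t * t ^ a = (\<Sum>c<degree r. C r a c * t ^ c)"
    if r: "lead_coeff r = 1" "poly r t = 0" and a: "a < degree r" for r t a
  proof (cases "Suc a < degree r")
    case True
    then have "(\<Sum>c<degree r. C r a c * t ^ c) = (\<Sum>c<degree r. if c = Suc a then t ^ c else 0)"
      by (intro sum.cong) (auto simp: C_def)
    then show ?thesis using True by simp
  next
    case False
    with a have e: "Suc a = degree r" by simp
    have "0 = (\<Sum>c<Suc (degree r). coeff r c * t ^ c)"
      using r(2) unfolding poly_altdef lessThan_Suc_atMost by simp
    then have "t ^ degree r = - (\<Sum>c<degree r. coeff r c * t ^ c)"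
      using r(1) by (simp add: eq_neg_iff_add_eq_0 add.commute)
    moreover have "t * t ^ a = t ^ degree r" unfolding e[symmetric] by simp
    moreover have "(\<Sum>c<degree r. C r a c * t ^ c) = - (\<Sum>c<degree r. coeff r c * t ^ c)"
      using False by (simp add: C_def sum_negf)
    ultimately show ?thesis by simp
  qed
  define I where "I = Sigma {..<degree p} (\<lambda>_. {..<degree q})"
  define v where "v = (\<lambda>(a, b). x ^ a * y ^ b)"
  \<comment> \<open>Multiplication by \<open>x\<close> and by \<open>y\<close> on the monomials: the
    companion matrix acts on one exponent and the identity on the other.\<close>
  define MX where "MX = (\<lambda>(a :: nat, b :: nat) (c :: nat, d :: nat). if d = b then C p a c else 0)"
  define MY where "MY = (\<lambda>(a :: nat, b :: nat) (c :: nat, d :: nat). if c = a then C q b d else 0)"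
  have I: "finite I" "(0, 0) \<in> I" "v (0, 0) \<noteq> 0"
    using deg[OF p(1,3)] deg[OF q(1,3)] by (auto simp: I_def v_def)
  have XA: "MX i j \<in> A" and YA: "MY i j \<in> A" for i j
    using C_A[OF p(2)] C_A[OF q(2)] cl(1) by (auto simp: MX_def MY_def split: prod.splits)
  have MX: "x * v i = (\<Sum>j\<in>I. MX i j * v j)" if iI: "i \<in> I" for i
  proof -
    obtain a b where i: "i = (a, b)" "a < degree p" "b < degree q" using iI by (cases i) (auto simp: I_def)
    have "(\<Sum>j\<in>I. MX i j * v j) = (\<Sum>c<degree p. \<Sum>d<degree q. MX i (c, d) * v (c, d))"
      unfolding I_def by (simp add: sum.cartesian_product)
    also have "\<dots> = (\<Sum>c<degree p. \<Sum>d<degree q. if d = b then C p a c * (x ^ c * y ^ b) else 0)"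
      by (intro sum.cong) (auto simp: MX_def v_def i)
    also have "\<dots> = (\<Sum>c<degree p. C p a c * x ^ c) * y ^ b"
      using i by (simp add: sum_distrib_right mult.assoc)
    finally show ?thesis using C_ev[OF p(1,3) i(2)] by (simp add: v_def i mult.assoc[symmetric])
  qed
  have MY: "y * v i = (\<Sum>j\<in>I. MY i j * v j)" if iI: "i \<in> I" for i
  proof -
    obtain a b where i: "i = (a, b)" "a < degree p" "b < degree q" using iI by (cases i) (auto simp: I_def)
    have "(\<Sum>j\<in>I. MY i j * v j) = (\<Sum>d<degree q. \<Sum>c<degree p. MY i (c, d) * v (c, d))"
      unfolding I_def by (subst sum.swap) (simp add: sum.cartesian_product)
    also have "\<dots> = (\<Sum>d<degree q. \<Sum>c<degree p. if c = a then C q b d * (x ^ a * y ^ d) else 0)"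
      by (intro sum.cong) (auto simp: MY_def v_def i)
    also have "\<dots> = (\<Sum>d<degree q. C q b d * y ^ d) * x ^ a"
      using i by (simp add: sum_distrib_left mult.assoc mult.commute mult.left_commute)
    finally show ?thesis using C_ev[OF q(1,3) i(3)]
      by (simp add: v_def i mult.assoc mult.commute mult.left_commute)
  qed
  show "\<exists>r. lead_coeff r = 1 \<and> coeffs_in A r \<and> poly r (x + y) = 0"
    by (rule integral_if_stable_span[OF A I(1), where M = "\<lambda>i j. MX i j + MY i j" and v = v])
      (use I XA YA MX MY in \<open>auto simp: sum.distrib distrib_right intro: cl\<close>)
  \<comment> \<open>Multiplying by \<open>y\<close> and then by \<open>x\<close> corresponds to the
    matrix product of \<open>MY\<close> and \<open>MX\<close>.\<close>
  have XY: "x * y * v i = (\<Sum>j\<in>I. (\<Sum>l\<in>I. MY i l * MX l j) * v j)" if i: "i \<in> I" for i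
  proof -
    have "x * y * v i = (\<Sum>l\<in>I. MY i l * (x * v l))"
      using MY[OF i] by (simp add: mult.assoc sum_distrib_left mult.left_commute)
    also have "\<dots> = (\<Sum>l\<in>I. \<Sum>j\<in>I. MY i l * MX l j * v j)"
      by (intro sum.cong) (simp_all add: MX sum_distrib_left mult.assoc)
    also have "\<dots> = (\<Sum>j\<in>I. (\<Sum>l\<in>I. MY i l * MX l j) * v j)"
      by (subst sum.swap) (simp add: sum_distrib_right)
    finally show ?thesis .
  qed
  show "\<exists>r. lead_coeff r = 1 \<and> coeffs_in A r \<and> poly r (x * y) = 0"
    by (rule integral_if_stable_span[OF A I(1), where M = "\<lambda>i j. \<Sum>l\<in>I. MY i l * MX l j" and v = v])
      (use I XA YA XY in \<open>auto intro!: sum intro: cl\<close>)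
qed

lemma integral_closure_mono: "A \<subseteq> A' \<Longrightarrow> E \<subseteq> E' \<Longrightarrow> integral_closure A E \<subseteq> integral_closure A' E'"
  unfolding integral_closure_def by (auto intro: coeffs_in_mono)

lemma subset_integral_closure:
  assumes "subring A (univ_ring :: 'a::field ring)" "A \<subseteq> E" shows "A \<subseteq> integral_closure A E"
proof
  fix a assume "a \<in> A"
  then show "a \<in> integral_closure A E"
    using assms subring_closed[OF assms(1)] unfolding integral_closure_def
    by (auto intro!: exI[of _ "[:- a, 1:]"])
qed

lemma subring_integral_closure:
  assumes A: "subring A (univ_ring :: 'a::field ring)" and E: "subring E univ_ring" and AE: "A \<subseteq> E"
  shows "subring (integral_closure A E) univ_ring"
proof -
  have sub: "A \<subseteq> integral_closure A E" by (rule subset_integral_closure[OF A AE])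
  have mult: "a * b \<in> integral_closure A E" if "a \<in> integral_closure A E" "b \<in> integral_closure A E" for a b
    using that integral_add_mult(2)[OF A] subring_closed(6)[OF E]
    unfolding integral_closure_def by blast
  have add: "a + b \<in> integral_closure A E" if "a \<in> integral_closure A E" "b \<in> integral_closure A E" for a b
    using that integral_add_mult(1)[OF A] subring_closed(4)[OF E]
    unfolding integral_closure_def by blast
  have one: "1 \<in> integral_closure A E" "-1 \<in> integral_closure A E"
    using sub subring_closed(2,3)[OF A] by auto
  have "- a \<in> integral_closure A E" if "a \<in> integral_closure A E" for a
    using mult[OF one(2) that] by simp
  then show ?thesis unfolding subring_univ_iff using mult add one(1) by blast
qed

section \<open>Quadratic extensions\<close>

text \<open>Coordinates instead of \<open>adjoin\<close>: \<open>z\<close> may lie in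
  \<open>L\<close>, which gives \<open>L\<close> back, so that one form covers all extensions of
  degree at most 2; and \<open>L\<close> may be a mere ring, which gives rings such as
  \<open>K[x] + K[x] Z\<close>.\<close>

definition quad_ext :: "'a::field set \<Rightarrow> 'a \<Rightarrow> 'a set" where
  "quad_ext L z = {a + b * z | a b. a \<in> L \<and> b \<in> L}"

lemma quad_extI: "a \<in> L \<Longrightarrow> b \<in> L \<Longrightarrow> a + b * z \<in> quad_ext L z"
  unfolding quad_ext_def by blast

lemma quad_extE:
  assumes "x \<in> quad_ext L z" obtains a b where "a \<in> L" "b \<in> L" "x = a + b * z"
  using assms unfolding quad_ext_def by blast

context
  fixes L :: "'a::field set" and z :: 'a
  assumes L: "subfield L univ_ring" and z: "z ^ 2 \<in> L"
begin

private lemmas cl = subfield_closed[OF L]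

lemma base_subset_quad_ext: "L \<subseteq> quad_ext L z"
proof
  fix a assume "a \<in> L"
  then show "a \<in> quad_ext L z" using quad_extI[of a L 0 z] cl(1) by simp
qed

lemma root_in_quad_ext: "z \<in> quad_ext L z"
  using quad_extI[of 0 L 1 z] cl(1,2) by simp

lemma quad_ext_trivial: "z \<in> L \<Longrightarrow> quad_ext L z = L"
  using base_subset_quad_ext by (auto elim!: quad_extE intro: cl)

lemma quad_coords_unique:
  assumes "z \<notin> L" "a \<in> L" "b \<in> L" "a' \<in> L" "b' \<in> L" "a + b * z = a' + b' * z"
  shows "a = a'" "b = b'"
proof -
  have "(b - b') * z = a' - a" using assms(6) by (simp add: algebra_simps)
  then have "z = (a' - a) / (b - b')" if "b \<noteq> b'" using that by (simp add: field_simps)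
  then show "b = b'" using assms cl(5,11) by metis
  then show "a = a'" using assms(6) by simp
qed

lemma subfield_quad_ext: "subfield (quad_ext L z) univ_ring"
proof (rule subfieldI_univ)
  show "1 \<in> quad_ext L z" using base_subset_quad_ext cl(2) by blast
next
  fix x assume "x \<in> quad_ext L z"
  then obtain a b where x: "a \<in> L" "b \<in> L" "x = a + b * z" by (rule quad_extE)
  show "- x \<in> quad_ext L z" using quad_extI[OF cl(3)[OF x(1)] cl(3)[OF x(2)], of z] x(3) by simp
  show "inverse x \<in> quad_ext L z"
  proof (cases "z \<in> L")
    case True
    then show ?thesis using x cl by (simp add: quad_ext_trivial)
  next
    case False
    \<comment> \<open>The norm of \<open>x\<close>. The conjugate is nonzero by uniqueness of
      coordinates, so the inverse of \<open>x\<close> is the conjugate divided by the norm.\<close>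
    let ?n = "a ^ 2 - b ^ 2 * z ^ 2"
    have n: "?n \<in> L" by (intro cl x z)
    have fac: "?n = (a + b * z) * (a - b * z)" by (simp add: algebra_simps power2_eq_square)
    show ?thesis
    proof (cases "x = 0")
      case True
      then show ?thesis using base_subset_quad_ext cl(1) by auto
    next
      case x0: False
      have "a - b * z \<noteq> 0"
      proof
        assume "a - b * z = 0"
        then have "a + (- b) * z = 0 + 0 * z" by simp
        from quad_coords_unique[OF False x(1) cl(3)[OF x(2)] cl(1) cl(1) this] x(3) x0
        show False by simp
      qed
      then have "inverse x = (a - b * z) / ?n"
        using x0 unfolding fac x(3) by (simp add: divide_simps)
      also have "\<dots> = a / ?n + (- b / ?n) * z" by (simp add: diff_divide_distrib)
      finally have "inverse x = a / ?n + (- b / ?n) * z" .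
      then show ?thesis using quad_extI[of "a / ?n" L "- b / ?n" z] n x cl by metis
    qed
  qed
  fix y assume "y \<in> quad_ext L z"
  then obtain c d where y: "c \<in> L" "d \<in> L" "y = c + d * z" by (rule quad_extE)
  have "x + y = (a + c) + (b + d) * z" unfolding x y by (simp add: algebra_simps)
  then show "x + y \<in> quad_ext L z" using quad_extI[of "a + c" L "b + d" z] cl x y by metis
  have "x * y = (a * c + b * d * z ^ 2) + (a * d + b * c) * z"
    unfolding x y by (simp add: algebra_simps power2_eq_square)
  then show "x * y \<in> quad_ext L z"
    using quad_extI[of "a * c + b * d * z ^ 2" L "a * d + b * c" z] cl x y z by metis
qed

lemma quad_ext_least:
  assumes "subring E univ_ring" "L \<subseteq> E" "z \<in> E" shows "quad_ext L z \<subseteq> E"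
proof
  fix x assume "x \<in> quad_ext L z"
  then obtain a b where "a \<in> L" "b \<in> L" "x = a + b * z" by (rule quad_extE)
  then show "x \<in> E" using assms(2,3) subring_closed(4)[OF assms(1) _ subring_closed(6)[OF assms(1)]] by blast
qed

text \<open>Connects the fields of the theorem and the splitting fields, which adjoin all square
  roots of an element, with coordinates relative to one chosen root; the other root is
  \<open>- z\<close>.\<close>

lemma adjoin_sqrt_eq_quad_ext: "adjoin L {y. y ^ 2 = z ^ 2} = quad_ext L z"
proof -
  have "{y. y ^ 2 = z ^ 2} = {z, - z}" by (auto simp: power2_eq_iff)
  moreover have "- z \<in> quad_ext L z" using subfield_closed(3)[OF subfield_quad_ext root_in_quad_ext] .
  ultimately show ?thesis
    using adjoin_superset[of L "{z, - z}"] root_in_quad_ext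
    by (intro adjoin_eqI subfield_quad_ext base_subset_quad_ext quad_ext_least
        subfield_subring[OF adjoin_subfield]) auto
qed

lemma quad_ext_eq_Span: "quad_ext L z = ring.Span univ_ring L [1, z]"
proof -
  interpret Ring.field "univ_ring :: 'a ring" by (rule field_from_type_algebra)
  have z: "line_extension L z {0} = (\<lambda>b. b * z) ` L"
    unfolding line_extension_mem_iff set_eq_iff by (auto simp: image_iff)
  have "line_extension L 1 ((\<lambda>b. b * z) ` L) = quad_ext L z"
    unfolding line_extension_mem_iff set_eq_iff quad_ext_def by (auto simp: image_iff)
  with z show ?thesis by simp
qed

lemma finite_dimension_quad_ext: "ring.finite_dimension univ_ring L (quad_ext L z)"
proof -
  interpret Ring.field "univ_ring :: 'a ring" by (rule field_from_type_algebra)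
  show ?thesis unfolding quad_ext_eq_Span by (rule Span_finite_dimension[OF L]) simp
qed

lemma dimension_quad_ext: "z \<notin> L \<Longrightarrow> ring.dimension univ_ring 2 L (quad_ext L z)"
proof -
  interpret Ring.field "univ_ring :: 'a ring" by (rule field_from_type_algebra)
  assume zL: "z \<notin> L"
  have "dimension (Suc (Suc 0)) L (line_extension L 1 (line_extension L z {0}))"
  proof (intro dimension.Suc_dim)
    show "dimension 0 L {0}" using zero_dim[of L] by simp
    show "z \<notin> {0}" using zL cl(1) by auto
    show "1 \<notin> line_extension L z {0}"
    proof
      assume "1 \<in> line_extension L z {0}"
      then obtain k where "k \<in> L" "1 = k * z" by (auto simp: line_extension_mem_iff)
      then have "z = inverse k" by (metis inverse_unique)
      then show False using \<open>k \<in> L\<close> zL cl(10) by auto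
    qed
  qed auto
  then show ?thesis unfolding quad_ext_eq_Span by (simp add: numeral_2_eq_2)
qed

end

text \<open>\<open>THE\<close> is meaningful when \<open>z \<notin> L\<close>, since the coordinates
  are then unique.\<close>

definition quad_conj :: "'a::field set \<Rightarrow> 'a \<Rightarrow> 'a \<Rightarrow> 'a" where
  "quad_conj L z x = (THE y. \<exists>a\<in>L. \<exists>b\<in>L. x = a + b * z \<and> y = a - b * z)"

lemma carrier_Gal:
  "carrier (Gal E L) = {\<sigma> \<in> Bij E. (\<forall>x\<in>E. \<forall>y\<in>E. \<sigma> (x * y) = \<sigma> x * \<sigma> y) \<and>
     (\<forall>x\<in>E. \<forall>y\<in>E. \<sigma> (x + y) = \<sigma> x + \<sigma> y) \<and> \<sigma> 1 = 1 \<and> (\<forall>x\<in>L. \<sigma> x = (x :: 'a::field))}"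
  unfolding Gal_def Ring.ring_hom_def by (auto simp: Bij_def bij_betw_def)

lemma one_Gal [simp]: "\<one>\<^bsub>Gal E L\<^esub> = (\<lambda>x\<in>E. x)"
  by (simp add: Gal_def BijGroup_def)

lemma mult_Gal [simp]:
  "\<sigma> \<in> Bij E \<Longrightarrow> \<tau> \<in> Bij E \<Longrightarrow> \<sigma> \<otimes>\<^bsub>Gal E L\<^esub> \<tau> = compose E \<sigma> \<tau>"
  by (simp add: Gal_def BijGroup_def)

lemma id_in_Gal: "subfield E (univ_ring :: 'a::field ring) \<Longrightarrow> L \<subseteq> E \<Longrightarrow> (\<lambda>x\<in>E. x) \<in> carrier (Gal E L)"
  unfolding carrier_Gal by (auto simp: Bij_def bij_betw_def inj_on_def intro: subfield_closed)

lemma Gal_self: 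
  assumes "subfield L (univ_ring :: 'a::field ring)" shows "carrier (Gal L L) = {\<lambda>x\<in>L. x}"
proof -
  have "\<sigma> = (\<lambda>x\<in>L. x)" if "\<sigma> \<in> carrier (Gal L L)" for \<sigma>
    using that unfolding carrier_Gal Bij_def by (auto intro: extensionalityI)
  then show ?thesis using id_in_Gal[OF assms order_refl] by blast
qed

lemma galois_extension_self:
  assumes L: "subfield L (univ_ring :: 'a::field ring)" shows "galois_extension L L"
proof -
  have "ring.finite_dimension univ_ring L L"
    using finite_dimension_quad_ext[OF L, of 0] quad_ext_trivial[OF L, of 0] subfield_closed(1)[OF L]
    by simp
  then show ?thesis using L by (auto simp: galois_extension_def Gal_self[OF L])
qed

context
  fixes L :: "'a::field set" and z :: 'a
  assumes L: "subfield L univ_ring" and z: "z ^ 2 \<in> L" and zL: "z \<notin> L" and two: "(2::'a) \<noteq> 0"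
begin

private lemmas cl' = subfield_closed[OF L]

lemma quad_conj_eq: "a \<in> L \<Longrightarrow> b \<in> L \<Longrightarrow> quad_conj L z (a + b * z) = a - b * z"
  unfolding quad_conj_def using quad_coords_unique[OF L z zL] by (intro the_equality) blast+

text \<open>An automorphism over \<open>L\<close> is determined by its value at \<open>z\<close>,
  whose square must be \<open>z ^ 2\<close>; this leaves \<open>z\<close> and
  \<open>- z\<close>.\<close>

lemma carrier_Gal_quad_ext:
  "carrier (Gal (quad_ext L z) L) = {\<lambda>x\<in>quad_ext L z. x, \<lambda>x\<in>quad_ext L z. quad_conj L z x}"
    (is "_ = {?id, ?\<sigma>}")
proof -
  let ?E = "quad_ext L z"
  note E = subfield_quad_ext[OF L z]
  have conj_in: "quad_conj L z x \<in> ?E" if "x \<in> ?E" for x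
  proof -
    obtain a b where x: "a \<in> L" "b \<in> L" "x = a + b * z" using \<open>x \<in> ?E\<close> by (rule quad_extE)
    then show ?thesis using quad_conj_eq[OF x(1,2)] quad_extI[OF x(1) cl'(3)[OF x(2)], of z] by simp
  qed
  have conj_conj: "quad_conj L z (quad_conj L z x) = x" if "x \<in> ?E" for x
  proof -
    obtain a b where x: "a \<in> L" "b \<in> L" "x = a + b * z" using \<open>x \<in> ?E\<close> by (rule quad_extE)
    then show ?thesis using quad_conj_eq[OF x(1,2)] quad_conj_eq[OF x(1) cl'(3)[OF x(2)]] by simp
  qed
  have "?\<sigma> \<in> carrier (Gal ?E L)"
    unfolding carrier_Gal
  proof (intro CollectI conjI ballI)
    have "bij_betw ?\<sigma> ?E ?E"
      by (rule bij_betwI[where g = "quad_conj L z"]) (auto simp: conj_in conj_conj)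
    then show "?\<sigma> \<in> Bij ?E" by (simp add: Bij_def)
    show "?\<sigma> x = x" if "x \<in> L" for x
      using that base_subset_quad_ext[OF L z] quad_conj_eq[OF that cl'(1)] by auto
    then show "?\<sigma> 1 = 1" using cl'(2) by blast
    fix x y assume xy: "x \<in> ?E" "y \<in> ?E"
    obtain a b where x: "a \<in> L" "b \<in> L" "x = a + b * z" using xy(1) by (rule quad_extE)
    obtain c d where y: "c \<in> L" "d \<in> L" "y = c + d * z" using xy(2) by (rule quad_extE)
    have s: "x + y = (a + c) + (b + d) * z" unfolding x y by (simp add: algebra_simps)
    show "?\<sigma> (x + y) = ?\<sigma> x + ?\<sigma> y"
      using xy subfield_closed(4)[OF E xy] quad_conj_eq[OF x(1,2)] quad_conj_eq[OF y(1,2)]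
        quad_conj_eq[OF cl'(4)[OF x(1) y(1)] cl'(4)[OF x(2) y(2)]]
      by (simp add: s[symmetric] x(3)[symmetric] y(3)[symmetric]) (simp add: x y algebra_simps)
    have m: "x * y = (a * c + b * d * z ^ 2) + (a * d + b * c) * z"
      unfolding x y by (simp add: algebra_simps power2_eq_square)
    have "a * c + b * d * z ^ 2 \<in> L" "a * d + b * c \<in> L" by (intro cl' x y z)+
    from quad_conj_eq[OF this] show "?\<sigma> (x * y) = ?\<sigma> x * ?\<sigma> y"
      using xy subfield_closed(6)[OF E xy] quad_conj_eq[OF x(1,2)] quad_conj_eq[OF y(1,2)]
      by (simp add: m[symmetric] x(3)[symmetric] y(3)[symmetric])
        (simp add: x y algebra_simps power2_eq_square)
  qed
  moreover have "?id \<in> carrier (Gal ?E L)" using id_in_Gal[OF E base_subset_quad_ext[OF L z]] .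
  moreover have "\<tau> = ?id \<or> \<tau> = ?\<sigma>" if \<tau>: "\<tau> \<in> carrier (Gal ?E L)" for \<tau>
  proof -
    have zE: "z \<in> ?E" using root_in_quad_ext[OF L z] .
    have ext: "\<tau> \<in> extensional ?E" using \<tau> unfolding carrier_Gal Bij_def by auto
    have "\<tau> z ^ 2 = \<tau> (z ^ 2)" using \<tau> zE unfolding carrier_Gal power2_eq_square by auto
    also have "\<dots> = z ^ 2" using \<tau> z unfolding carrier_Gal by auto
    finally have tz: "\<tau> z = z \<or> \<tau> z = - z" by (simp add: power2_eq_iff)
    have t: "\<tau> (a + b * z) = a + b * \<tau> z" if "a \<in> L" "b \<in> L" for a b
    proof -
      have "a \<in> ?E" "b \<in> ?E" "b * z \<in> ?E"
        using that base_subset_quad_ext[OF L z] zE subfield_closed(6)[OF E] by auto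
      then show ?thesis using \<tau> that zE unfolding carrier_Gal by auto
    qed
    show ?thesis
    proof (cases "\<tau> z = z")
      case True
      have "\<tau> = ?id"
        by (rule extensionalityI[OF ext]) (auto elim!: quad_extE simp: t True)
      then show ?thesis ..
    next
      case False
      with tz have tz: "\<tau> z = - z" by simp
      have "\<tau> = ?\<sigma>"
        by (rule extensionalityI[OF ext]) (auto elim!: quad_extE simp: t tz quad_conj_eq)
      then show ?thesis ..
    qed
  qed
  ultimately show ?thesis by blast
qed

lemma quad_conj_not_id: "(\<lambda>x\<in>quad_ext L z. quad_conj L z x) \<noteq> (\<lambda>x\<in>quad_ext L z. x)"
proof
  assume e: "(\<lambda>x\<in>quad_ext L z. quad_conj L z x) = (\<lambda>x\<in>quad_ext L z. x)"
  have "quad_conj L z z = z" using fun_cong[OF e, of z] root_in_quad_ext[OF L z] by simp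
  moreover have "quad_conj L z z = - z" using quad_conj_eq[OF cl'(1,2)] by simp
  ultimately have "2 * z = 0" by simp
  then show False using two zL cl'(1) by auto
qed

lemma card_Gal_quad_ext: "card (carrier (Gal (quad_ext L z) L)) = 2"
  unfolding carrier_Gal_quad_ext using quad_conj_not_id by (metis card_2_iff)

lemma group_Gal_quad_ext: "group (Gal (quad_ext L z) L)"
proof -
  let ?E = "quad_ext L z" and ?\<sigma> = "\<lambda>x\<in>quad_ext L z. quad_conj L z x"
  interpret B: group "BijGroup ?E" by (rule group_BijGroup)
  have sub: "carrier (Gal ?E L) \<subseteq> Bij ?E" unfolding carrier_Gal by blast
  then have s: "?\<sigma> \<in> Bij ?E" "(\<lambda>x\<in>?E. x) \<in> Bij ?E" unfolding carrier_Gal_quad_ext by auto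
  have ss: "compose ?E ?\<sigma> ?\<sigma> = (\<lambda>x\<in>?E. x)"
  proof (rule extensionalityI[of _ ?E])
    fix x assume xE: "x \<in> ?E"
    then obtain a b where x: "a \<in> L" "b \<in> L" "x = a + b * z" by (rule quad_extE)
    have "a - b * z \<in> ?E" using quad_extI[OF x(1) cl'(3)[OF x(2)], of z] by simp
    then show "compose ?E ?\<sigma> ?\<sigma> x = (\<lambda>x\<in>?E. x) x"
      using xE quad_conj_eq[OF x(1,2)] quad_conj_eq[OF x(1) cl'(3)[OF x(2)]]
        by (simp add: compose_def x(3)[symmetric])
  qed (auto simp: compose_def)
  have one: "\<one>\<^bsub>BijGroup ?E\<^esub> = (\<lambda>x\<in>?E. x)" by (simp add: BijGroup_def)
  have c: "carrier (BijGroup ?E) = Bij ?E" by (simp add: BijGroup_def)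
  have ss': "?\<sigma> \<otimes>\<^bsub>BijGroup ?E\<^esub> ?\<sigma> = \<one>\<^bsub>BijGroup ?E\<^esub>"
    using s ss by (simp add: BijGroup_def)
  have inv: "inv\<^bsub>BijGroup ?E\<^esub> ?\<sigma> = ?\<sigma>" using B.inv_equality[OF ss'] s c by simp
  have "subgroup {\<lambda>x\<in>?E. x, ?\<sigma>} (BijGroup ?E)"
  proof (rule B.subgroupI)
    show "{\<lambda>x\<in>?E. x, ?\<sigma>} \<subseteq> carrier (BijGroup ?E)" using s c by auto
    show "inv\<^bsub>BijGroup ?E\<^esub> a \<in> {\<lambda>x\<in>?E. x, ?\<sigma>}" if "a \<in> {\<lambda>x\<in>?E. x, ?\<sigma>}" for a
      using that inv B.inv_one one by auto
    show "a \<otimes>\<^bsub>BijGroup ?E\<^esub> b \<in> {\<lambda>x\<in>?E. x, ?\<sigma>}"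
      if "a \<in> {\<lambda>x\<in>?E. x, ?\<sigma>}" "b \<in> {\<lambda>x\<in>?E. x, ?\<sigma>}" for a b
      using that ss' s c B.l_one[of ?\<sigma>] B.r_one[of ?\<sigma>] B.l_one[of "\<one>\<^bsub>BijGroup ?E\<^esub>"] unfolding one by auto
  qed simp
  from B.subgroup_imp_group[OF this] show ?thesis
    using carrier_Gal_quad_ext unfolding Gal_def by simp
qed

lemma galois_extension_quad_ext: "galois_extension L (quad_ext L z)"
proof -
  let ?E = "quad_ext L z"
  have "x \<in> L" if x: "x \<in> ?E" "\<forall>\<sigma>\<in>carrier (Gal ?E L). \<sigma> x = x" for x
  proof -
    obtain a b where ab: "a \<in> L" "b \<in> L" "x = a + b * z" using x(1) by (rule quad_extE)
    have "quad_conj L z x = x" using x unfolding carrier_Gal_quad_ext by auto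
    then have "2 * (b * z) = 0" using quad_conj_eq[OF ab(1,2)] ab(3) by simp
    then have "b * z = 0" using two by simp
    then have "x = a" using ab(3) by simp
    then show ?thesis using ab(1) by simp
  qed
  moreover have "\<sigma> x = x" if "x \<in> L" "\<sigma> \<in> carrier (Gal ?E L)" for x \<sigma>
    using that unfolding carrier_Gal by auto
  ultimately show ?thesis unfolding galois_extension_def
    using L subfield_quad_ext[OF L z] base_subset_quad_ext[OF L z] finite_dimension_quad_ext[OF L z]
    by blast
qed

end

lemma Gal_compose:
  assumes "\<sigma> \<in> carrier (Gal E L)" "\<tau> \<in> carrier (Gal E L)" "subfield E (univ_ring :: 'a::field ring)" "L \<subseteq> E"
  shows "compose E \<sigma> \<tau> \<in> carrier (Gal E L)"
proof -
  have E: "\<tau> x \<in> E" if "x \<in> E" for x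
    using assms(2) that unfolding carrier_Gal Bij_def bij_betw_def by auto
  have "compose E \<sigma> \<tau> \<in> Bij E"
    using assms(1,2) compose_Bij unfolding carrier_Gal by blast
  then show ?thesis
    using assms(1,2) E subfield_closed[OF assms(3)] assms(4) unfolding carrier_Gal
    by (auto simp: compose_def)
qed

text \<open>Kummer theory in degree 2. If \<open>\<sigma>\<close> moves \<open>e\<close>, then
  \<open>z = e - \<sigma> e\<close> changes sign under \<open>\<sigma>\<close>, so
  \<open>z ^ 2\<close> is fixed and lies in \<open>L\<close>. Any \<open>x\<close> is the sum of its
  invariant half \<open>(x + \<sigma> x) / 2\<close> and its anti-invariant half, and the latter is
  an invariant multiple of \<open>z\<close>.\<close>

lemma galois_extension_small_group:
  fixes L E :: "'a::field set"
  assumes gal: "galois_extension L E" and card: "card (carrier (Gal E L)) \<in> {1, 2}" and two: "(2::'a) \<noteq> 0"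
  shows "\<exists>z. z ^ 2 \<in> L \<and> E = quad_ext L z"
proof -
  have L: "subfield L univ_ring" and E: "subfield E univ_ring" and LE: "L \<subseteq> E"
    and fix_L: "\<And>x. x \<in> E \<Longrightarrow> (\<And>\<sigma>. \<sigma> \<in> carrier (Gal E L) \<Longrightarrow> \<sigma> x = x) \<Longrightarrow> x \<in> L"
    using gal unfolding galois_extension_def by blast+
  note id = id_in_Gal[OF E LE]
  note clE = subfield_closed[OF E]
  show ?thesis
  proof (cases "carrier (Gal E L) = {\<lambda>x\<in>E. x}")
    case True
    then have "E = L" using fix_L LE by auto
    then show ?thesis using quad_ext_trivial[OF L, of 0] subfield_closed(1)[OF L]
      by (intro exI[of _ 0]) simp
  next
    case False
    then obtain \<sigma> where \<sigma>: "\<sigma> \<in> carrier (Gal E L)" "\<sigma> \<noteq> (\<lambda>x\<in>E. x)" using id by blast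
    have "card (carrier (Gal E L)) = 2"
    proof (rule ccontr)
      assume "card (carrier (Gal E L)) \<noteq> 2"
      with card have "card (carrier (Gal E L)) = 1" by simp
      then show False using id \<sigma> by (metis card_1_singletonE singletonD)
    qed
    then obtain \<alpha> \<beta> where "carrier (Gal E L) = {\<alpha>, \<beta>}" by (metis card_2_iff)
    then have car: "carrier (Gal E L) = {\<lambda>x\<in>E. x, \<sigma>}" using id \<sigma> by auto
    have sE: "\<sigma> x \<in> E" if "x \<in> E" for x using \<sigma>(1) that unfolding carrier_Gal Bij_def bij_betw_def by auto
    have ext: "\<sigma> \<in> extensional E" and inj: "inj_on \<sigma> E"
      using \<sigma>(1) unfolding carrier_Gal Bij_def bij_betw_def by auto
    have hom: "\<And>x y. x \<in> E \<Longrightarrow> y \<in> E \<Longrightarrow> \<sigma> (x + y) = \<sigma> x + \<sigma> y"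
      "\<And>x y. x \<in> E \<Longrightarrow> y \<in> E \<Longrightarrow> \<sigma> (x * y) = \<sigma> x * \<sigma> y" "\<And>x. x \<in> L \<Longrightarrow> \<sigma> x = x"
      using \<sigma>(1) unfolding carrier_Gal by auto
    obtain e where e: "e \<in> E" "\<sigma> e \<noteq> e"
      using \<sigma>(2) ext extensionalityI[of \<sigma> E "\<lambda>x\<in>E. x"] by auto
    have ss: "\<sigma> (\<sigma> x) = x" if "x \<in> E" for x
    proof -
      have "compose E \<sigma> \<sigma> \<in> {\<lambda>x\<in>E. x, \<sigma>}" using Gal_compose[OF \<sigma>(1) \<sigma>(1) E LE] car by simp
      moreover have "compose E \<sigma> \<sigma> \<noteq> \<sigma>"
      proof
        assume "compose E \<sigma> \<sigma> = \<sigma>"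
        then have "\<sigma> (\<sigma> e) = \<sigma> e" using e(1) by (metis compose_eq)
        then show False using inj_onD[OF inj _ sE[OF e(1)] e(1)] e(2) by simp
      qed
      ultimately have "compose E \<sigma> \<sigma> = (\<lambda>x\<in>E. x)" by simp
      then show ?thesis using that by (metis compose_eq restrict_apply')
    qed
    have sneg: "\<sigma> (- x) = - \<sigma> x" if "x \<in> E" for x
    proof -
      have "\<sigma> (- 1) = - 1" using hom(3) subfield_closed(2,3)[OF L] by blast
      then show ?thesis using hom(2)[OF clE(3)[OF clE(2)] that] by simp
    qed
    have fixL: "x \<in> L" if "x \<in> E" "\<sigma> x = x" for x
    proof (rule fix_L[OF that(1)])
      fix \<tau> assume "\<tau> \<in> carrier (Gal E L)"
      then show "\<tau> x = x" using that unfolding car by auto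
    qed
    define z where "z = e - \<sigma> e"
    have z: "z \<in> E" "z \<noteq> 0" using e sE clE unfolding z_def by auto
    have sz: "\<sigma> z = - z"
      unfolding z_def using hom(1)[OF e(1) clE(3)[OF sE[OF e(1)]]] sneg[OF sE[OF e(1)]] ss[OF e(1)] by simp
    have z2: "z ^ 2 \<in> L" using fixL[of "z ^ 2"] hom(2)[OF z(1) z(1)] sz clE(6)[OF z(1) z(1)]
      by (simp add: power2_eq_square)
    have "x \<in> quad_ext L z" if x: "x \<in> E" for x
    proof -
      let ?a = "(x + \<sigma> x) / 2" and ?b = "(x - \<sigma> x) / (2 * z)"
      have two': "2 \<in> L" using subfield_closed(9)[OF L] by blast
      have s2: "\<sigma> (inverse 2) = inverse 2" using hom(3) subfield_closed(10)[OF L two'] by blast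
      have half: "inverse 2 \<in> E" using LE subfield_closed(10)[OF L two'] by blast
      have sum: "x + \<sigma> x \<in> E" "x - \<sigma> x \<in> E" using clE sE[OF x] x by auto
      have "\<sigma> (x + \<sigma> x) = x + \<sigma> x" using hom(1)[OF x sE[OF x]] ss[OF x] by (simp add: add.commute)
      then have "\<sigma> ?a = ?a"
        using hom(2)[OF sum(1) half] s2 unfolding field_class.field_divide_inverse by metis
      moreover have "?a \<in> E"
        using clE(6)[OF sum(1) half] unfolding field_class.field_divide_inverse .
      ultimately have a: "?a \<in> L" using fixL by blast
      have sd: "\<sigma> (x - \<sigma> x) = - (x - \<sigma> x)"
        using hom(1)[OF x clE(3)[OF sE[OF x]]] sneg[OF sE[OF x]] ss[OF x] by simp
      have iz: "inverse z \<in> E" using clE(10)[OF z(1)] .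
      have "\<sigma> (z * inverse z) = 1" using z hom(3) subfield_closed(2)[OF L] by simp
      then have "- z * \<sigma> (inverse z) = 1" using hom(2)[OF z(1) iz] sz by simp
      then have siz: "\<sigma> (inverse z) = - inverse z"
        using inverse_unique[of "- z" "\<sigma> (inverse z)"] by simp
      have b_eq: "?b = (x - \<sigma> x) * inverse z * inverse 2"
        unfolding field_class.field_divide_inverse inverse_mult_distrib by (simp only: ac_simps)
      have "\<sigma> ((x - \<sigma> x) * inverse z) = (x - \<sigma> x) * inverse z"
        unfolding hom(2)[OF sum(2) iz] sd siz by (rule minus_mult_minus)
      then have "\<sigma> ?b = ?b"
        unfolding b_eq hom(2)[OF clE(6)[OF sum(2) iz] half] s2 by simp
      moreover have "?b \<in> E" unfolding b_eq using clE(6)[OF clE(6)[OF sum(2) iz] half] .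
      ultimately have b: "?b \<in> L" using fixL by blast
      have "?a + ?b * z = (x + \<sigma> x) / 2 + (x - \<sigma> x) / 2" using z(2) by simp
      also have "\<dots> = 2 * x / 2" unfolding add_divide_distrib[symmetric] by simp
      also have "\<dots> = x" by (rule nonzero_mult_div_cancel_left[OF two])
      finally have "?a + ?b * z = x" .
      then show ?thesis using quad_extI[OF a b, of z] by simp
    qed
    moreover have "quad_ext L z \<subseteq> E" by (rule quad_ext_least[OF L z2 subfield_subring[OF E] LE z(1)])
    ultimately show ?thesis using z2 by blast
  qed
qed

lemma two_element_groups_iso:
  assumes G: "group G" and H: "group H" and "card (carrier G) = 2" "card (carrier H) = 2"
  shows "G \<cong> H"
proof -
  interpret G: group G by fact
  interpret H: group H by fact
  have ex: "\<exists>x. carrier K = {\<one>\<^bsub>K\<^esub>, x} \<and> x \<noteq> \<one>\<^bsub>K\<^esub> \<and> x \<otimes>\<^bsub>K\<^esub> x = \<one>\<^bsub>K\<^esub>"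
    if gK: "group K" and cK: "card (carrier K) = 2" for K :: "('z, 'w) monoid_scheme"
  proof -
    interpret group K by fact
    obtain a b where ab: "carrier K = {a, b}" "a \<noteq> b" using cK by (metis card_2_iff)
    have one: "\<one>\<^bsub>K\<^esub> \<in> {a, b}" using one_closed ab by simp
    then obtain x where x: "carrier K = {\<one>\<^bsub>K\<^esub>, x}" "x \<noteq> \<one>\<^bsub>K\<^esub>" using ab by auto
    have xc: "x \<in> carrier K" using x(1) by simp
    then have "x \<otimes>\<^bsub>K\<^esub> x \<in> {\<one>\<^bsub>K\<^esub>, x}" using m_closed[of x x] x(1) by simp
    moreover have "x \<otimes>\<^bsub>K\<^esub> x \<noteq> x" using l_cancel_one[OF xc xc] x(2) by simp
    ultimately show ?thesis using x by blast
  qed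
  obtain x where x: "carrier G = {\<one>\<^bsub>G\<^esub>, x}" "x \<noteq> \<one>\<^bsub>G\<^esub>" "x \<otimes>\<^bsub>G\<^esub> x = \<one>\<^bsub>G\<^esub>" using ex[OF G assms(3)] by blast
  obtain y where y: "carrier H = {\<one>\<^bsub>H\<^esub>, y}" "y \<noteq> \<one>\<^bsub>H\<^esub>" "y \<otimes>\<^bsub>H\<^esub> y = \<one>\<^bsub>H\<^esub>" using ex[OF H assms(4)] by blast
  have xy: "x \<in> carrier G" "y \<in> carrier H" using x y by auto
  let ?h = "\<lambda>a. if a = x then y else \<one>\<^bsub>H\<^esub>"
  have "bij_betw ?h (carrier G) (carrier H)"
    unfolding x(1) y(1) bij_betw_def inj_on_def using x(2) y(2) by auto
  moreover have "?h \<in> hom G H"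
    by (rule homI) (use x y xy in \<open>auto simp: x(1) y(1)\<close>)
  ultimately show ?thesis unfolding is_iso_def iso_def by blast
qed

lemma trivial_groups_iso:
  assumes "carrier G = {\<one>\<^bsub>G\<^esub>}" "carrier H = {\<one>\<^bsub>H\<^esub>}" "\<one>\<^bsub>G\<^esub> \<otimes>\<^bsub>G\<^esub> \<one>\<^bsub>G\<^esub> = \<one>\<^bsub>G\<^esub>" "\<one>\<^bsub>H\<^esub> \<otimes>\<^bsub>H\<^esub> \<one>\<^bsub>H\<^esub> = \<one>\<^bsub>H\<^esub>"
  shows "G \<cong> H"
  unfolding is_iso_def iso_def hom_def using assms by (auto simp: bij_betw_def intro!: exI[of _ "\<lambda>_. \<one>\<^bsub>H\<^esub>"])

text \<open>Replaces group isomorphisms by square roots: later arguments about parametric extensions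
  only compare fields \<open>quad_ext L z\<close>.\<close>

lemma R_eq_two:
  fixes L :: "'a::field set"
  assumes G: "group G" "card (carrier G) = 2" and L: "subfield L univ_ring" and two: "(2::'a) \<noteq> 0"
  shows "R_eq G L = {quad_ext L z | z. z ^ 2 \<in> L \<and> z \<notin> L}"
proof (intro equalityI subsetI)
  fix E assume "E \<in> R_eq G L"
  then have gal: "galois_extension L E" and iso: "Gal E L \<cong> G" unfolding R_eq_def by auto
  have card: "card (carrier (Gal E L)) = 2" using iso G(2) unfolding is_iso_def iso_def
    by (auto dest: bij_betw_same_card)
  obtain z where z: "z ^ 2 \<in> L" "E = quad_ext L z" using galois_extension_small_group[OF gal _ two] card by auto
  have "z \<notin> L"
  proof
    assume "z \<in> L"
    then have "E = L" using quad_ext_trivial[OF L z(1)] z(2) by simp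
    then show False using card Gal_self[OF L] by simp
  qed
  then show "E \<in> {quad_ext L z | z. z ^ 2 \<in> L \<and> z \<notin> L}" using z by blast
next
  fix E assume "E \<in> {quad_ext L z | z. z ^ 2 \<in> L \<and> z \<notin> L}"
  then obtain z where z: "z ^ 2 \<in> L" "z \<notin> L" "E = quad_ext L z" by blast
  show "E \<in> R_eq G L"
    unfolding R_eq_def z(3)
    using galois_extension_quad_ext[OF L z(1,2) two] card_Gal_quad_ext[OF L z(1,2) two]
      two_element_groups_iso[OF group_Gal_quad_ext[OF L z(1,2) two] G(1) _ G(2)] by blast
qed

lemma R_le_two:
  fixes L :: "'a::field set"
  assumes G: "group G" "card (carrier G) = 2" and L: "subfield L univ_ring" and two: "(2::'a) \<noteq> 0"
  shows "R_le G L = {quad_ext L z | z. z ^ 2 \<in> L}"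
proof (intro equalityI subsetI)
  fix E assume "E \<in> R_le G L"
  then obtain H where gal: "galois_extension L E" and H: "subgroup H G" and iso: "Gal E L \<cong> G\<lparr>carrier := H\<rparr>"
    unfolding R_le_def by auto
  have fin: "finite (carrier G)" using G(2) by (metis card.infinite zero_neq_numeral)
  have "card H \<le> 2" using card_mono[OF fin subgroup.subset[OF H]] G(2) by simp
  moreover have "card H \<noteq> 0"
    using finite_subset[OF subgroup.subset[OF H] fin] subgroup.one_closed[OF H] by auto
  moreover have "card (carrier (Gal E L)) = card H"
    using iso unfolding is_iso_def iso_def by (auto dest: bij_betw_same_card)
  ultimately have "card (carrier (Gal E L)) \<in> {1, 2}" by auto
  from galois_extension_small_group[OF gal this two]
  show "E \<in> {quad_ext L z | z. z ^ 2 \<in> L}" by blast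
next
  fix E assume "E \<in> {quad_ext L z | z. z ^ 2 \<in> L}"
  then obtain z where z: "z ^ 2 \<in> L" "E = quad_ext L z" by blast
  interpret G: group G by fact
  show "E \<in> R_le G L"
  proof (cases "z \<in> L")
    case True
    then have E: "E = L" using quad_ext_trivial[OF L z(1)] z(2) by simp
    have "(\<lambda>x\<in>L. x) \<in> Bij L" using id_in_Gal[OF L order_refl] unfolding carrier_Gal by blast
    then have "Gal L L \<cong> G\<lparr>carrier := {\<one>\<^bsub>G\<^esub>}\<rparr>"
      by (intro trivial_groups_iso) (auto simp: Gal_self[OF L] compose_def restrict_def fun_eq_iff)
    then show ?thesis unfolding R_le_def E
      using galois_extension_self[OF L] G.triv_subgroup by blast
  next
    case False
    have "G\<lparr>carrier := carrier G\<rparr> = G" by simp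
    then show ?thesis
      unfolding R_le_def z(2)
      using galois_extension_quad_ext[OF L z(1) False two] card_Gal_quad_ext[OF L z(1) False two]
        G.subgroup_self
        two_element_groups_iso[OF group_Gal_quad_ext[OF L z(1) False two] G(1) _ G(2)] by auto
  qed
qed

section \<open>Rational points on quadratic twists\<close>

text \<open>Near 1, \<open>f\<close> is \<open>u s * (s - 1) ^ r\<close> with
  \<open>u 1 \<noteq> 0\<close>, and the other factor \<open>g\<close> of the completed L-function
  is continuous and nonzero at 1. The reflection of \<open>s\<close> to \<open>2 - s\<close>
  multiplies \<open>(s - 1) ^ r\<close> by \<open>(-1) ^ r\<close>, so cancelling this power and
  letting \<open>s\<close> tend to 1 leaves \<open>(-1) ^ r = w\<close>.\<close>

lemma functional_equation_parity:
  assumes fe: "functional_equation K f w" and hol: "f holomorphic_on UNIV" and nz: "\<exists>s. f s \<noteq> 0"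
    and zo: "zorder f 1 = int r"
  shows "(-1) ^ r = w"
proof -
  obtain A where A: "A > 0" "\<And>s. s \<notin> \<int>\<^sub>\<le>\<^sub>0 \<Longrightarrow> 2 - s \<notin> \<int>\<^sub>\<le>\<^sub>0 \<Longrightarrow>
      completed_L K A f (2 - s) = of_int w * completed_L K A f s"
    using fe unfolding functional_equation_def by blast
  define n where "n = ring.dim univ_ring \<rat> K"
  define g where "g = (\<lambda>s. of_nat A powr (s / 2) * (complex_of_real (2 * pi) powr (- s) * Gamma s) ^ n)"
  have c: "completed_L K A f s = g s * f s" for s by (simp add: completed_L_def g_def n_def)
  obtain u \<rho> where \<rho>: "\<rho> > 0" and u: "u holomorphic_on cball 1 \<rho>"
    "\<And>s. s \<in> cball 1 \<rho> \<Longrightarrow> f s = u s * (s - 1) ^ r" "\<And>s. s \<in> cball 1 \<rho> \<Longrightarrow> u s \<noteq> 0"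
    using zorder_exist_zero[of f UNIV 1] hol nz connected_UNIV[where 'a = complex] unfolding zo by auto
  have g1: "g 1 \<noteq> 0" using A(1) by (simp add: g_def)
  have cont_g: "isCont g 1"
    unfolding g_def by (intro continuous_intros) (use A(1) in auto)
  have "continuous_on (ball 1 \<rho>) u"
    using holomorphic_on_imp_continuous_on[OF u(1)] ball_subset_cball by (rule continuous_on_subset)
  then have cont_u: "isCont u 1" using \<rho> by (simp add: continuous_on_eq_continuous_at)
  define h where "h = (\<lambda>s. g s * u s)"
  have cont_h: "isCont h 1" unfolding h_def by (intro continuous_intros cont_g cont_u)
  then have lim: "(h \<longlongrightarrow> h 1) (at 1)" by (simp add: isCont_def)
  have "filterlim (\<lambda>s::complex. 2 - s) (nhds 1) (at 1)" by (auto intro!: tendsto_eq_intros)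
  moreover have "eventually (\<lambda>s::complex. 2 - s \<noteq> 1) (at 1)"
    by (auto simp: eventually_at_filter)
  ultimately have refl: "filterlim (\<lambda>s::complex. 2 - s) (at 1) (at 1)" by (simp add: filterlim_at)
  have lim1: "((\<lambda>s. (-1) ^ r * h (2 - s)) \<longlongrightarrow> (-1) ^ r * h 1) (at 1)"
    by (intro tendsto_intros filterlim_compose[OF lim refl])
  have lim2: "((\<lambda>s. of_int w * h s) \<longlongrightarrow> of_int w * h 1) (at 1)"
    by (intro tendsto_intros lim)
  \<comment> \<open>A radius of at most 1 keeps both \<open>s\<close> and \<open>2 - s\<close> off
    the nonpositive integers, where the functional equation says nothing.\<close>
  have "eventually (\<lambda>s. s \<in> ball 1 (min \<rho> 1) - {1}) (at (1::complex))"
    using \<rho> by (intro eventually_at_in_open) auto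
  then have "eventually (\<lambda>s. (-1) ^ r * h (2 - s) = of_int w * h s) (at 1)"
  proof eventually_elim
    case (elim s)
    have "s \<in> cball 1 \<rho>" and d: "dist 1 s < 1" and s1: "s \<noteq> 1" using elim by auto
    moreover have "dist 1 (2 - s) = dist 1 s" by (simp add: dist_norm norm_minus_commute)
    ultimately have s: "s \<in> cball 1 \<rho>" "2 - s \<in> cball 1 \<rho>" "dist 1 (2 - s) < 1" by auto
    have nonpos: "x \<notin> \<int>\<^sub>\<le>\<^sub>0" if "dist 1 x < 1" for x :: complex
    proof
      assume "x \<in> \<int>\<^sub>\<le>\<^sub>0"
      then have "Re x \<le> 0" by (auto elim!: nonpos_Ints_cases)
      moreover have "\<bar>Re (1 - x)\<bar> < 1" using that abs_Re_le_cmod[of "1 - x"] by (simp add: dist_norm)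
      ultimately show False by simp
    qed
    have "g (2 - s) * (u (2 - s) * (2 - s - 1) ^ r) = of_int w * (g s * (u s * (s - 1) ^ r))"
      using A(2)[OF nonpos[OF d] nonpos[OF s(3)]] unfolding c u(2)[OF s(1)] u(2)[OF s(2)] .
    moreover have "(2 - s - 1) ^ r = (-1) ^ r * (s - 1) ^ r"
      using power_minus[of "s - 1" r] by simp
    ultimately have "((-1) ^ r * h (2 - s)) * (s - 1) ^ r = (of_int w * h s) * (s - 1) ^ r"
      unfolding h_def by (simp add: algebra_simps)
    then show ?case using s1 by simp
  qed
  from Lim_transform_eventually[OF lim1 this] lim2
  have "(-1) ^ r * h 1 = of_int w * h 1" by (rule LIM_unique)
  moreover have "h 1 \<noteq> 0" using g1 u(3)[of 1] \<rho> by (simp add: h_def)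
  ultimately have "(-1) ^ r = (of_int w :: complex)" by simp
  then have "of_int ((-1) ^ r) = (of_int w :: complex)" by simp
  then show ?thesis by (simp only: of_int_eq_iff)
qed

lemma coeffs_in_synthetic_div:
  assumes A: "subring A (univ_ring :: 'a::field ring)" and c: "c \<in> A" and p: "coeffs_in A p"
  shows "coeffs_in A (synthetic_div p c)"
  using p by (induction p) (auto intro: poly_in_subring[OF A _ c] subring_closed(1)[OF A])

lemma irreducible_over_no_root:
  assumes K: "subfield K (univ_ring :: 'a::field ring)" and irr: "irreducible_over K p"
    and deg: "degree p > 1" and c: "c \<in> K"
  shows "poly p c \<noteq> 0"
proof
  assume "poly p c = 0"
  then have p: "p = [:- c, 1:] * synthetic_div p c" using synthetic_div_correct'[of c p] by simp
  have irr': "degree g = 0 \<or> degree h = 0" if "coeffs_in K g" "coeffs_in K h" "p = g * h" for g h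
    using irr that unfolding irreducible_over_def by metis
  have 1: "coeffs_in K (synthetic_div p c)"
    using coeffs_in_synthetic_div[OF subfield_subring[OF K] c] irr unfolding irreducible_over_def by blast
  have 2: "coeffs_in K [:- c, 1:]" using subfield_closed(3)[OF K c] subfield_closed(1,2)[OF K] by simp
  have "degree [:- c, 1:] = 0 \<or> degree (synthetic_div p c) = 0" by (rule irr'[OF 2 1 p])
  then show False using deg by (simp add: degree_synthetic_div)
qed

lemma has_rank_unique: "has_rank G r \<Longrightarrow> has_rank G r' \<Longrightarrow> r = r'"
proof (rule le_antisym)
  assume r: "has_rank G r" "has_rank G r'"
  show "r \<le> r'" "r' \<le> r" using r unfolding has_rank_def by blast+
qed

text \<open>Serves to extract a point from an odd rank. With carrier \<open>{Origin}\<close> the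
  axioms of a commutative group are immediate, so \<open>finprod\<close> can be computed, and
  exponent 1 shows that the set \<open>{Origin}\<close> is dependent.\<close>

lemma trivial_mordell_weil_rank:
  assumes c: "carrier (mordell_weil_group K E) = {Origin}" and r: "has_rank (mordell_weil_group K E) r"
  shows "r = 0"
proof (rule ccontr)
  let ?G = "mordell_weil_group K E"
  assume "r \<noteq> 0"
  obtain S where S: "S \<subseteq> {Origin}" "card S = r" "int_independent ?G S"
    using r c unfolding has_rank_def by metis
  then have S': "S = {Origin}" using \<open>r \<noteq> 0\<close> by (metis card.empty subset_singletonD)
  have m: "Origin \<otimes>\<^bsub>?G\<^esub> Origin = Origin" and o: "\<one>\<^bsub>?G\<^esub> = Origin" by (simp_all add: mordell_weil_group_def)
  interpret comm_group ?G
    by (rule comm_groupI) (auto simp: c m o)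
  have "finprod ?G (\<lambda>g. g [^]\<^bsub>?G\<^esub> (1::int)) {Origin} = \<one>\<^bsub>?G\<^esub>"
    using finprod_one_eqI[of "{Origin}" "\<lambda>g. g [^]\<^bsub>?G\<^esub> (1::int)"] o int_pow_one[of 1] by simp
  then show False using S(3) unfolding int_independent_def S' by force
qed

lemma poly_cubic:
  fixes Q :: "'a::field poly"
  assumes "degree Q = 3"
  shows "poly Q t = coeff Q 3 * t ^ 3 + coeff Q 2 * t ^ 2 + coeff Q 1 * t + coeff Q 0"
  unfolding poly_altdef assms by (simp add: eval_nat_numeral atMost_Suc algebra_simps)

lemma cubic_curve_eq:
  fixes Q :: "'a::field poly"
  assumes "degree Q = 3"
  shows "weierstrass_eq (cubic_curve Q) x y = 0 \<longleftrightarrow> (y / coeff Q 3) ^ 2 = poly Q (x / coeff Q 3)"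
proof -
  have a: "coeff Q 3 \<noteq> 0" using assms by (metis leading_coeff_0_iff degree_0 zero_neq_numeral)
  show ?thesis
    unfolding poly_cubic[OF assms] using a
    by (simp add: weierstrass_eq_def cubic_curve_def field_simps eval_nat_numeral)
qed

text \<open>A repeated root of a cubic is rational: it is the triple root \<open>- p / 3\<close> if
  \<open>p^2 = 3 * q\<close>, and otherwise the double root
  \<open>(9 * r - p * q) / (2 * (p^2 - 3 * q))\<close>. Hence an irreducible cubic has distinct
  roots and defines an elliptic curve.\<close>

lemma cubic_root_if_discriminant_0:
  fixes p q r :: "'a::field_char_0"
  assumes K: "subfield K univ_ring" and pqr: "p \<in> K" "q \<in> K" "r \<in> K"
    and D: "p^2 * q^2 - 4 * q^3 - 4 * p^3 * r + 18 * p * q * r - 27 * r^2 = 0"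
  shows "\<exists>x\<in>K. x^3 + p * x^2 + q * x + r = 0"
proof (cases "p^2 - 3 * q = 0")
  case True
  then have q: "q = p^2 / 3" by (simp add: field_simps)
  have "(27 * r - p^3)^2 = 0" using D unfolding q by (simp add: field_simps eval_nat_numeral)
  then have r: "r = p^3 / 27" by (simp add: field_simps)
  have "- p / 3 \<in> K" by (intro subfield_closed[OF K] pqr)
  moreover have "(- p / 3)^3 + p * (- p / 3)^2 + q * (- p / 3) + r = 0"
    unfolding q r by (simp add: field_simps eval_nat_numeral)
  ultimately show ?thesis by blast
next
  case False
  let ?m = "p^2 - 3 * q" and ?N = "9 * r - p * q"
  have "?N / (2 * ?m) \<in> K" by (intro subfield_closed[OF K] pqr)
  \<comment> \<open>The left side is the cubic at \<open>?N / (2 * ?m)\<close>, cleared of its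
    denominator \<open>8 * ?m^3\<close>; it turns out to be a multiple of the discriminant.\<close>
  moreover have "?N^3 + 2 * p * ?m * ?N^2 + 4 * q * ?m^2 * ?N + 8 * r * ?m^3 =
      (9 * p * q - 27 * r - 2 * p^3) * (p^2 * q^2 - 4 * q^3 - 4 * p^3 * r + 18 * p * q * r - 27 * r^2)"
    by (simp add: algebra_simps eval_nat_numeral)
  then have "?N^3 + 2 * p * ?m * ?N^2 + 4 * q * ?m^2 * ?N + 8 * r * ?m^3 = 0" using D by simp
  then have "(?N / (2 * ?m))^3 + p * (?N / (2 * ?m))^2 + q * (?N / (2 * ?m)) + r = 0"
  proof -
    assume e: "?N^3 + 2 * p * ?m * ?N^2 + 4 * q * ?m^2 * ?N + 8 * r * ?m^3 = 0"
    define m where "m = ?m"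
    define N where "N = ?N"
    have m: "m \<noteq> 0" using False unfolding m_def .
    have "(N / (2 * m))^3 + p * (N / (2 * m))^2 + q * (N / (2 * m)) + r = (N^3 + 2 * p * m * N^2 + 4
      * q * m^2 * N + 8 * r * m^3) / (8 * m^3)"
      using m by (simp add: field_simps eval_nat_numeral)
    then show ?thesis using e unfolding m_def N_def by simp
  qed
  ultimately show ?thesis by blast
qed

text \<open>
  The first two hypotheses are the components over \<open>1\<close> and \<open>z\<close>, where \<open>z\<^sup>2 = d\<close>, of the equation of
  the cubic at \<open>(x\<^sub>0 + x\<^sub>1 z, y\<^sub>0 + y\<^sub>1 z)\<close>, the second one divided by \<open>x\<^sub>1\<close>. The line through this
  point \<open>P\<close> and \<open>- P'\<close>, with \<open>P'\<close> the conjugate of \<open>P\<close>, has slope \<open>m z\<close>.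
\<close>

lemma third_intersection:
  fixes x0 x1 y0 y1 d p q r m :: "'a::field_char_0"
  assumes eq1: "x0^3 + 3 * x0 * x1^2 * d + p * (x0^2 + x1^2 * d) + q * x0 + r = y0^2 + y1^2 * d"
    and eq2: "3 * x0^2 + x1^2 * d + 2 * p * x0 + q = 2 * m * d * y1"
    and m: "y0 = m * x1 * d"
    and s: "s = m^2 * d - p - 2 * x0"
  shows "s^3 + p * s^2 + q * s + r = d * (m * (s - x0) + y1)^2"
proof -
  \<comment> \<open>The hypotheses are solved for \<open>q\<close>, \<open>r\<close> and
    \<open>p\<close>, so that a polynomial identity in the free quantities \<open>x0\<close>,
    \<open>x1\<close>, \<open>y1\<close>, \<open>d\<close>, \<open>m\<close>, \<open>s\<close>
    remains.\<close>
  have q: "q = 2 * m * d * y1 - 3 * x0^2 - x1^2 * d - 2 * p * x0" using eq2 by (simp add: algebra_simps)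
  have r: "r = y0^2 + y1^2 * d - (x0^3 + 3 * x0 * x1^2 * d + p * (x0^2 + x1^2 * d) + q * x0)"
    using eq1 by (simp add: algebra_simps)
  have p: "p = m^2 * d - s - 2 * x0" using s by simp
  show ?thesis unfolding r q m unfolding p by (simp add: algebra_simps eval_nat_numeral)
qed

lemma number_field_quad_ext:
  assumes k: "number_field k" and z: "z ^ 2 \<in> k"
  shows "number_field (quad_ext k z)"
proof -
  interpret Ring.field "univ_ring :: complex ring" by (rule field_from_type_algebra)
  have K: "subfield k univ_ring" and f: "finite_dimension \<rat> k" using k unfolding number_field_def by auto
  obtain n where n: "dimension n \<rat> k" using f by (rule finite_dimensionE')
  obtain m where m: "dimension m k (quad_ext k z)"
    using finite_dimension_quad_ext[OF K z] by (rule finite_dimensionE')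
  have Q: "subfield \<rat> (univ_ring :: complex ring)" by (rule subfieldI_univ) auto
  show ?thesis unfolding number_field_def
    using subfield_quad_ext[OF K z] finite_dimensionI[OF telescopic_base[OF Q K n m]] by blast
qed

lemma quadratic_extension_quad_ext:
  "subfield k univ_ring \<Longrightarrow> z ^ 2 \<in> k \<Longrightarrow> z \<notin> k \<Longrightarrow> quadratic_extension k (quad_ext k z)"
  unfolding quadratic_extension_def
  by (intro conjI subfield_quad_ext base_subset_quad_ext dimension_quad_ext)

text \<open>
  For \<open>P \<in> C(k(z))\<close> with conjugate \<open>P'\<close>, the point \<open>P - P'\<close> is either the origin or a point of the
  twist of \<open>C\<close> by \<open>z\<^sup>2\<close>; so without such points \<open>C(k(z)) = C(k)\<close>, and the ranks agree.
\<close>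

lemma twist_point_if_point_outside:
  fixes k :: "complex set"
  assumes K: "subfield k univ_ring" and z: "z ^ 2 \<in> k" "z \<notin> k"
    and pqr: "p \<in> k" "q \<in> k" "r \<in> k"
    and no_root: "\<And>x. x \<in> k \<Longrightarrow> x^3 + p * x^2 + q * x + r \<noteq> 0"
    and xy: "x \<in> quad_ext k z" "y \<in> quad_ext k z" "y^2 = x^3 + p * x^2 + q * x + r"
    and out: "x \<notin> k \<or> y \<notin> k"
  shows "\<exists>s\<in>k. \<exists>c\<in>k. s^3 + p * s^2 + q * s + r = z^2 * c^2"
proof -
  note cl = subfield_closed[OF K]
  define d where "d = z ^ 2"
  have d: "d \<in> k" "z * z = d" "d \<noteq> 0" using z cl(1) by (auto simp: d_def power2_eq_square)
  obtain x0 x1 where x: "x0 \<in> k" "x1 \<in> k" "x = x0 + x1 * z" using xy(1) by (rule quad_extE)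
  obtain y0 y1 where y: "y0 \<in> k" "y1 \<in> k" "y = y0 + y1 * z" using xy(2) by (rule quad_extE)
  have zz: "z * (z * a) = d * a" for a using d(2) by (metis mult.assoc)
  let ?A = "x0^3 + 3 * x0 * x1^2 * d + p * (x0^2 + x1^2 * d) + q * x0 + r"
  let ?B = "3 * x0^2 * x1 + x1^3 * d + 2 * p * x0 * x1 + q * x1"
  have "(y0^2 + y1^2 * d) + (2 * y0 * y1) * z = ?A + ?B * z"
    using xy(3) unfolding x y by (simp add: algebra_simps eval_nat_numeral zz d(2))
  moreover have "y0^2 + y1^2 * d \<in> k" "2 * y0 * y1 \<in> k" "?A \<in> k" "?B \<in> k"
    by (intro cl x y d pqr)+
  ultimately have eq: "y0^2 + y1^2 * d = ?A" "2 * y0 * y1 = ?B"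
    using quad_coords_unique[OF K z] by blast+
  show ?thesis
  proof (cases "x1 = 0")
    case True
    \<comment> \<open>Here \<open>x\<close> lies in \<open>k\<close>, so \<open>y\<close> does not
      and \<open>y1 \<noteq> 0\<close>. Then \<open>y = y1 * z\<close>, and \<open>(x0, y1)\<close>
      is itself a point of the twist.\<close>
    then have "y0 * y1 = 0" using eq(2) by simp
    moreover have "y1 \<noteq> 0" using out x y True by auto
    ultimately have "y0 = 0" by simp
    then have "x0^3 + p * x0^2 + q * x0 + r = z^2 * y1^2" using eq(1) True by (simp add: d_def mult.commute)
    then show ?thesis using x y by blast
  next
    case False
    \<comment> \<open>The line through the point and the negative of its conjugate has slope
      \<open>y0 / (x1 * z)\<close>, which is \<open>m * z\<close> as
      \<open>z ^ 2 = d\<close>.\<close>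
    define m where "m = y0 / (x1 * d)"
    have m: "m \<in> k" unfolding m_def by (intro cl x y d)
    have y0: "y0 = m * x1 * d" using False d by (simp add: m_def)
    have "x1 * (3 * x0^2 + x1^2 * d + 2 * p * x0 + q) = x1 * (2 * m * d * y1)"
      using eq(2) unfolding y0 by (simp add: algebra_simps eval_nat_numeral)
    then have eq2: "3 * x0^2 + x1^2 * d + 2 * p * x0 + q = 2 * m * d * y1" using False by simp
    \<comment> \<open>By Vieta, the abscissas of the three intersection points add up to the squared
      slope \<open>m^2 * d\<close> minus \<open>p\<close>; the two known ones add up to
      \<open>2 * x0\<close>.\<close>
    define s where "s = m^2 * d - p - 2 * x0"
    have "s \<in> k" unfolding s_def by (intro cl m d pqr x)
    moreover have "m * (s - x0) + y1 \<in> k" by (intro cl m x y \<open>s \<in> k\<close>)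
    ultimately show ?thesis
      using third_intersection[OF eq(1)[symmetric] eq2 y0 s_def] unfolding d_def by blast
  qed
qed

lemma twist_has_point:
  fixes k :: "complex set" and Q :: "complex poly"
  assumes k: "number_field k" and deg: "degree Q = 3" and irr: "irreducible_over k Q"
    and root: "root_number k (cubic_curve Q) = -1"
    and root_quad: "\<And>L. quadratic_extension k L \<Longrightarrow> root_number L (cubic_curve Q) = 1"
    and BSD: BSD_conjecture
    and d: "d \<in> k" "d \<noteq> 0"
  shows "\<exists>t\<in>k. \<exists>y\<in>k. y ^ 2 = d * poly Q t"
proof -
  have K: "subfield k univ_ring" using k unfolding number_field_def by blast
  note cl = subfield_closed[OF K]
  let ?E = "cubic_curve Q"
  have Qk: "coeff Q i \<in> k" for i using irr unfolding irreducible_over_def coeffs_in_def by blast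
  define a where "a = coeff Q 3"
  have a: "a \<noteq> 0" "a \<in> k" using deg Qk unfolding a_def
    by (metis leading_coeff_0_iff degree_0 zero_neq_numeral, blast)
  \<comment> \<open>With these coefficients the cubic is \<open>a^2 * poly Q (x / a)\<close>, which
    is monic in \<open>x\<close>.\<close>
  define p q r where "p = coeff Q 2" and "q = a * coeff Q 1" and "r = a ^ 2 * coeff Q 0"
  have pqr: "p \<in> k" "q \<in> k" "r \<in> k" unfolding p_def q_def r_def by (intro cl a Qk)+
  have f: "x^3 + p * x^2 + q * x + r = a^2 * poly Q (x / a)" for x
    using a(1) unfolding poly_cubic[OF deg] p_def q_def r_def a_def[symmetric]
    by (simp add: field_simps eval_nat_numeral)
  have no_root: "x^3 + p * x^2 + q * x + r \<noteq> 0" if "x \<in> k" for x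
    using irreducible_over_no_root[OF K irr _ cl(11)[OF that a(2)]] deg a unfolding f by simp
  have disc: "discriminant ?E = 16 * (p^2 * q^2 - 4 * q^3 - 4 * p^3 * r + 18 * p * q * r - 27 * r^2)"
    unfolding discriminant_def cubic_curve_def p_def q_def r_def a_def
    by (simp add: Let_def algebra_simps eval_nat_numeral)
  have "discriminant ?E \<noteq> 0"
    unfolding disc mult_eq_0_iff using cubic_root_if_discriminant_0[OF K pqr] no_root by force
  moreover have "weierstrass_coeffs ?E \<subseteq> k"
    using cl(1) pqr unfolding weierstrass_coeffs_def cubic_curve_def p_def q_def r_def a_def by simp
  ultimately have ell: "elliptic_curve k ?E" unfolding elliptic_curve_def by blast
  have rank: "\<exists>r. has_rank (mordell_weil_group L ?E) r \<and> (-1) ^ r = root_number L ?E"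
    if "number_field L" "elliptic_curve L ?E" for L
  proof -
    obtain g r where "L_continuation L ?E g" "functional_equation L g (root_number L ?E)"
      "\<exists>s. g s \<noteq> 0" "zorder g 1 = int r" "has_rank (mordell_weil_group L ?E) r"
      using BSD \<open>number_field L\<close> \<open>elliptic_curve L ?E\<close> unfolding BSD_conjecture_def by blast
    then show ?thesis
      using functional_equation_parity[of L g "root_number L ?E" r] unfolding L_continuation_def by blast
  qed
  obtain n where n: "has_rank (mordell_weil_group k ?E) n" "(-1) ^ n = (-1::int)"
    using rank[OF k ell] root by auto
  have W: "weierstrass_eq ?E x y = 0 \<longleftrightarrow> y^2 = x^3 + p * x^2 + q * x + r" for x y
    unfolding cubic_curve_eq[OF deg] f a_def[symmetric] using a(1) by (simp add: field_simps)
  define z where "z = csqrt d"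
  have zd: "z ^ 2 = d" unfolding z_def by (rule power2_csqrt)
  then have z0: "z \<noteq> 0" using d(2) by (metis power_zero_numeral)
  have zk: "z ^ 2 \<in> k" unfolding zd by (rule d(1))
  note z = zd z0 zk
  have "\<exists>s\<in>k. \<exists>c\<in>k. s^3 + p * s^2 + q * s + r = z^2 * c^2"
  proof (cases "z \<in> k")
    case True
    \<comment> \<open>For a square \<open>d\<close> the twist is isomorphic to the curve over
      \<open>k\<close>; the rank over \<open>k\<close> is odd, hence positive, so an affine point
      exists.\<close>
    have "carrier (mordell_weil_group k ?E) \<noteq> {Origin}"
    proof
      assume "carrier (mordell_weil_group k ?E) = {Origin}"
      from trivial_mordell_weil_rank[OF this n(1)] n(2) show False by simp
    qed
    then have "{Point x y | x y. x \<in> k \<and> y \<in> k \<and> weierstrass_eq ?E x y = 0} \<noteq> {}"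
      unfolding mordell_weil_group_def by (intro notI) simp
    then obtain x y where "x \<in> k" "y \<in> k" "weierstrass_eq ?E x y = 0" by blast
    then have "x \<in> k" "y / z \<in> k" "x^3 + p * x^2 + q * x + r = z^2 * (y / z)^2"
      using True z(2) cl(11) unfolding W by (simp_all add: power_divide)
    then show ?thesis by blast
  next
    case False
    let ?L = "quad_ext k z"
    have kL: "k \<subseteq> ?L" by (rule base_subset_quad_ext[OF K z(3)])
    have "elliptic_curve ?L ?E" using ell kL unfolding elliptic_curve_def by blast
    then obtain n' where n': "has_rank (mordell_weil_group ?L ?E) n'" "(-1) ^ n' = (1::int)"
      using rank[OF number_field_quad_ext[OF k z(3)]] root_quad[OF quadratic_extension_quad_ext[OF K
        z(3) False]]
      by auto
    have "mordell_weil_group ?L ?E \<noteq> mordell_weil_group k ?E"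
    proof
      assume "mordell_weil_group ?L ?E = mordell_weil_group k ?E"
      then have "n' = n" using has_rank_unique[OF n'(1)] n(1) by simp
      then show False using n(2) n'(2) by simp
    qed
    then have "\<not> (\<forall>x\<in>?L. \<forall>y\<in>?L. weierstrass_eq ?E x y = 0 \<longrightarrow> x \<in> k \<and> y \<in> k)"
      using kL unfolding mordell_weil_group_def by (intro notI) (simp, blast)
    then obtain x y where "x \<in> ?L" "y \<in> ?L" "weierstrass_eq ?E x y = 0" "x \<notin> k \<or> y \<notin> k" by blast
    then show ?thesis
      using twist_point_if_point_outside[OF K z(3) False pqr no_root] unfolding W by blast
  qed
  then obtain s c where sc: "s \<in> k" "c \<in> k" "a^2 * poly Q (s / a) = d * c^2" unfolding f z(1) by blast
  \<comment> \<open>Multiplication by \<open>d\<close> trades the form \<open>d Y^2 = Q\<close> of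
    the twist for \<open>Y^2 = d Q\<close>.\<close>
  have "(d * c / a) ^ 2 = d * poly Q (s / a)"
    using sc(3) a(1) by (simp add: field_simps power2_eq_square)
  moreover have "s / a \<in> k" "d * c / a \<in> k" by (intro cl sc a d)+
  ultimately show ?thesis by blast
qed

section \<open>Maps from the projective line to a cubic curve\<close>

lemma order_le_imp_degree_le:
  fixes p q :: "complex poly"
  assumes "p \<noteq> 0" "q \<noteq> 0" "\<And>x. order x p \<le> order x q"
  shows "degree p \<le> degree q"
proof -
  have "proots p \<subseteq># proots q" using assms by (intro mset_subset_eqI) simp
  from size_mset_mono[OF this] show ?thesis by (simp add: size_proots_complex)
qed

definition wronskian :: "complex poly \<Rightarrow> complex poly \<Rightarrow> complex poly" where
  "wronskian p q = pderiv p * q - p * pderiv q"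

text \<open>Each product loses one degree by differentiation. The additive form avoids truncated
  subtraction: two constants are excluded by the hypothesis.\<close>

lemma degree_wronskian:
  assumes "wronskian p q \<noteq> 0" shows "degree (wronskian p q) + 1 \<le> degree p + degree q"
proof -
  have "degree (wronskian p q) \<le> degree p + degree q - 1"
  proof (cases "degree p = 0 \<or> degree q = 0")
    case True
    then show ?thesis
    proof
      assume "degree p = 0"
      then obtain c where "p = [:c:]" by (rule degree_eq_zeroE)
      then show ?thesis by (simp add: wronskian_def pderiv_pCons degree_pderiv)
    next
      assume "degree q = 0"
      then obtain c where "q = [:c:]" by (rule degree_eq_zeroE)
      then show ?thesis by (simp add: wronskian_def pderiv_pCons degree_pderiv)
    qed
  next
    case False
    have "degree (pderiv p * q) \<le> degree p + degree q - 1"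
      using degree_mult_le[of "pderiv p" q] False by (simp add: degree_pderiv)
    moreover have "degree (p * pderiv q) \<le> degree p + degree q - 1"
      using degree_mult_le[of p "pderiv q"] False by (simp add: degree_pderiv)
    ultimately show ?thesis unfolding wronskian_def by (rule degree_diff_le)
  qed
  moreover have "degree p + degree q \<noteq> 0"
  proof
    assume "degree p + degree q = 0"
    then obtain c d where "p = [:c:]" "q = [:d:]" by (metis add_is_0 degree_eq_zeroE)
    then show False using assms by (simp add: wronskian_def pderiv_pCons)
  qed
  ultimately show ?thesis by linarith
qed

text \<open>A zero of order \<open>n + 1\<close> of \<open>p\<close> is a zero of order at least
  \<open>n\<close> of its derivative, hence of both terms of the Wronskian.\<close>

lemma order_le_order_wronskian:
  assumes "wronskian p q \<noteq> 0" "p \<noteq> 0"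
  shows "order x p \<le> order x (wronskian p q) + 1"
proof (cases "order x p")
  case (Suc n)
  obtain r where r: "p = [:- x, 1:] ^ Suc n * r" using order_1[of x p] Suc by (metis dvdE)
  have "[:- x, 1:] ^ n dvd pderiv p"
    unfolding r lemma_order_pderiv1 by (intro dvd_add dvd_smult dvd_mult2[OF le_imp_power_dvd]
      dvd_mult dvd_refl) simp
  moreover have "[:- x, 1:] ^ n dvd p" unfolding r by (intro dvd_mult2 le_imp_power_dvd) simp
  ultimately have "[:- x, 1:] ^ n dvd wronskian p q" unfolding wronskian_def by (intro dvd_diff dvd_mult2)
  then show ?thesis using assms(1) Suc unfolding order_divides by simp
qed simp

text \<open>
  If \<open>t = A / B\<close> is not constant, the square root \<open>w\<close> of \<open>U Q(t) B\<^sup>4\<close> divides \<open>U\<close> times the Wronskian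
  of \<open>A\<close> and \<open>B\<close>, whose degree is too small for this: the invariant differential of the elliptic
  curve would pull back to a regular differential form on a rational curve.
\<close>

lemma no_nonconstant_twist_point:
  fixes A B w :: "complex poly" and a \<alpha> \<beta> \<gamma> :: complex
  assumes cop: "coprime A B" and B: "B \<noteq> 0" and a: "a \<noteq> 0"
    and dist: "\<alpha> \<noteq> \<beta>" "\<beta> \<noteq> \<gamma>" "\<alpha> \<noteq> \<gamma>"
    and eq: "w ^ 2 = [:0, 1:] * smult a (B * (A - smult \<alpha> B) * (A - smult \<beta> B) * (A - smult \<gamma> B))"
  shows "w = 0"
proof (rule ccontr)
  assume w: "w \<noteq> 0"
  define l where "l = (\<lambda>c. A - smult c B)"
  have nz: "l \<alpha> \<noteq> 0" "l \<beta> \<noteq> 0" "l \<gamma> \<noteq> 0" using eq w unfolding l_def by auto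
  have eq': "w ^ 2 = [:0, 1:] * smult a (B * l \<alpha> * l \<beta> * l \<gamma>)" using eq unfolding l_def .
  have no_common: "\<not> (poly A x = 0 \<and> poly B x = 0)" for x
    using cop coprime_poly_0 by blast
  let ?W = "wronskian A B"
  have W1: "wronskian (l c) B = ?W" for c
    unfolding wronskian_def l_def by (simp add: pderiv_diff pderiv_smult algebra_simps)
  have W2: "wronskian B (l c) = - ?W" for c
    unfolding wronskian_def l_def by (simp add: pderiv_diff pderiv_smult algebra_simps)
  have W3: "wronskian (l c) (l d) = smult (c - d) ?W" for c d
    unfolding wronskian_def l_def
    by (simp add: pderiv_diff pderiv_smult algebra_simps smult_diff_left smult_diff_right smult_add_right)
  have degs: "2 * degree w = 1 + degree B + degree (l \<alpha>) + degree (l \<beta>) + degree (l \<gamma>)"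
  proof -
    have "2 * degree w = degree (w ^ 2)" using w by (simp add: degree_power_eq)
    also have "\<dots> = 1 + degree B + degree (l \<alpha>) + degree (l \<beta>) + degree (l \<gamma>)"
      unfolding eq' using nz B a by (simp add: degree_mult_eq del: mult_pCons_left)
    finally show ?thesis .
  qed
  show False
  proof (cases "?W = 0")
    case True
    \<comment> \<open>A vanishing Wronskian makes \<open>A / B\<close> constant. For coprime
      \<open>A\<close> and \<open>B\<close> both are then constants, and \<open>degs\<close> becomes
      \<open>2 * degree w = 1\<close>.\<close>
    have "B dvd A * pderiv B" using True unfolding wronskian_def by (metis dvd_triv_right eq_iff_diff_eq_0)
    then have "B dvd pderiv B" using cop by (metis coprime_commute coprime_dvd_mult_right_iff)
    then have "degree B = 0"
      using dvd_imp_degree_le[of B "pderiv B"] pderiv_eq_0_iff[of B] by (auto simp: degree_pderiv)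
    then have pB: "pderiv B = 0" by (simp add: pderiv_eq_0_iff)
    then have "pderiv A = 0" using True B unfolding wronskian_def by simp
    then have "degree A = 0" by (simp add: pderiv_eq_0_iff)
    then have "degree (l c) = 0" for c
      unfolding l_def using \<open>degree B = 0\<close> degree_diff_le[of A 0 "smult c B"] degree_smult_le[of c B] by simp
    then show False using degs \<open>degree B = 0\<close> by simp
  next
    case False
    \<comment> \<open>At most one of the four factors \<open>B\<close>, \<open>l \<alpha>\<close>,
      \<open>l \<beta>\<close>, \<open>l \<gamma>\<close> vanishes at \<open>x\<close>, to order at
      most \<open>order x ?W + 1\<close>. Adding the order of \<open>U\<close>, which is at most 1,
      bounds \<open>2 * order x w\<close>, and halving gives the claim.\<close>
    have "order x w \<le> order x ([:0, 1:] * ?W)" for x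
    proof -
      have "2 * order x w = order x (w ^ 2)" using w by (simp add: power2_eq_square order_mult)
      also have "\<dots> = order x [:0, 1:] + (order x B + order x (l \<alpha>) + order x (l \<beta>) + order x (l \<gamma>))"
        unfolding eq' using nz B a by (simp add: order_mult order_smult del: mult_pCons_left)
      finally have ord: "2 * order x w =
        order x [:0, 1:] + (order x B + order x (l \<alpha>) + order x (l \<beta>) + order x (l \<gamma>))" .
      have zero: "order x p = 0" if "poly p x \<noteq> 0" for p :: "complex poly" using that by (rule order_0I)
      have "order x [:0, 1:] \<le> 1" using order_degree[of "[:0, 1:] :: complex poly" x] by simp
      have tgt: "order x ([:0, 1:] * ?W) = order x [:0, 1:] + order x ?W"
        using False by (intro order_mult) (simp del: mult_pCons_left)
      have bound: "order x p \<le> order x ?W + 1" if "p \<in> {B, l \<alpha>, l \<beta>, l \<gamma>}" for p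
      proof -
        have "order x B \<le> order x (- ?W) + 1"
          using order_le_order_wronskian[of B "l \<alpha>" x] W2[of \<alpha>] False B by simp
        moreover have "order x (l c) \<le> order x ?W + 1" if "l c \<noteq> 0" for c
          using order_le_order_wronskian[of "l c" B x] W1[of c] False that by simp
        ultimately show ?thesis using that nz by auto
      qed
      have "\<exists>e. e \<le> order x ?W + 1 \<and> order x B + order x (l \<alpha>) + order x (l \<beta>) + order x (l \<gamma>) = e"
      proof (cases "poly B x = 0")
        case True
        then have "poly A x \<noteq> 0" using no_common by blast
        then have "poly (l c) x \<noteq> 0" for c using True by (simp add: l_def)
        then show ?thesis using zero bound[of B] by simp
      next
        case B: False
        have c: "c = poly A x / poly B x" if "poly (l c) x = 0" for c
          using that B unfolding l_def by (simp add: field_simps)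
        have "poly (l \<alpha>) x \<noteq> 0 \<or> poly (l \<beta>) x \<noteq> 0" "poly (l \<beta>) x \<noteq> 0 \<or> poly (l \<gamma>) x \<noteq> 0"
            "poly (l \<alpha>) x \<noteq> 0 \<or> poly (l \<gamma>) x \<noteq> 0"
          using c dist by metis+
        then show ?thesis using zero[OF B] zero bound[of "l \<alpha>"] bound[of "l \<beta>"] bound[of "l \<gamma>"] by fastforce
      qed
      then show ?thesis using ord \<open>order x [:0, 1:] \<le> 1\<close> unfolding tgt by (cases "order x [:0, 1:] = 0") auto
    qed
    then have "degree w \<le> degree ([:0, 1:] * ?W)"
      using order_le_imp_degree_le[OF w] False by (metis mult_eq_0_iff pCons_eq_0_iff one_neq_zero)
    then have "degree w \<le> 1 + degree ?W" using False by (simp add: degree_mult_eq del: mult_pCons_left)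
    \<comment> \<open>Pairing the four factors bounds \<open>2 * degree ?W + 2\<close> by the sum of
      their degrees, which is \<open>2 * degree w - 1\<close>; this contradicts
      \<open>degree w \<le> 1 + degree ?W\<close>.\<close>
    moreover have "degree ?W + 1 \<le> degree (l \<alpha>) + degree B"
      using degree_wronskian[of "l \<alpha>" B] W1[of \<alpha>] False by simp
    moreover have "degree ?W + 1 \<le> degree (l \<beta>) + degree (l \<gamma>)"
      using degree_wronskian[of "l \<beta>" "l \<gamma>"] W3[of \<beta> \<gamma>] False dist by simp
    ultimately show False using degs by linarith
  qed
qed

section \<open>Quadratic function fields\<close>

definition transcendental_over :: "'a::field set \<Rightarrow> 'a \<Rightarrow> bool" where
  "transcendental_over K x \<longleftrightarrow> (\<forall>p. coeffs_in K p \<longrightarrow> poly p x = 0 \<longrightarrow> p = 0)"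

lemma transcendental_overD:
  "transcendental_over K x \<Longrightarrow> coeffs_in K p \<Longrightarrow> poly p x = 0 \<Longrightarrow> p = 0"
  unfolding transcendental_over_def by blast

lemma transcendental_over_mono: "transcendental_over K x \<Longrightarrow> K' \<subseteq> K \<Longrightarrow> transcendental_over K' x"
  unfolding transcendental_over_def by (auto dest: coeffs_in_mono)

lemma transcendental_over_eqD:
  assumes "subring K (univ_ring :: 'a::field ring)" "transcendental_over K x" "coeffs_in K p"
    "coeffs_in K q" "poly p x = poly q x"
  shows "p = q"
  using transcendental_overD[OF assms(2) coeffs_in_closed(5)[OF assms(1,3,4)]] assms(5) by simp

lemma transcendental_not_in:
  assumes "subring K (univ_ring :: 'a::field ring)" "transcendental_over K x" shows "x \<notin> K"
proof
  assume "x \<in> K"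
  then have "coeffs_in K [:- x, 1:]" using subring_closed(1-3)[OF assms(1)] by simp
  from transcendental_overD[OF assms(2) this] show False by simp
qed

text \<open>The library's \<open>coprime\<close> has few rules for polynomials over a field without a \<open>gcd\<close>.\<close>

definition comaximal :: "'a::comm_ring_1 \<Rightarrow> 'a \<Rightarrow> bool" where
  "comaximal p q \<longleftrightarrow> (\<exists>u v. u * p + v * q = 1)"

lemma comaximal_commute: "comaximal p q \<longleftrightarrow> comaximal q p"
  unfolding comaximal_def by (metis add.commute)

lemma comaximal_mult: assumes "comaximal p q" "comaximal p r" shows "comaximal p (q * r)"
proof -
  obtain u v u' v' where e: "u * p + v * q = 1" "u' * p + v' * r = 1" using assms
    unfolding comaximal_def by blast
  have "(u * p + v * q) * (u' * p + v' * r) = 1" unfolding e by simp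
  then have "(u * (u' * p + v' * r) + v * q * u') * p + (v * v') * (q * r) = 1" by (simp add: algebra_simps)
  then show ?thesis unfolding comaximal_def by blast
qed

lemma comaximal_1: "comaximal p 1"
  unfolding comaximal_def by (intro exI[of _ 0] exI[of _ 1]) simp

lemma comaximal_power: assumes "comaximal p q" shows "comaximal (p ^ m) (q ^ n)"
proof -
  have *: "comaximal p q \<Longrightarrow> comaximal p (q ^ n)" for p q :: 'a and n
    by (induction n) (auto intro: comaximal_1 comaximal_mult)
  show ?thesis using * assms comaximal_commute by metis
qed

lemma comaximal_dvd_mult: assumes "comaximal p q" "q dvd p * r" shows "q dvd r"
proof -
  obtain u v where e: "u * p + v * q = 1" using assms(1) unfolding comaximal_def by blast
  have "r = (u * p + v * q) * r" unfolding e by simp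
  also have "\<dots> = u * (p * r) + v * r * q" by (simp add: algebra_simps)
  finally show ?thesis using assms(2) by (metis dvd_add dvd_mult dvd_triv_right)
qed

lemma division_over:
  assumes K: "subfield K (univ_ring :: 'a::field ring)" and g: "coeffs_in K g" "g \<noteq> 0"
  shows "coeffs_in K p \<Longrightarrow> \<exists>s r. coeffs_in K s \<and> coeffs_in K r \<and> p = s * g + r \<and> (r = 0 \<or> degree r < degree g)"
proof (induction "degree p" arbitrary: p rule: less_induct)
  case less
  note cl = coeffs_in_closed[OF subfield_subring[OF K]]
  show ?case
  proof (cases "p = 0 \<or> degree p < degree g")
    case True
    then show ?thesis using less.prems cl(1) by (intro exI[of _ 0] exI[of _ p]) auto
  next
    case False
    let ?m = "monom (lead_coeff p / lead_coeff g) (degree p - degree g)"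
    have "lead_coeff p / lead_coeff g \<in> K"
      using less.prems g unfolding coeffs_in_def by (intro subfield_closed(11)[OF K]) auto
    then have m: "coeffs_in K ?m" by (rule cl(9)[OF _])
    let ?p = "p - ?m * g"
    have p': "coeffs_in K ?p" using cl(5)[OF less.prems cl(6)[OF m g(1)]] .
    have m0: "?m \<noteq> 0" using False g by simp
    have dm: "degree (?m * g) = degree p" using False g m0
      by (simp add: degree_mult_eq Polynomial.degree_monom_eq)
    have lc: "lead_coeff (?m * g) = lead_coeff p" unfolding lead_coeff_mult lead_coeff_monom using g by simp
    have "?p = 0 \<or> degree ?p < degree p"
    proof (cases "degree p = 0")
      case True
      then have "degree ?p = 0" using degree_diff_le[of p 0 "?m * g"] dm by simp
      then obtain c where "?p = [:c:]" by (rule degree_eq_zeroE)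
      moreover have "coeff ?p 0 = 0" using lc dm True by simp
      ultimately show ?thesis by simp
    next
      case dp: False
      have "degree ?p \<le> degree p" using degree_diff_le[of p "degree p" "?m * g"] dm by simp
      moreover have "coeff ?p (degree p) = 0" using lc dm by simp
      ultimately show ?thesis using dp by (metis le_neq_implies_less leading_coeff_0_iff)
    qed
    then have "\<exists>s r. coeffs_in K s \<and> coeffs_in K r \<and> ?p = s * g + r \<and> (r = 0 \<or> degree r < degree g)"
    proof
      assume "?p = 0"
      then show ?thesis using cl(1) by (intro exI[of _ 0]) simp
    qed (rule less.hyps[OF _ p'])
    then obtain s r where sr: "coeffs_in K s" "coeffs_in K r" "?p = s * g + r" "r = 0 \<or> degree r < degree g"
      by blast
    have "p = (s + ?m) * g + r" using sr(3) by (simp add: algebra_simps)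
    then show ?thesis using cl(4)[OF sr(1) m] sr(2,4) by blast
  qed
qed

text \<open>The Euclidean algorithm with coefficients kept in the subfield. It returns the cofactors
  and a relation between them, which is what a reduced fraction consists of.\<close>

lemma bezout_over:
  assumes K: "subfield K (univ_ring :: 'a::field ring)"
  shows "coeffs_in K p \<Longrightarrow> coeffs_in K g \<Longrightarrow> g \<noteq> 0 \<Longrightarrow>
    \<exists>d p' g' u v. coeffs_in K p' \<and> coeffs_in K g' \<and> p = d * p' \<and> g = d * g' \<and> coeffs_in K u \<and>
      coeffs_in K v \<and> u * p' + v * g' = 1"
proof (induction "degree g" arbitrary: p g rule: less_induct)
  case less
  note cl = coeffs_in_closed[OF subfield_subring[OF K]]
  obtain s r where sr: "coeffs_in K s" "coeffs_in K r" "p = s * g + r" "r = 0 \<or> degree r < degree g"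
    using division_over[OF K less.prems(2,3,1)] by blast
  show ?case
  proof (cases "r = 0")
    case True
    then show ?thesis using sr(1,3) cl(1,2)
      by (intro exI[of _ g] exI[of _ s] exI[of _ 1] exI[of _ 0]) (simp add: mult.commute)
  next
    case False
    with sr(4) have "degree r < degree g" by simp
    from less.hyps[OF this less.prems(2) sr(2) False] obtain d g' r' u v where
      *: "coeffs_in K g'" "coeffs_in K r'" "g = d * g'" "r = d * r'" "coeffs_in K u" "coeffs_in K v"
        "u * g' + v * r' = 1"
      by blast
    have "p = d * (s * g' + r')" unfolding sr(3) *(3,4) by (simp add: algebra_simps)
    moreover have "v * (s * g' + r') + (u - v * s) * g' = 1" using *(7) by (simp add: algebra_simps)
    moreover have "coeffs_in K (s * g' + r')" "coeffs_in K (u - v * s)" by (intro cl sr *)+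
    ultimately show ?thesis using * by blast
  qed
qed

text \<open>Over an algebraically closed field a non-unit \<open>q\<close> has a root, so excluding
  squares of linear factors already makes \<open>R\<close> squarefree.\<close>

lemma is_unit_if_power2_dvd:
  fixes R :: "'b::alg_closed_field poly"
  assumes "R \<noteq> 0" "q ^ 2 dvd R" "\<And>c. \<not> [:- c, 1:] ^ 2 dvd R" shows "is_unit q"
proof (rule ccontr)
  assume nu: "\<not> is_unit q"
  have "q \<noteq> 0" using assms(1,2) by auto
  then have "degree q > 0" using nu is_unit_iff_degree by blast
  then obtain c where "poly q c = 0" using alg_closed_imp_poly_has_root by blast
  then have "[:- c, 1:] dvd q" by (simp add: poly_eq_0_iff_dvd)
  then have "[:- c, 1:] ^ 2 dvd q ^ 2" by (rule dvd_power_same)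
  then show False using assms(2,3) dvd_trans by blast
qed

context
  fixes K :: "'a::field set" and x :: 'a
  assumes K: "subfield K univ_ring" and x: "transcendental_over K x"
begin

private lemmas Kr = subfield_subring[OF K]
private lemmas pcl = coeffs_in_closed[OF Kr]

lemma adjoin_rational_functions:
  "adjoin K {x} = {poly p x / poly q x | p q. coeffs_in K p \<and> coeffs_in K q \<and> q \<noteq> 0}" (is "_ = ?F")
proof -
  have nz: "poly q x \<noteq> 0" if "coeffs_in K q" "q \<noteq> 0" for q
    using transcendental_overD[OF x that(1)] that(2) by blast
  have FI: "poly p x / poly q x \<in> ?F" if "coeffs_in K p" "coeffs_in K q" "q \<noteq> 0" for p q
    using that by blast
  have sub: "subfield ?F univ_ring"
  proof (rule subfieldI_univ)
    show "1 \<in> ?F" using FI[OF pcl(2) pcl(2)] by simp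
    fix f assume "f \<in> ?F"
    then obtain p q where f: "coeffs_in K p" "coeffs_in K q" "q \<noteq> 0" "f = poly p x / poly q x" by blast
    show "- f \<in> ?F" using FI[OF pcl(3)[OF f(1)] f(2,3)] f(4) by simp
    show "inverse f \<in> ?F"
    proof (cases "p = 0")
      case True
      then show ?thesis using FI[OF pcl(1) pcl(2)] f(4) by simp
    next
      case False
      then show ?thesis using FI[OF f(2,1) False] f(4) by simp
    qed
    fix g assume "g \<in> ?F"
    then obtain r s where g: "coeffs_in K r" "coeffs_in K s" "s \<noteq> 0" "g = poly r x / poly s x" by blast
    have "f * g = poly (p * r) x / poly (q * s) x" unfolding f g by simp
    then show "f * g \<in> ?F" using FI[OF pcl(6)[OF f(1) g(1)] pcl(6)[OF f(2) g(2)]] f(3) g(3) by simp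
    have "f + g = poly (p * s + r * q) x / poly (q * s) x"
      unfolding f(4) g(4) using nz[OF f(2,3)] nz[OF g(2,3)] by (simp add: add_frac_eq)
    then show "f + g \<in> ?F"
      using FI[OF pcl(4)[OF pcl(6)[OF f(1) g(2)] pcl(6)[OF g(1) f(2)]] pcl(6)[OF f(2) g(2)]] f(3) g(3) by simp
  qed
  have "K \<subseteq> ?F"
  proof
    fix c assume "c \<in> K"
    then have "coeffs_in K [:c:]" using subfield_closed(1)[OF K] by simp
    from FI[OF this pcl(2)] show "c \<in> ?F" by simp
  qed
  moreover have "x \<in> ?F"
    using FI[of "[:0, 1:]" 1] pcl(2) subfield_closed(1,2)[OF K] by simp
  moreover have "?F \<subseteq> adjoin K {x}"
  proof
    fix f assume "f \<in> ?F"
    then obtain p q where f: "coeffs_in K p" "coeffs_in K q" "f = poly p x / poly q x" by blast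
    have "K \<subseteq> adjoin K {x}" "x \<in> adjoin K {x}" using adjoin_superset[of K "{x}"] by auto
    then show "f \<in> adjoin K {x}" unfolding f(3)
      by (intro subfield_closed(11)[OF adjoin_subfield] poly_in_subring[OF subfield_subring[OF
        adjoin_subfield]] coeffs_in_mono[OF f(1)] coeffs_in_mono[OF f(2)])
  qed
  ultimately show ?thesis by (intro adjoin_eqI sub) auto
qed

lemma reduced_fraction:
  assumes "f \<in> adjoin K {x}"
  obtains p q where "coeffs_in K p" "coeffs_in K q" "q \<noteq> 0" "comaximal p q" "f = poly p x / poly q
    x" "poly q x \<noteq> 0"
proof -
  obtain p q where f: "coeffs_in K p" "coeffs_in K q" "q \<noteq> 0" "f = poly p x / poly q x"
    using assms unfolding adjoin_rational_functions by blast
  obtain d p' q' u v where *: "coeffs_in K p'" "coeffs_in K q'" "p = d * p'" "q = d * q'" "u * p' + v * q' = 1"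
    using bezout_over[OF K f(1-3)] by blast
  have "comaximal p' q'" using *(5) unfolding comaximal_def by blast
  moreover have nz: "poly q x \<noteq> 0" using transcendental_overD[OF x f(2)] f(3) by blast
  then have "f = poly p' x / poly q' x" "poly q' x \<noteq> 0" unfolding f(4) *(3,4) by auto
  moreover have "q' \<noteq> 0" using f(3) *(4) by auto
  ultimately show ?thesis using *(1,2) that by blast
qed

lemma poly_ring_subset_adjoin: "poly_ring K x \<subseteq> adjoin K {x}"
  using adjoin_superset[of K "{x}"] by (intro poly_ring_subset subfield_subring[OF adjoin_subfield]) auto

lemma const_denominator_in_poly_ring:
  assumes "coeffs_in K p" "coeffs_in K q" "is_unit q"
  shows "poly p x / poly q x \<in> poly_ring K x"
proof -
  obtain c where c: "q = [:c:]" using assms(3) is_unit_polyE by blast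
  then have "c \<in> K" using assms(2) by simp
  then have "coeffs_in K (smult (inverse c) p)" using pcl(8)[OF _ assms(1)] subfield_closed(10)[OF K] by blast
  from poly_ringI[OF this, of x] show ?thesis unfolding c
    by (simp add: field_class.field_divide_inverse mult.commute)
qed

text \<open>The rational root argument: multiplied by \<open>q ^ n\<close>, the equation of
  \<open>p / q\<close> shows that \<open>q\<close> divides \<open>p ^ n\<close>, and coprimality
  makes \<open>q\<close> a constant.\<close>

lemma poly_ring_integrally_closed:
  assumes f: "f \<in> adjoin K {x}" and P: "lead_coeff P = 1" "coeffs_in (poly_ring K x) P" "poly P f = 0"
  shows "f \<in> poly_ring K x"
proof -
  obtain p q where pq: "coeffs_in K p" "coeffs_in K q" "q \<noteq> 0" "comaximal p q" "f = poly p x / poly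
    q x" "poly q x \<noteq> 0"
    using reduced_fraction[OF f] .
  have "\<forall>i. \<exists>a. coeffs_in K a \<and> coeff P i = poly a x" using P(2) unfolding coeffs_in_def poly_ring_def by blast
  then obtain a where a: "\<And>i. coeffs_in K (a i)" "\<And>i. coeff P i = poly (a i) x" by metis
  define n where "n = degree P"
  have tm: "coeff P i * f ^ i * poly q x ^ n = poly (a i * p ^ i * q ^ (n - i)) x" if "i \<le> n" for i
  proof -
    have "poly q x ^ n = poly q x ^ i * poly q x ^ (n - i)" using that by (simp add: power_add[symmetric])
    then show ?thesis using pq(6) unfolding pq(5) a(2) by (simp add: power_divide)
  qed
  define S where "S = (\<Sum>i<n. a i * p ^ i * q ^ (n - i))"
  have S: "coeffs_in K S" unfolding S_def by (intro coeffs_in_sum[OF Kr] pcl a pq)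
  have "0 = (\<Sum>i\<le>n. coeff P i * f ^ i) * poly q x ^ n" using P(3) unfolding poly_altdef n_def by simp
  also have "\<dots> = (\<Sum>i\<le>n. poly (a i * p ^ i * q ^ (n - i)) x)"
    unfolding sum_distrib_right by (intro sum.cong) (auto simp: tm)
  also have "\<dots> = poly S x + poly (a n * p ^ n) x"
    unfolding S_def lessThan_Suc_atMost[symmetric] by (simp add: poly_sum)
  also have "poly (a n * p ^ n) x = poly (p ^ n) x" using a(2)[of n] P(1) unfolding n_def by simp
  finally have "poly (S + p ^ n) x = 0" by simp
  then have e: "S + p ^ n = 0" by (rule transcendental_overD[OF x pcl(4)[OF S pcl(7)[OF pq(1)]]])
  have "q dvd S" unfolding S_def
    by (intro dvd_sum dvd_mult) (metis dvd_power lessThan_iff zero_less_diff)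
  then have "q dvd p ^ n" using e by (metis add_eq_0_iff dvd_minus_iff)
  then have "is_unit q" using comaximal_dvd_mult[of "p ^ n" q 1] comaximal_power[OF pq(4), of n 1] by simp
  then show ?thesis using const_denominator_in_poly_ring[OF pq(1,2)] pq(5) by simp
qed

end

lemma poly_Gal:
  assumes \<sigma>: "\<sigma> \<in> carrier (Gal E L)" and E: "subfield E (univ_ring :: 'a::field ring)"
    and L: "subfield L univ_ring"
    and LE: "L \<subseteq> E" and b: "b \<in> E" and p: "coeffs_in L p"
  shows "\<sigma> (poly p b) = poly p (\<sigma> b)"
  using p
proof (induction p)
  case 0
  show ?case using \<sigma> subfield_closed(1)[OF L] unfolding carrier_Gal by simp
next
  case (pCons c p)
  have c: "c \<in> L" "coeffs_in L p" using pCons.prems by auto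
  have "poly p b \<in> E" by (rule poly_in_subring[OF subfield_subring[OF E] coeffs_in_mono[OF c(2) LE] b])
  then have "b * poly p b \<in> E" using subfield_closed(6)[OF E b] by blast
  then show ?case using \<sigma> c(1) LE b \<open>poly p b \<in> E\<close> pCons.IH[OF c(2)] unfolding carrier_Gal by auto
qed

text \<open>\<open>R\<close> is squarefree over an algebraically closed field, hence geometrically,
  and this is what makes coordinates describe the integral closure. Besides both charts of the
  covers, the locale is applied to \<open>\<complex>(U)\<close> with a square root of
  \<open>U\<close> adjoined.\<close>

locale quadratic_function_field =
  fixes K :: "'a::alg_closed_field set" and x Z :: 'a and R :: "'a poly"
  assumes K: "subfield K univ_ring" and x: "transcendental_over K x"
    and R: "coeffs_in K R" and deg_R: "degree R > 0" and sqfree: "\<And>c. \<not> [:- c, 1:] ^ 2 dvd R"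
    and Z: "Z ^ 2 = poly R x" and two: "(2 :: 'a) \<noteq> 0"
begin

abbreviation "Kx \<equiv> adjoin K {x}"
abbreviation "M \<equiv> quad_ext Kx Z"
abbreviation "B \<equiv> quad_ext (poly_ring K x) Z"

lemmas Kr = subfield_subring[OF K]
lemmas pcl = coeffs_in_closed[OF Kr]
lemmas Kx = adjoin_subfield[of K "{x}"]
lemmas Kxr = subfield_subring[OF Kx]
lemmas pr = subring_poly_ring[OF Kr, of x]
lemmas prK = poly_ring_subset_adjoin[OF K x]

lemma R0: "R \<noteq> 0" using deg_R by auto

lemma RKx: "Z ^ 2 \<in> Kx" using poly_ringI[OF R, of x] prK unfolding Z by blast

text \<open>From \<open>Z = p / q\<close> in lowest terms, \<open>p ^ 2 = q ^ 2 * R\<close>; so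
  \<open>q\<close> is constant and \<open>p ^ 2\<close> divides the squarefree \<open>R\<close>,
  which makes \<open>p\<close> and then \<open>R\<close> constant.\<close>

lemma Z_notin: "Z \<notin> Kx"
proof
  assume "Z \<in> Kx"
  then obtain p q where pq: "coeffs_in K p" "coeffs_in K q" "q \<noteq> 0" "comaximal p q" "Z = poly p x /
    poly q x" "poly q x \<noteq> 0"
    by (rule reduced_fraction[OF K x])
  have "poly (p ^ 2) x = poly (q ^ 2 * R) x" using Z pq(6) unfolding pq(5) by (simp add: field_simps)
  then have e: "p ^ 2 = q ^ 2 * R" by (rule transcendental_over_eqD[OF Kr x pcl(7)[OF pq(1)]
    pcl(6)[OF pcl(7)[OF pq(2)] R]])
  then have "q dvd p ^ 2" by (metis dvd_mult_left dvd_triv_left power2_eq_square)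
  then have "is_unit q" using comaximal_dvd_mult[of "p ^ 2" q 1] comaximal_power[OF pq(4), of 2 1] by simp
  then have "is_unit (q ^ 2)" using dvd_power_same[of q 1 2] by simp
  then have dvd: "p ^ 2 dvd R" unfolding e by (metis dvd_refl mult_unit_dvd_iff')
  have "degree (p ^ 2) > 0" unfolding e using deg_R pq(3) R0 by (simp add: degree_mult_eq)
  moreover have "is_unit p" using is_unit_if_power2_dvd[OF R0 dvd sqfree] .
  then obtain c where "p = [:c:]" by (rule is_unit_polyE)
  ultimately show False by (simp add: power2_eq_square)
qed

lemmas M = subfield_quad_ext[OF Kx RKx]
lemmas Mr = subfield_subring[OF M]

lemma B_coords_unique:
  assumes "a \<in> poly_ring K x" "b \<in> poly_ring K x" "a' \<in> poly_ring K x" "b' \<in> poly_ring K x" "a + b *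
    Z = a' + b' * Z"
  shows "a = a'" "b = b'"
  using quad_coords_unique[OF Kx RKx Z_notin _ _ _ _ assms(5)] assms(1-4) prK by blast+

text \<open>Here squarefreeness enters: a denominator \<open>q\<close> of \<open>g\<close> satisfies
  \<open>q ^ 2 dvd R\<close>. This forces the coefficient of \<open>Z\<close> in an integral element
  to be a polynomial.\<close>

lemma square_in_poly_ring:
  assumes g: "g \<in> Kx" and e: "g ^ 2 * poly R x \<in> poly_ring K x"
  shows "g \<in> poly_ring K x"
proof -
  obtain p q where pq: "coeffs_in K p" "coeffs_in K q" "q \<noteq> 0" "comaximal p q" "g = poly p x / poly
    q x" "poly q x \<noteq> 0"
    using reduced_fraction[OF K x g] .
  obtain m where m: "coeffs_in K m" "g ^ 2 * poly R x = poly m x" using e by (rule poly_ringE)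
  have "poly (p ^ 2 * R) x = poly (q ^ 2 * m) x" using m(2) pq(6) unfolding pq(5) by (simp add: field_simps)
  then have "p ^ 2 * R = q ^ 2 * m"
    by (rule transcendental_over_eqD[OF Kr x pcl(6)[OF pcl(7)[OF pq(1)] R] pcl(6)[OF pcl(7)[OF pq(2)] m(1)]])
  then have "q ^ 2 dvd p ^ 2 * R" by simp
  then have "q ^ 2 dvd R" by (rule comaximal_dvd_mult[OF comaximal_power[OF pq(4)]])
  then have "is_unit q" by (rule is_unit_if_power2_dvd[OF R0 _ sqfree])
  then show ?thesis using const_denominator_in_poly_ring[OF K x pq(1,2)] pq(5) by simp
qed

lemma integral_conj:
  assumes A: "A \<subseteq> Kx" and f: "f \<in> Kx" "g \<in> Kx" and int: "f + g * Z \<in> integral_closure A M"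
  shows "f - g * Z \<in> integral_closure A M"
proof -
  obtain P where P: "lead_coeff P = 1" "coeffs_in A P" "poly P (f + g * Z) = 0" using int
    unfolding integral_closure_def by blast
  let ?\<sigma> = "\<lambda>b\<in>M. quad_conj Kx Z b"
  have \<sigma>: "?\<sigma> \<in> carrier (Gal M Kx)" unfolding carrier_Gal_quad_ext[OF Kx RKx Z_notin two] by blast
  have b: "f + g * Z \<in> M" by (rule quad_extI[OF f])
  have s: "?\<sigma> (f + g * Z) = f - g * Z" using b quad_conj_eq[OF Kx RKx Z_notin two f] by simp
  have "poly P (f - g * Z) = ?\<sigma> (poly P (f + g * Z))"
    using poly_Gal[OF \<sigma> M Kx base_subset_quad_ext[OF Kx RKx] b coeffs_in_mono[OF P(2) A]]
      unfolding s by (rule sym)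
  also have "\<dots> = 0"
    using quad_conj_eq[OF Kx RKx Z_notin two subfield_closed(1,1)[OF Kx]] subfield_closed(1)[OF M]
    unfolding P(3) by simp
  finally have "poly P (f - g * Z) = 0" .
  moreover have "f - g * Z \<in> M" using quad_extI[OF f(1) subfield_closed(3)[OF Kx f(2)], of Z] by simp
  ultimately show ?thesis using P unfolding integral_closure_def by blast
qed

text \<open>The trace of \<open>f + g * Z\<close> is \<open>2 * f\<close> and its norm is
  \<open>f ^ 2 - g ^ 2 * poly R x\<close>. The ring \<open>A\<close> stays general because it will
  be \<open>K\<close>, then \<open>K[x]\<close> and, for the model, a polynomial ring over a local
  ring.\<close>

lemma integral_trace_norm:
  assumes A: "subring A univ_ring" "A \<subseteq> Kx" and half: "inverse 2 \<in> A"
    and f: "f \<in> Kx" "g \<in> Kx" and int: "f + g * Z \<in> integral_closure A M"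
  shows "f \<in> integral_closure A Kx" "f ^ 2 - g ^ 2 * poly R x \<in> integral_closure A Kx"
    "g ^ 2 * poly R x \<in> integral_closure A Kx"
proof -
  have AM: "A \<subseteq> M" using A(2) base_subset_quad_ext[OF Kx RKx] by blast
  note cl = subring_closed[OF subring_integral_closure[OF A(1) Mr AM]]
  note clx = subring_closed[OF subring_integral_closure[OF A(1) Kxr A(2)]]
  note int' = integral_conj[OF A(2) f int]
  have KM: "a \<in> integral_closure A Kx" if "a \<in> Kx" "a \<in> integral_closure A M" for a
    using that unfolding integral_closure_def by blast
  have "inverse 2 * ((f + g * Z) + (f - g * Z)) \<in> integral_closure A M"
    by (intro cl int int' subsetD[OF subset_integral_closure[OF A(1) AM]] half)
  moreover have "inverse 2 * ((f + g * Z) + (f - g * Z)) = inverse 2 * (2 * f)" by simp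
  then have "inverse 2 * ((f + g * Z) + (f - g * Z)) = f" using two by (metis left_inverse mult.assoc mult_1)
  ultimately show f': "f \<in> integral_closure A Kx" using KM f(1) by simp
  have "(f + g * Z) * (f - g * Z) \<in> integral_closure A M" by (intro cl int int')
  moreover have "(f + g * Z) * (f - g * Z) = f ^ 2 - g ^ 2 * poly R x"
    unfolding Z[symmetric] by (simp add: algebra_simps power2_eq_square)
  moreover have "f ^ 2 - g ^ 2 * poly R x \<in> Kx"
    using RKx f unfolding Z by (intro subfield_closed[OF Kx])
  ultimately show n: "f ^ 2 - g ^ 2 * poly R x \<in> integral_closure A Kx" using KM by simp
  have "f ^ 2 - (f ^ 2 - g ^ 2 * poly R x) \<in> integral_closure A Kx" by (intro clx f' n)
  then show "g ^ 2 * poly R x \<in> integral_closure A Kx" by simp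
qed

lemma integral_closure_Kx: "integral_closure (poly_ring K x) Kx = poly_ring K x"
  using poly_ring_integrally_closed[OF K x] subset_integral_closure[OF pr prK]
  unfolding integral_closure_def by blast

lemma integral_closure_M: "integral_closure (poly_ring K x) M = B"
proof
  have prM: "poly_ring K x \<subseteq> M" using prK base_subset_quad_ext[OF Kx RKx] by blast
  have half: "inverse 2 \<in> poly_ring K x"
    using subfield_closed(9,10,1)[OF K] const_in_poly_ring by blast
  show "integral_closure (poly_ring K x) M \<subseteq> B"
  proof
    fix b assume b: "b \<in> integral_closure (poly_ring K x) M"
    then have "b \<in> M" unfolding integral_closure_def by blast
    then obtain f g where fg: "f \<in> Kx" "g \<in> Kx" "b = f + g * Z" by (rule quad_extE)
    note tn = integral_trace_norm[OF pr prK half fg(1,2) b[unfolded fg(3)], unfolded integral_closure_Kx]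
    show "b \<in> B" unfolding fg(3) by (intro quad_extI tn(1) square_in_poly_ring[OF fg(2) tn(3)])
  qed
  note ic = subring_integral_closure[OF pr Mr prM]
  have "Z \<in> integral_closure (poly_ring K x) M"
    unfolding integral_closure_def
  proof (intro CollectI conjI exI)
    show "Z \<in> M" by (rule root_in_quad_ext[OF Kx RKx])
    show "lead_coeff [:- poly R x, 0, 1:] = 1" by simp
    show "coeffs_in (poly_ring K x) [:- poly R x, 0, 1:]"
      using poly_ringI[OF R, of x] subring_closed(1-3)[OF pr] by simp
    show "poly [:- poly R x, 0, 1:] Z = 0" using Z by (simp add: power2_eq_square)
  qed
  then show "B \<subseteq> integral_closure (poly_ring K x) M"
    by (auto elim!: quad_extE intro!: subring_closed(4,6)[OF ic] dest: subsetD[OF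
      subset_integral_closure[OF pr prM]])
qed

lemma subring_B: "subring B univ_ring"
  using subring_integral_closure[OF pr Mr] prK base_subset_quad_ext[OF Kx RKx]
  unfolding integral_closure_M by blast

end

section \<open>Specializations and ramification\<close>

lemma domain_on: "subring B (univ_ring :: 'a::field ring) \<Longrightarrow> domain (on B)"
  by (rule domain.subring_is_domain[OF field.axioms(1)[OF field_from_type_algebra]])

lemma ring_on: "subring B (univ_ring :: 'a::field ring) \<Longrightarrow> ring (on B)"
  by (rule ring.subring_is_ring[OF ring_from_type_algebra])

lemma field_on: "subfield E (univ_ring :: 'a::field ring) \<Longrightarrow> Ring.field (on E)"
  using ring.subfield_iff[OF ring_from_type_algebra, of E] by simp

lemma ring_hom_on_iff:
  "h \<in> Ring.ring_hom (on B) (on E) \<longleftrightarrow> h ` B \<subseteq> E \<and> (\<forall>a\<in>B. \<forall>b\<in>B. h (a * b) = h a * h b) \<and>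
     (\<forall>a\<in>B. \<forall>b\<in>B. h (a + b) = h a + h b) \<and> h 1 = (1 :: 'a::field)"
  unfolding Ring.ring_hom_def by auto

lemma a_kernel_on: "a_kernel (on B) (on E) h = {b \<in> B. h b = (0 :: 'a::field)}"
  unfolding a_kernel_def' by simp

lemma genideal_single:
  assumes B: "subring B (univ_ring :: 'a::field ring)" and s: "s \<in> B"
  shows "genideal (on B) {s} = {b * s | b. b \<in> B}"
proof -
  interpret domain "on B" by (rule domain_on[OF B])
  have "PIdl\<^bsub>on B\<^esub> s = Idl\<^bsub>on B\<^esub> {s}" using s by (intro cgenideal_eq_genideal) simp
  then show ?thesis unfolding cgenideal_def by simp
qed

lemma combination_in_genideal:
  assumes B: "subring B (univ_ring :: 'a::field ring)" and "s \<in> B" "t \<in> B" "a \<in> B" "b \<in> B"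
  shows "a * s + b * t \<in> genideal (on B) {s, t}"
proof -
  interpret domain "on B" by (rule domain_on[OF B])
  interpret I: ideal "genideal (on B) {s, t}" "on B" using assms by (intro genideal_ideal) simp
  have "s \<in> genideal (on B) {s, t}" "t \<in> genideal (on B) {s, t}"
    using genideal_self[of "{s, t}"] assms by auto
  then show ?thesis using I.I_l_closed[of s a] I.I_l_closed[of t b] I.a_closed[of "a * s" "b * t"] assms by simp
qed

text \<open>Trades residue fields for homomorphisms: composed with the quotient map, the isomorphism
  becomes a surjection of the chart onto \<open>E\<close>, which can be evaluated at the
  generators.\<close>

lemma is_specialization_hom:
  assumes "is_specialization L T F t (E :: 'a::field set)"
  defines "B \<equiv> chart_closure L T F t"
  obtains \<Psi> where "\<Psi> \<in> Ring.ring_hom (on B) (on E)" "\<Psi> ` B = E" "\<And>c. c \<in> L \<Longrightarrow> \<Psi> c = c"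
    "local_parameter T t \<in> B" "\<Psi> (local_parameter T t) = 0"
proof -
  let ?R = "on B"
  obtain M \<psi> where M: "primeideal M ?R" "local_parameter T t \<in> M"
    and \<psi>: "\<psi> \<in> ring_iso (?R Quot M) (on E)" "\<And>c. c \<in> L \<Longrightarrow> \<psi> (M +>\<^bsub>?R\<^esub> c) = c"
    using assms(1) unfolding is_specialization_def Let_def B_def by blast
  interpret M: primeideal M ?R by fact
  interpret E: ring "on E" using assms(1) ring_on[OF subfield_subring] unfolding is_specialization_def by blast
  have q: "(+>\<^bsub>?R\<^esub>) M \<in> Ring.ring_hom ?R (?R Quot M)" by (rule M.rcos_ring_hom)
  have hom: "\<psi> \<in> Ring.ring_hom (?R Quot M) (on E)" and bij: "bij_betw \<psi> (carrier (?R Quot M)) E"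
    using \<psi>(1) unfolding ring_iso_def by auto
  let ?\<Psi> = "\<psi> \<circ> (+>\<^bsub>?R\<^esub>) M"
  have "?\<Psi> \<in> Ring.ring_hom ?R (on E)" by (rule ring_hom_trans[OF q hom])
  moreover have "(+>\<^bsub>?R\<^esub>) M ` B = carrier (?R Quot M)"
    unfolding FactRing_def A_RCOSETS_def' by auto
  then have "?\<Psi> ` B = E" using bij_betw_imp_surj_on[OF bij] by (metis image_comp)
  moreover have lB: "local_parameter T t \<in> B" using M(2) M.Icarr by simp
  moreover have "M +>\<^bsub>?R\<^esub> local_parameter T t = \<zero>\<^bsub>?R Quot M\<^esub>"
    using M.a_rcos_const[OF M(2)] by (simp add: FactRing_def)
  then have "?\<Psi> (local_parameter T t) = 0"
    using ring_hom_zero[OF hom M.quotient_is_ring E.ring_axioms] by simp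
  ultimately show ?thesis using \<psi>(2) that[of ?\<Psi>] by simp
qed

text \<open>The prime ideal is the kernel of \<open>\<Psi>\<close>, prime because \<open>E\<close>
  is a field, and the first isomorphism theorem identifies the residue ring.\<close>

lemma is_specializationI:
  assumes E: "subfield E (univ_ring :: 'a::field ring)" and LE: "L \<subseteq> E"
    and B: "subring (chart_closure L T F t) univ_ring" "L \<subseteq> chart_closure L T F t"
    and \<Psi>: "\<Psi> \<in> Ring.ring_hom (on (chart_closure L T F t)) (on E)" "\<Psi> ` chart_closure L T F t = E"
      "\<And>c. c \<in> L \<Longrightarrow> \<Psi> c = c"
    and lp: "local_parameter T t \<in> chart_closure L T F t" "\<Psi> (local_parameter T t) = 0"
  shows "is_specialization L T F t E"
proof -
  define B' where "B' = chart_closure L T F t"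
  let ?R = "on B'"
  note \<Psi>' = \<Psi>[folded B'_def]
  interpret R: domain ?R using domain_on[OF B(1)] unfolding B'_def .
  interpret E: Ring.field "on E" by (rule field_on[OF E])
  interpret h: ring_hom_ring ?R "on E" \<Psi> using \<Psi>'(1) by unfold_locales
  define M where "M = a_kernel ?R (on E) \<Psi>"
  have M: "M = {b \<in> B'. \<Psi> b = 0}" unfolding M_def a_kernel_on ..
  have 1: "primeideal M ?R"
  proof (rule primeidealI)
    show "ideal M ?R" unfolding M_def by (rule h.kernel_is_ideal)
    show "cring ?R" by (rule R.is_cring)
    have "1 \<notin> M" using \<Psi>'(1) unfolding M ring_hom_on_iff by simp
    then show "carrier ?R \<noteq> M" using R.one_closed by auto
    fix a b assume "a \<in> carrier ?R" "b \<in> carrier ?R" "a \<otimes>\<^bsub>?R\<^esub> b \<in> M"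
    then show "a \<in> M \<or> b \<in> M" using \<Psi>'(1) unfolding M ring_hom_on_iff by simp
  qed
  have 2: "local_parameter T t \<in> M" using lp unfolding M B'_def by simp
  have "(\<lambda>C. the_elem (\<Psi> ` C)) \<in> ring_iso (?R Quot M) ((on E)\<lparr>carrier := \<Psi> ` carrier ?R\<rparr>)"
    unfolding M_def by (rule h.FactRing_iso_set_aux)
  then have 3: "(\<lambda>C. the_elem (\<Psi> ` C)) \<in> ring_iso (?R Quot M) (on E)" using \<Psi>'(2) by simp
  have 4: "the_elem (\<Psi> ` (M +>\<^bsub>?R\<^esub> c)) = c" if "c \<in> L" for c
  proof -
    have "c \<in> carrier ?R" using B(2) that unfolding B'_def by auto
    from h.the_elem_simp[OF this] show ?thesis using \<Psi>(3)[OF that] unfolding M_def by simp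
  qed
  show ?thesis
    unfolding is_specialization_def Let_def B'_def[symmetric]
    by (intro conjI exI[of _ M] bexI[OF _ 3] ballI E LE 1 2 4)
qed

lemma hom_poly:
  assumes h: "h \<in> Ring.ring_hom (on B) (on E)" and B: "subring B (univ_ring :: 'a::field ring)"
    and KB: "K \<subseteq> B" and hK: "\<And>c. c \<in> K \<Longrightarrow> h c = c" and b: "b \<in> B" and p: "coeffs_in K p" "0 \<in> K"
  shows "h (poly p b) = poly p (h b)"
  using p(1)
proof (induction p)
  case 0
  show ?case using hK[OF p(2)] by simp
next
  case (pCons c p)
  have c: "c \<in> K" "coeffs_in K p" using pCons.prems by auto
  have pb: "poly p b \<in> B" by (rule poly_in_subring[OF B coeffs_in_mono[OF c(2) KB] b])
  then have "b * poly p b \<in> B" using subring_closed(6)[OF B b] by blast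
  then show ?case using h c(1) hK[OF c(1)] KB b pb pCons.IH[OF c(2)] unfolding ring_hom_on_iff by auto
qed

lemma poly_split_at:
  fixes p :: "'a::field poly"
  shows "poly p y = poly p c + (y - c) * poly (synthetic_div p c) y"
proof -
  have "poly p y = poly ([:- c, 1:] * synthetic_div p c + [:poly p c:]) y"
    using synthetic_div_correct'[of c p] by simp
  then show ?thesis by (simp add: algebra_simps)
qed

context quadratic_function_field
begin

lemma K_subset_B: "K \<subseteq> B" and x_in_B: "x \<in> B" and Z_in_B: "Z \<in> B" and poly_ring_subset_B: "poly_ring K x \<subseteq> B"
proof -
  note cl = subring_closed[OF pr]
  show sub: "poly_ring K x \<subseteq> B" using quad_extI[of _ "poly_ring K x" 0 Z] cl(1) by force
  show "K \<subseteq> B" using sub const_in_poly_ring[OF _ subfield_closed(1)[OF K]] by blast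
  show "x \<in> B" using sub var_in_poly_ring[OF subfield_closed(1,2)[OF K]] by blast
  show "Z \<in> B" using quad_extI[OF cl(1,2), of Z] by simp
qed

lemma B_E:
  assumes "b \<in> B"
  obtains p q where "coeffs_in K p" "coeffs_in K q" "b = poly p x + poly q x * Z"
  using assms by (elim quad_extE poly_ringE) blast

lemma B_I: "coeffs_in K p \<Longrightarrow> coeffs_in K q \<Longrightarrow> poly p x + poly q x * Z \<in> B"
  by (intro quad_extI poly_ringI)

text \<open>Evaluation at the point \<open>(x0, z0)\<close>. Unique coordinates and the
  transcendence of \<open>x\<close> justify \<open>THE\<close> for any \<open>x0\<close> and
  \<open>z0\<close>; multiplicativity comes from \<open>z0 ^ 2 = poly R x0\<close>.\<close>

definition eval_B :: "'a \<Rightarrow> 'a \<Rightarrow> 'a \<Rightarrow> 'a" where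
  "eval_B x0 z0 b = (THE v. \<exists>p q. coeffs_in K p \<and> coeffs_in K q \<and> b = poly p x + poly q x * Z \<and>
     v = poly p x0 + poly q x0 * z0)"

lemma eval_B_eq:
  assumes "coeffs_in K p" "coeffs_in K q"
  shows "eval_B x0 z0 (poly p x + poly q x * Z) = poly p x0 + poly q x0 * z0"
  unfolding eval_B_def
proof (rule the_equality)
  fix v assume "\<exists>p' q'. coeffs_in K p' \<and> coeffs_in K q' \<and> poly p x + poly q x * Z = poly p' x + poly q' x * Z \<and>
     v = poly p' x0 + poly q' x0 * z0"
  then obtain p' q' where *: "coeffs_in K p'" "coeffs_in K q'" "poly p x + poly q x * Z = poly p' x
    + poly q' x * Z"
    "v = poly p' x0 + poly q' x0 * z0" by blast
  have "poly p x = poly p' x" "poly q x = poly q' x"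
    using B_coords_unique[OF poly_ringI poly_ringI poly_ringI poly_ringI *(3)] assms *(1,2) by blast+
  then have "p = p'" "q = q'" using transcendental_over_eqD[OF Kr x] assms *(1,2) by blast+
  then show "v = poly p x0 + poly q x0 * z0" using *(4) by simp
qed (use assms in blast)

lemma eval_B_hom:
  assumes z0: "z0 ^ 2 = poly R x0" and x0: "x0 \<in> K" and E: "E = quad_ext K z0"
  shows "eval_B x0 z0 \<in> Ring.ring_hom (on B) (on E)" "eval_B x0 z0 ` B = E"
    "\<And>c. c \<in> K \<Longrightarrow> eval_B x0 z0 c = c" "eval_B x0 z0 x = x0" "eval_B x0 z0 Z = z0"
proof -
  note cl = subfield_closed[OF K]
  have in_K: "poly p x0 \<in> K" if "coeffs_in K p" for p by (rule poly_in_subring[OF Kr that x0])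
  show c: "eval_B x0 z0 c = c" if "c \<in> K" for c
    using eval_B_eq[of "[:c:]" 0 x0 z0] that cl(1) by simp
  show "eval_B x0 z0 x = x0" using eval_B_eq[of "[:0, 1:]" 0 x0 z0] cl(1,2) by simp
  show "eval_B x0 z0 Z = z0" using eval_B_eq[of 0 1 x0 z0] cl(1) pcl(2) by simp
  show img: "eval_B x0 z0 ` B = E"
  proof (intro equalityI subsetI)
    fix v assume "v \<in> eval_B x0 z0 ` B"
    then obtain b where b: "b \<in> B" "v = eval_B x0 z0 b" by blast
    obtain p q where pq: "coeffs_in K p" "coeffs_in K q" "b = poly p x + poly q x * Z" using b(1) by (rule B_E)
    show "v \<in> E" unfolding b(2) pq(3) eval_B_eq[OF pq(1,2)] E by (intro quad_extI in_K pq)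
  next
    fix v assume "v \<in> E"
    then obtain a c where ac: "a \<in> K" "c \<in> K" "v = a + c * z0" unfolding E by (rule quad_extE)
    have co: "coeffs_in K [:a:]" "coeffs_in K [:c:]" using ac cl(1) by auto
    show "v \<in> eval_B x0 z0 ` B" using eval_B_eq[OF co, of x0 z0] B_I[OF co] ac(3) by force
  qed
  show "eval_B x0 z0 \<in> Ring.ring_hom (on B) (on E)"
    unfolding ring_hom_on_iff
  proof (intro conjI ballI)
    show "eval_B x0 z0 ` B \<subseteq> E" using img by simp
    show "eval_B x0 z0 1 = 1" by (rule c[OF cl(2)])
    fix b c assume "b \<in> B" "c \<in> B"
    then obtain p q r s where b: "coeffs_in K p" "coeffs_in K q" "b = poly p x + poly q x * Z"
      and c: "coeffs_in K r" "coeffs_in K s" "c = poly r x + poly s x * Z" by (elim B_E)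
    have "b + c = poly (p + r) x + poly (q + s) x * Z" unfolding b c by (simp add: algebra_simps)
    then show "eval_B x0 z0 (b + c) = eval_B x0 z0 b + eval_B x0 z0 c"
      using eval_B_eq[OF pcl(4)[OF b(1) c(1)] pcl(4)[OF b(2) c(2)], of x0 z0]
      unfolding b(3) c(3) eval_B_eq[OF b(1,2)] eval_B_eq[OF c(1,2)] by (simp add: algebra_simps)
    have "b * c = (poly p x * poly r x + poly q x * poly s x * Z ^ 2) + (poly p x * poly s x + poly
      q x * poly r x) * Z"
      unfolding b c by (simp add: algebra_simps power2_eq_square)
    then have m: "b * c = poly (p * r + q * s * R) x + poly (p * s + q * r) x * Z" unfolding Z by simp
    have "eval_B x0 z0 (b * c) = poly (p * r + q * s * R) x0 + poly (p * s + q * r) x0 * z0"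
      unfolding m by (intro eval_B_eq pcl b c R)
    also have "\<dots> = (poly p x0 + poly q x0 * z0) * (poly r x0 + poly s x0 * z0)"
      using z0 by (simp add: algebra_simps power2_eq_square)
    finally show "eval_B x0 z0 (b * c) = eval_B x0 z0 b * eval_B x0 z0 c"
      unfolding b(3) c(3) eval_B_eq[OF b(1,2)] eval_B_eq[OF c(1,2)] .
  qed
qed

lemma hom_Z:
  assumes h: "h \<in> Ring.ring_hom (on B) (on E)" and hK: "\<And>c. c \<in> K \<Longrightarrow> h c = c"
  shows "h Z ^ 2 = poly R (h x)"
proof -
  have "h Z ^ 2 = h (Z ^ 2)" using h Z_in_B unfolding ring_hom_on_iff power2_eq_square by auto
  also have "\<dots> = poly R (h x)"
    unfolding Z by (rule hom_poly[OF h subring_B K_subset_B hK x_in_B R subfield_closed(1)[OF K]])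
  finally show ?thesis .
qed

text \<open>A homomorphism fixing \<open>K\<close> is evaluation at \<open>(h x, h Z)\<close>, and
  the first of these coordinates lies in \<open>K\<close>.\<close>

lemma hom_image:
  assumes h: "h \<in> Ring.ring_hom (on B) (on E)" and hK: "\<And>c. c \<in> K \<Longrightarrow> h c = c"
    and hx: "h x \<in> K" and E: "h ` B = E"
  shows "E = quad_ext K (h Z)"
proof -
  have ev: "h (poly p x + poly q x * Z) = poly p (h x) + poly q (h x) * h Z"
    if "coeffs_in K p" "coeffs_in K q" for p q
  proof -
    have "poly p x \<in> B" "poly q x \<in> B" "poly q x * Z \<in> B"
      using that poly_ring_subset_B poly_ringI subring_closed(6)[OF subring_B _ Z_in_B] by blast+
    then have "h (poly p x + poly q x * Z) = h (poly p x) + h (poly q x) * h Z"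
      using h Z_in_B unfolding ring_hom_on_iff by auto
    then show ?thesis
      using hom_poly[OF h subring_B K_subset_B hK x_in_B that(1) subfield_closed(1)[OF K]]
        hom_poly[OF h subring_B K_subset_B hK x_in_B that(2) subfield_closed(1)[OF K]] by simp
  qed
  have "h b \<in> quad_ext K (h Z)" if bB: "b \<in> B" for b
  proof -
    obtain p q where pq: "coeffs_in K p" "coeffs_in K q" "b = poly p x + poly q x * Z" using bB by (rule B_E)
    show ?thesis unfolding pq(3) ev[OF pq(1,2)] by (intro quad_extI poly_in_subring[OF Kr _ hx] pq)
  qed
  moreover have "v \<in> h ` B" if v: "v \<in> quad_ext K (h Z)" for v
  proof -
    obtain a c where ac: "a \<in> K" "c \<in> K" "v = a + c * h Z" using v by (rule quad_extE)
    have co: "coeffs_in K [:a:]" "coeffs_in K [:c:]" using ac subfield_closed(1)[OF K] by auto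
    show ?thesis using ev[OF co] B_I[OF co] ac(3) by force
  qed
  ultimately show ?thesis using E by blast
qed

text \<open>For a square root \<open>e\<close> of \<open>poly R x0\<close>, the product
  \<open>(Z - e) * (Z + e)\<close> is a multiple of \<open>x - x0\<close>, so one factor lies in
  \<open>P\<close>; the other differs from it by \<open>2 * e \<noteq> 0\<close> up to sign and is a
  local unit. Hence the factor in \<open>P\<close> is locally a multiple of
  \<open>x - x0\<close>.\<close>

lemma generates_locally_unramified:
  assumes P: "primeideal P (on B)" and x0: "x0 \<in> K" "x - x0 \<in> P"
    and z0: "z0 \<in> K" "z0 \<noteq> 0" "z0 ^ 2 = poly R x0"
  shows "generates_locally B P {x - x0}"
proof -
  interpret P: primeideal P "on B" by fact
  note clB = subring_closed[OF subring_B]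
  have mul: "a * p \<in> P" if "a \<in> B" "p \<in> P" for a p using P.I_l_closed[of p a] that by simp
  have add: "p + q \<in> P" if "p \<in> P" "q \<in> P" for p q using additive_subgroup.a_closed[OF
    P.is_additive_subgroup that] by simp
  have neg: "- p \<in> P" if "p \<in> P" for p using mul[of "-1" p] clB(2,3) that by simp
  have one: "1 \<notin> P" using P.I_notcarr P.one_imp_carrier by auto
  have PB: "P \<subseteq> B" using P.a_subset by simp
  have unit: "c \<notin> P" if "c \<in> K" "c \<noteq> 0" for c
    using mul[of "inverse c" c] subfield_closed(10)[OF K that(1)] K_subset_B that(2) one by auto
  let ?r = "poly (synthetic_div R x0) x"
  have rB: "poly (synthetic_div p x0) x \<in> B" if "coeffs_in K p" for p
    using coeffs_in_synthetic_div[OF Kr x0(1) that] poly_ringI poly_ring_subset_B by blast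
  have ZZ: "(Z - z0) * (Z + z0) = ?r * (x - x0)"
    using poly_split_at[of R x x0] Z z0(3) by (simp add: algebra_simps power2_eq_square)
  have z0B: "z0 \<in> B" using z0(1) K_subset_B by blast
  have "(Z - z0) * (Z + z0) \<in> P" unfolding ZZ by (rule mul[OF rB[OF R] x0(2)])
  then have "Z - z0 \<in> P \<or> Z + z0 \<in> P"
    using P.I_prime[of "Z - z0" "Z + z0"] clB(4,5)[OF Z_in_B z0B] by simp
  then obtain e where e: "e \<in> K" "e \<noteq> 0" "e ^ 2 = poly R x0" "Z - e \<in> P"
  proof
    assume "Z + z0 \<in> P"
    then show ?thesis using z0 subfield_closed(3)[OF K] that[of "- z0"] by simp
  qed (use z0 that in blast)
  have eB: "e \<in> B" using e(1) K_subset_B by blast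
  have ZeB: "Z + e \<in> B" by (rule clB(4)[OF Z_in_B eB])
  have ZZe: "(Z + e) * (Z - e) = ?r * (x - x0)"
    using poly_split_at[of R x x0] Z e(3) by (simp add: algebra_simps power2_eq_square)
  have "Z + e \<notin> P"
  proof
    assume "Z + e \<in> P"
    from add[OF this neg[OF e(4)]] have "2 * e \<in> P" by simp
    moreover have "2 * e \<in> K" by (intro subfield_closed[OF K] e)
    ultimately show False using unit e(2) two by auto
  qed
  moreover have "(Z + e) * b \<in> genideal (on B) {x - x0}" if bP: "b \<in> P" for b
  proof -
    obtain p q where pq: "coeffs_in K p" "coeffs_in K q" "b = poly p x + poly q x * Z"
      using subsetD[OF PB bP] by (rule B_E)
    let ?p = "poly (synthetic_div p x0) x" and ?q = "poly (synthetic_div q x0) x"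
    let ?c = "poly p x0 + poly q x0 * e"
    have K': "poly p x0 \<in> K" "poly q x0 \<in> K" by (intro poly_in_subring[OF Kr _ x0(1)] pq)+
    have qB: "poly q x0 \<in> B" using K' K_subset_B by blast
    \<comment> \<open>Expansion of \<open>b\<close> at the point \<open>(x0, e)\<close>; its
      constant term \<open>?c\<close> lies in \<open>P\<close> and in \<open>K\<close>, hence
      vanishes.\<close>
    have b: "b = ?c + poly q x0 * (Z - e) + (?p + ?q * Z) * (x - x0)"
      unfolding pq(3) poly_split_at[of p x x0] poly_split_at[of q x x0] by (simp add: algebra_simps)
    have pqB: "?p + ?q * Z \<in> B" by (intro clB rB pq Z_in_B)
    have "b + - (poly q x0 * (Z - e)) + - ((?p + ?q * Z) * (x - x0)) \<in> P"
      by (intro add neg mul bP e x0 pqB qB)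
    then have "?c \<in> P" unfolding b by (simp add: algebra_simps)
    moreover have "?c \<in> K" by (intro subfield_closed[OF K] K' e)
    ultimately have "?c = 0" using unit by blast
    then have "(Z + e) * b = poly q x0 * ((Z + e) * (Z - e)) + (Z + e) * (?p + ?q * Z) * (x - x0)"
      unfolding b by (simp add: algebra_simps)
    also have "\<dots> = (poly q x0 * ?r + (Z + e) * (?p + ?q * Z)) * (x - x0)"
      unfolding ZZe by (simp add: algebra_simps)
    finally have "(Z + e) * b = (poly q x0 * ?r + (Z + e) * (?p + ?q * Z)) * (x - x0)" .
    moreover have "poly q x0 * ?r + (Z + e) * (?p + ?q * Z) \<in> B" by (intro clB qB rB R ZeB pqB)
    ultimately show ?thesis using genideal_single[OF subring_B, of "x - x0"] x0(2) PB by blast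
  qed
  ultimately show ?thesis unfolding generates_locally_def using x0(2) ZeB by auto
qed

text \<open>Otherwise \<open>s * Z = b * (x - h x)\<close> with \<open>h s \<noteq> 0\<close>.
  Squaring and cancelling one factor \<open>x - h x\<close> of \<open>R\<close> gives
  \<open>s ^ 2 * poly ?R1 x = b ^ 2 * (x - h x)\<close>; applying \<open>h\<close> makes
  \<open>h x\<close> a double root of \<open>R\<close>.\<close>

lemma not_generates_locally_ramified:
  assumes h: "h \<in> Ring.ring_hom (on B) (on E)" and hK: "\<And>c. c \<in> K \<Longrightarrow> h c = c"
    and hx: "h x \<in> K" and hZ: "h Z = 0"
  shows "\<not> generates_locally B (a_kernel (on B) (on E) h) {x - h x}"
proof
  let ?P = "a_kernel (on B) (on E) h" and ?x = "h x"
  assume "generates_locally B ?P {x - ?x}"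
  moreover have "Z \<in> ?P" using Z_in_B hZ unfolding a_kernel_on by simp
  ultimately obtain s where s: "s \<in> B" "s \<notin> ?P" "s * Z \<in> genideal (on B) {x - ?x}"
    unfolding generates_locally_def by blast
  have hxB: "?x \<in> B" using hx K_subset_B by blast
  have "x - ?x \<in> B" by (rule subring_closed(5)[OF subring_B x_in_B hxB])
  then obtain b where b: "b \<in> B" "s * Z = b * (x - ?x)"
    using s(3) genideal_single[OF subring_B] by blast
  let ?R1 = "synthetic_div R ?x"
  have R1: "coeffs_in K ?R1" by (rule coeffs_in_synthetic_div[OF Kr hx R])
  have R0: "poly R ?x = 0" using hom_Z[OF h hK] hZ by simp
  have "s ^ 2 * Z ^ 2 = (s * Z) ^ 2" by (simp add: power_mult_distrib)
  also have "\<dots> = b ^ 2 * (x - ?x) ^ 2" unfolding b(2) by (simp add: power_mult_distrib)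
  finally have "(x - ?x) * (s ^ 2 * poly ?R1 x) = (x - ?x) * (b ^ 2 * (x - ?x))"
    using poly_split_at[of R x ?x] R0 unfolding Z by (simp add: algebra_simps power2_eq_square)
  moreover have "x - ?x \<noteq> 0" using transcendental_not_in[OF Kr x] hx by auto
  ultimately have e: "s ^ 2 * poly ?R1 x = b ^ 2 * (x - ?x)" by (metis mult_cancel_left)
  note clB = subring_closed[OF subring_B]
  have mult: "\<And>a c. a \<in> B \<Longrightarrow> c \<in> B \<Longrightarrow> h (a * c) = h a * h c"
    and add: "\<And>a c. a \<in> B \<Longrightarrow> c \<in> B \<Longrightarrow> h (a + c) = h a + h c" using h unfolding ring_hom_on_iff by blast+
  have "h (x + - ?x) = h x + h (- ?x)" by (intro add x_in_B clB hxB)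
  also have "h (- ?x) = - ?x" by (rule hK[OF subfield_closed(3)[OF K hx]])
  finally have hxx: "h (x - ?x) = 0" by simp
  have R1B: "poly ?R1 x \<in> B" using poly_ringI[OF R1] poly_ring_subset_B by blast
  have "h (s ^ 2 * poly ?R1 x) = h s ^ 2 * poly ?R1 ?x"
    using mult[OF clB(7)[OF s(1)] R1B, of 2] mult[OF s(1) s(1)]
      hom_poly[OF h subring_B K_subset_B hK x_in_B R1 subfield_closed(1)[OF K]]
    by (simp add: power2_eq_square)
  moreover have "h (b ^ 2 * (x - ?x)) = 0"
    using mult[OF clB(7)[OF b(1)] \<open>x - ?x \<in> B\<close>, of 2] hxx by simp
  moreover have "h s \<noteq> 0" using s(1,2) unfolding a_kernel_on by simp
  ultimately have "poly ?R1 ?x = 0" using e by simp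
  then have "[:- ?x, 1:] dvd ?R1" by (simp add: poly_eq_0_iff_dvd)
  then have "[:- ?x, 1:] * [:- ?x, 1:] dvd [:- ?x, 1:] * ?R1" by (rule mult_dvd_mono[OF dvd_refl])
  also have "[:- ?x, 1:] * ?R1 = R" using synthetic_div_correct'[of ?x R] R0 by simp
  finally show False using sqfree[of ?x] by (simp add: power2_eq_square)
qed

end

section \<open>The field of rational functions in two variables\<close>

definition U_fun :: "complex poly fract \<Rightarrow> ambient" where
  "U_fun f = to_ac (to_fract [:f:])"

definition U_poly :: "complex poly \<Rightarrow> ambient" where
  "U_poly p = U_fun (to_fract p)"

lemma U_fun_simps [simp]:
  "U_fun 0 = 0" "U_fun 1 = 1" "U_fun (f + g) = U_fun f + U_fun g" "U_fun (f * g) = U_fun f * U_fun g"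
  "U_fun (- f) = - U_fun f" "U_fun f = U_fun g \<longleftrightarrow> f = g"
proof -
  have h: "[:f + g:] = [:f:] + [:g:]" "[:f * g:] = [:f:] * [:g:]" "[:- f:] = - [:f:]" by simp_all
  show "U_fun (f + g) = U_fun f + U_fun g" "U_fun (f * g) = U_fun f * U_fun g" "U_fun (- f) = - U_fun f"
    unfolding U_fun_def h
    by (simp_all only: to_fract_add to_fract_mult to_fract_uminus to_ac_add to_ac_mult to_ac_minus)
qed (simp_all add: U_fun_def one_pCons[symmetric])

lemma U_fun_inverse: "U_fun (inverse f) = inverse (U_fun f)"
proof (cases "f = 0")
  case False
  then have "U_fun f * U_fun (inverse f) = 1" unfolding U_fun_simps(4)[symmetric] by simp
  then show ?thesis by (metis inverse_unique)
qed simp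

lemma U_poly_simps [simp]:
  "U_poly 0 = 0" "U_poly 1 = 1" "U_poly (p + r) = U_poly p + U_poly r" "U_poly (p * r) = U_poly p * U_poly r"
  "U_poly (- p) = - U_poly p" "U_poly p = U_poly r \<longleftrightarrow> p = r"
  by (simp_all add: U_poly_def)

lemma U_poly_diff [simp]: "U_poly (p - r) = U_poly p - U_poly r"
  using U_poly_simps(3)[of p "- r"] by simp

lemma U_poly_power [simp]: "U_poly (p ^ n) = U_poly p ^ n"
  by (induction n) simp_all

lemma U_poly_eq_0 [simp]: "U_poly p = 0 \<longleftrightarrow> p = 0"
  using U_poly_simps(6)[of p 0] by simp

lemma U_poly_const: "U_poly [:c:] = const c" and U_poly_var: "U_poly [:0, 1:] = U_var"
  by (simp_all add: U_poly_def U_fun_def const_def U_var_def)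

lemma const_simps [simp]:
  "const 0 = 0" "const 1 = 1" "const (a + b) = const a + const b" "const (a * b) = const a * const b"
  "const (- a) = - const a" "const (a - b) = const a - const b" "const a = const b \<longleftrightarrow> a = b"
  "const a = 0 \<longleftrightarrow> a = 0"
proof -
  have h: "[:a + b:] = [:a:] + [:b:]" "[:a * b:] = [:a:] * [:b:]" "[:- a:] = - [:a:]" "[:a - b:] =
    [:a:] - [:b:]" by simp_all
  show "const (a + b) = const a + const b" "const (a * b) = const a * const b" "const (- a) = -
    const a" "const (a - b) = const a - const b"
    unfolding U_poly_const[symmetric] h by (simp_all only: U_poly_simps U_poly_diff)
  show "const a = const b \<longleftrightarrow> a = b" unfolding U_poly_const[symmetric] by simp
qed (simp_all add: U_poly_const[symmetric] one_pCons[symmetric])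

lemma const_power [simp]: "const (a ^ n) = const a ^ n"
  by (induction n) simp_all

lemma const_inverse [simp]: "const (inverse a) = inverse (const a)"
proof (cases "a = 0")
  case False
  then have "const a * const (inverse a) = 1" unfolding const_simps(4)[symmetric] by simp
  then show ?thesis by (metis inverse_unique)
qed simp

lemma const_of_nat [simp]: "const (of_nat n) = of_nat n"
  by (induction n) simp_all

lemma const_of_int [simp]: "const (of_int n) = of_int n"
  by (cases n) (simp_all del: of_nat_Suc)

lemma two_ambient: "(2 :: ambient) \<noteq> 0"
  using const_of_nat[of 2] const_simps(8)[of 2] by simp

lemma subfield_const_image: "subfield k univ_ring \<Longrightarrow> subfield (const ` k) univ_ring"
proof (rule subfieldI_univ)
  assume k: "subfield k univ_ring"
  note cl = subfield_closed[OF k]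
  show "1 \<in> const ` k" using cl(2) by (metis const_simps(2) imageI)
  show "- x \<in> const ` k" if "x \<in> const ` k" for x using that cl(3) by (auto simp flip: const_simps)
  show "inverse x \<in> const ` k" if "x \<in> const ` k" for x using that cl(10) by (auto simp flip: const_inverse)
  show "x + y \<in> const ` k" "x * y \<in> const ` k" if "x \<in> const ` k" "y \<in> const ` k" for x y
    using that cl(4,6) by (auto simp flip: const_simps)
qed

lemma subfield_Cx: "subfield Cx univ_ring"
  by (rule subfield_const_image) (rule subfieldI_univ; simp)

lemma coeff_map_const [simp]: "coeff (map_poly const p) i = const (coeff p i)"
  by (simp add: coeff_map_poly)

lemma coeffs_in_const_image:
  assumes "coeffs_in (const ` k) p" "0 \<in> k"
  obtains p' where "coeffs_in k p'" "p = map_poly const p'"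
proof -
  define g where "g = inv_into k const"
  have inj: "inj_on const k" by (auto simp: inj_on_def)
  have g: "g (const c) = c" if "c \<in> k" for c using inv_into_f_f[OF inj that] unfolding g_def .
  have g0: "g 0 = 0" using g[OF assms(2)] by simp
  have c: "const (g (coeff p i)) = coeff p i" "g (coeff p i) \<in> k" for i
    using assms(1) g unfolding coeffs_in_def by (metis imageE)+
  have "p = map_poly const (map_poly g p)" by (rule poly_eqI) (simp add: coeff_map_poly[of g, OF g0] c)
  moreover have "coeffs_in k (map_poly g p)" unfolding coeffs_in_def coeff_map_poly[of g, OF g0]
    using c by blast
  ultimately show ?thesis using that by blast
qed

lemma map_poly_const_simps [simp]:
  "map_poly const (p + r) = map_poly const p + map_poly const r"
  "map_poly const (p * r) = map_poly const p * map_poly const r"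
  "map_poly const (pCons c p) = pCons (const c) (map_poly const p)"
  "map_poly const (smult c p) = smult (const c) (map_poly const p)"
proof -
  have sum: "const (sum f I) = (\<Sum>i\<in>I. const (f i))" for f and I :: "nat set"
    by (induction I rule: infinite_finite_induct) auto
  show "map_poly const (p + r) = map_poly const p + map_poly const r"
    "map_poly const (smult c p) = smult (const c) (map_poly const p)"
    by (rule poly_eqI; simp)+
  show "map_poly const (p * r) = map_poly const p * map_poly const r"
    by (rule poly_eqI) (simp add: coeff_mult sum)
  show "map_poly const (pCons c p) = pCons (const c) (map_poly const p)"
    by (rule poly_eqI) (simp add: coeff_pCons split: nat.split)
qed

lemma poly_map_const [simp]: "poly (map_poly const p) (const c) = const (poly p c)"
  by (induction p) simp_all

lemma poly_const_U: "poly (map_poly const p) U_var = U_poly p"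
proof (induction p)
  case (pCons c p)
  have "pCons c p = [:c:] + [:0, 1:] * p" by simp
  then have "U_poly (pCons c p) = const c + U_var * U_poly p"
    by (simp only: U_poly_simps U_poly_const U_poly_var)
  then show ?case using pCons.IH by simp
qed simp

lemma transcendental_U: "transcendental_over Cx U_var"
  unfolding transcendental_over_def
proof (intro allI impI)
  fix p assume p: "coeffs_in Cx p" "poly p U_var = 0"
  obtain p' where "coeffs_in UNIV p'" "p = map_poly const p'" using p(1) by (rule coeffs_in_const_image) simp
  then show "p = 0" using p(2) by (simp add: poly_const_U)
qed

abbreviation "CU \<equiv> adjoin Cx {U_var}"

lemma CU_subset_U_fun: "CU \<subseteq> range U_fun"
proof (rule adjoin_least)
  show "subfield (range U_fun) univ_ring"
  proof (rule subfieldI_univ)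
    show "1 \<in> range U_fun" by (metis U_fun_simps(2) rangeI)
  qed (auto simp flip: U_fun_simps U_fun_inverse)
  show "Cx \<subseteq> range U_fun" "{U_var} \<subseteq> range U_fun"
    unfolding U_poly_const[symmetric] U_poly_var[symmetric] U_poly_def by auto
qed

text \<open>A polynomial over \<open>CU\<close>, evaluated at \<open>T_var\<close>, is the image of
  a polynomial over the fractions in \<open>U\<close> under the injective maps
  \<open>to_fract\<close> and \<open>to_ac\<close>.\<close>

lemma transcendental_T: "transcendental_over CU T_var"
  unfolding transcendental_over_def
proof (intro allI impI)
  fix p assume "coeffs_in CU p" and p0: "poly p T_var = 0"
  then have p: "coeffs_in (range U_fun) p" using coeffs_in_mono CU_subset_U_fun by blast
  define g where "g = inv_into UNIV U_fun"
  have g: "g (U_fun c) = c" for c using inv_into_f_f[of U_fun UNIV c] unfolding g_def by (auto simp: inj_on_def)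
  have g0: "g 0 = 0" using g[of 0] by simp
  have c: "U_fun (g (coeff p i)) = coeff p i" for i using p g unfolding coeffs_in_def by (metis imageE)
  have ev: "poly (map_poly U_fun r) T_var = to_ac (to_fract r)" for r
  proof (induction r)
    case (pCons c r)
    have "pCons c r = [:c:] + [:0, 1:] * r" by simp
    then have "to_ac (to_fract (pCons c r)) = U_fun c + T_var * to_ac (to_fract r)"
      by (simp only: to_fract_add to_fract_mult to_ac_add to_ac_mult U_fun_def T_var_def)
    moreover have "map_poly U_fun (pCons c r) = pCons (U_fun c) (map_poly U_fun r)"
      by (rule poly_eqI) (simp add: coeff_map_poly coeff_pCons split: nat.split)
    ultimately show ?case using pCons.IH by simp
  qed simp
  have "p = map_poly U_fun (map_poly g p)" by (rule poly_eqI) (simp add: coeff_map_poly g0 c)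
  moreover from this have "to_ac (to_fract (map_poly g p)) = 0" using ev[of "map_poly g p"] p0 by simp
  ultimately show "p = 0" by simp
qed

text \<open>As \<complex> is algebraically closed, \<open>p\<close> splits into linear factors over
  the constants. This puts the algebraic closure of \<open>k\<close> inside
  \<open>Cx\<close>.\<close>

lemma algebraic_over_Cx:
  assumes "coeffs_in Cx p" "p \<noteq> 0" "poly p y = 0" shows "y \<in> Cx"
proof -
  obtain p' where p': "coeffs_in UNIV p'" "p = map_poly const p'" using assms(1)
    by (rule coeffs_in_const_image) simp
  have "p' \<noteq> 0 \<Longrightarrow> poly (map_poly const p') y = 0 \<Longrightarrow> y \<in> Cx"
  proof (induction "degree p'" arbitrary: p')
    case 0
    then obtain c where "p' = [:c:]" by (metis degree_eq_zeroE)
    then show ?case using 0 by (simp add: map_poly_pCons)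
  next
    case (Suc n)
    obtain c where "poly p' c = 0" using alg_closed_imp_poly_has_root[of p'] Suc.hyps(2) by auto
    then obtain s where s: "p' = [:- c, 1:] * s" by (metis dvdE poly_eq_0_iff_dvd)
    have s0: "s \<noteq> 0" using Suc.prems(1) s by auto
    have "degree p' = degree [:- c, 1:] + degree s" unfolding s using s0 by (intro degree_mult_eq) auto
    then have ds: "n = degree s" using Suc.hyps(2) by simp
    have "poly (map_poly const p') y = (y - const c) * poly (map_poly const s) y"
      unfolding s map_poly_const_simps(2) poly_mult by (simp add: algebra_simps)
    then have "y = const c \<or> poly (map_poly const s) y = 0" using Suc.prems(2) by auto
    then show ?case using Suc.hyps(1)[OF ds s0] by blast
  qed
  then show ?thesis using assms(2,3) unfolding p'(2) by auto
qed

text \<open>Division by the leading coefficient makes an equation monic, so that closure under sums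
  and products is inherited from integral elements.\<close>

lemma alg_closure_in_eq: 
  assumes "subfield K (univ_ring :: 'a::field ring)"
  shows "alg_closure_in K = integral_closure K UNIV"
proof (intro equalityI subsetI)
  fix y assume "y \<in> alg_closure_in K"
  then obtain p where p: "p \<noteq> 0" "coeffs_in K p" "poly p y = 0" unfolding alg_closure_in_def by blast
  let ?p = "smult (inverse (lead_coeff p)) p"
  have "lead_coeff p \<in> K" using p(2) unfolding coeffs_in_def by simp
  then have "inverse (lead_coeff p) \<in> K" by (rule subfield_closed(10)[OF assms])
  then have "coeffs_in K ?p" by (rule coeffs_in_closed(8)[OF subfield_subring[OF assms] _ p(2)])
  moreover have "lead_coeff ?p = 1" "poly ?p y = 0" using p by simp_all
  ultimately show "y \<in> integral_closure K UNIV" unfolding integral_closure_def by blast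
next
  fix y assume "y \<in> integral_closure K UNIV"
  then obtain p where p: "lead_coeff p = 1" "coeffs_in K p" "poly p y = 0"
    unfolding integral_closure_def by blast
  then have "p \<noteq> 0" by (intro notI) simp
  then show "y \<in> alg_closure_in K" using p unfolding alg_closure_in_def by blast
qed

lemma subfield_alg_closure_in:
  assumes K: "subfield K (univ_ring :: 'a::field ring)" shows "subfield (alg_closure_in K) univ_ring"
  unfolding subfield_univ_iff
proof (intro conjI ballI)
  show "subring (alg_closure_in K) univ_ring"
    unfolding alg_closure_in_eq[OF K]
    by (rule subring_integral_closure[OF subfield_subring[OF K]]) (auto simp: subring_univ_iff)
  fix y assume "y \<in> alg_closure_in K"
  then obtain p where p: "p \<noteq> 0" "coeffs_in K p" "poly p y = 0" unfolding alg_closure_in_def by blast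
  show "inverse y \<in> alg_closure_in K"
  proof (cases "y = 0")
    case True
    then show ?thesis using \<open>y \<in> alg_closure_in K\<close> by simp
  next
    case False
    have "coeffs_in K (reflect_poly p)"
      using p(2) subfield_closed(1)[OF K] unfolding coeffs_in_def coeff_reflect_poly by simp
    moreover have "poly (reflect_poly p) (inverse y) = 0" using False p(3) by (simp add: poly_reflect_poly_nz)
    ultimately show ?thesis using p(1) unfolding alg_closure_in_def
      by (metis (mono_tags, lifting) mem_Collect_eq reflect_poly_eq_0_iff)
  qed
qed

lemma subset_alg_closure_in:
  assumes "subfield K (univ_ring :: 'a::field ring)" shows "K \<subseteq> alg_closure_in K"
  unfolding alg_closure_in_eq[OF assms] by (rule subset_integral_closure[OF subfield_subring[OF assms]]) simp

text \<open>Clear the denominator and compare coefficients, which is possible because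
  \<open>U_var\<close> is transcendental over all of \<open>Cx\<close>, where \<open>const c\<close>
  lies.\<close>

lemma const_in_adjoin_U:
  assumes k: "subfield k univ_ring" and c: "const c \<in> adjoin (const ` k) {U_var}"
  shows "c \<in> k"
proof -
  note k0 = subfield_const_image[OF k]
  have sub: "const ` k \<subseteq> Cx" by blast
  obtain p r where pr: "coeffs_in (const ` k) p" "coeffs_in (const ` k) r" "r \<noteq> 0" "const c = poly p
    U_var / poly r U_var"
    using c unfolding adjoin_rational_functions[OF k0 transcendental_over_mono[OF transcendental_U
      sub]] by blast
  have "poly r U_var \<noteq> 0" using transcendental_overD[OF transcendental_U coeffs_in_mono[OF pr(2)
    sub]] pr(3) by blast
  then have e: "poly (smult (const c) r) U_var = poly p U_var" using pr(4) by (simp add: field_simps)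
  have "coeffs_in Cx (smult (const c) r)"
    by (rule coeffs_in_closed(8)[OF subfield_subring[OF subfield_Cx] _ coeffs_in_mono[OF pr(2) sub]]) simp
  then have "smult (const c) r = p"
    by (rule transcendental_over_eqD[OF subfield_subring[OF subfield_Cx] transcendental_U _
      coeffs_in_mono[OF pr(1) sub] e])
  then have "const c * lead_coeff r = coeff p (degree r)" by auto
  then have "const c = coeff p (degree r) / lead_coeff r" using pr(3) by (simp add: field_simps)
  moreover have "coeff p (degree r) \<in> const ` k" "lead_coeff r \<in> const ` k" using pr(1,2)
    unfolding coeffs_in_def by auto
  ultimately have "const c \<in> const ` k" using subfield_closed(11)[OF k0] by metis
  then show ?thesis by auto
qed

section \<open>Twisted cubic curves over a function field\<close>

definition cubic :: "complex \<Rightarrow> complex \<Rightarrow> complex \<Rightarrow> complex \<Rightarrow> complex poly" where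
  "cubic a \<alpha> \<beta> \<gamma> = smult a ([:- \<alpha>, 1:] * [:- \<beta>, 1:] * [:- \<gamma>, 1:])"

lemma poly_cubic_roots: "poly (cubic a \<alpha> \<beta> \<gamma>) x = a * ((x - \<alpha>) * (x - \<beta>) * (x - \<gamma>))"
  unfolding cubic_def by (simp only: poly_smult poly_mult) simp

text \<open>The discriminant is the squared product of the root differences, and its vanishing would
  give a root in \<open>k\<close>. The roots are nonzero because 0 lies in \<open>k\<close>; this
  keeps the factors \<open>1 - \<alpha> x\<close> linear in the chart at infinity.\<close>

lemma irreducible_cubic_roots:
  fixes Q :: "complex poly"
  assumes k: "subfield k univ_ring" and irr: "irreducible_over k Q" and deg: "degree Q = 3"
  obtains a \<alpha> \<beta> \<gamma> where "Q = cubic a \<alpha> \<beta> \<gamma>" "a \<noteq> 0" "\<alpha> \<noteq> \<beta>" "\<beta> \<noteq> \<gamma>" "\<alpha> \<noteq> \<gamma>" "\<alpha> \<noteq> 0" "\<beta> \<noteq> 0" "\<gamma> \<noteq> 0"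
proof -
  note cl = subfield_closed[OF k]
  have no_root: "poly Q x \<noteq> 0" if "x \<in> k" for x
    using irreducible_over_no_root[OF k irr _ that] deg by simp
  have ex: "\<exists>c s. p = [:- c, 1:] * s \<and> degree p = Suc (degree s)" if p: "degree p > 0" for p :: "complex poly"
  proof -
    obtain c where "poly p c = 0" using alg_closed_imp_poly_has_root[OF p] by blast
    then obtain s where s: "p = [:- c, 1:] * s" by (metis dvdE poly_eq_0_iff_dvd)
    have "s \<noteq> 0" using s p by auto
    then have "degree p = degree [:- c, 1:] + degree s" unfolding s by (intro degree_mult_eq) auto
    then show ?thesis using s by auto
  qed
  obtain \<alpha> s1 where 1: "Q = [:- \<alpha>, 1:] * s1" "degree s1 = 2" using ex[of Q] deg by auto
  obtain \<beta> s2 where 2: "s1 = [:- \<beta>, 1:] * s2" "degree s2 = 1" using ex[of s1] 1 by auto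
  obtain \<gamma> s3 where 3: "s2 = [:- \<gamma>, 1:] * s3" "degree s3 = 0" using ex[of s2] 2 by auto
  obtain a where a: "s3 = [:a:]" using 3(2) by (rule degree_eq_zeroE)
  have Q: "Q = cubic a \<alpha> \<beta> \<gamma>"
    unfolding cubic_def 1(1) 2(1) 3(1) a by (simp only: mult.assoc mult.commute[of _ "[:a:]"]
      mult.left_commute[of _ "[:a:]"]) simp
  have a0: "a \<noteq> 0" using deg unfolding Q cubic_def by auto
  have Qk: "coeff Q i \<in> k" for i using irr unfolding irreducible_over_def coeffs_in_def by blast
  let ?p = "- (\<alpha> + \<beta> + \<gamma>)" and ?q = "\<alpha> * \<beta> + \<beta> * \<gamma> + \<alpha> * \<gamma>" and ?r = "- (\<alpha> * \<beta> * \<gamma>)"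
  have c: "coeff Q 3 = a" "coeff Q 2 = a * ?p" "coeff Q 1 = a * ?q" "coeff Q 0 = a * ?r"
    unfolding Q cubic_def by (simp_all add: algebra_simps eval_nat_numeral)
  have "?p = coeff Q 2 / coeff Q 3" "?q = coeff Q 1 / coeff Q 3" "?r = coeff Q 0 / coeff Q 3"
    unfolding c using a0 by simp_all
  then have pqr: "?p \<in> k" "?q \<in> k" "?r \<in> k" using cl(11)[OF Qk Qk] by metis+
  have f: "x ^ 3 + ?p * x ^ 2 + ?q * x + ?r = (x - \<alpha>) * (x - \<beta>) * (x - \<gamma>)" for x
    by (simp add: algebra_simps eval_nat_numeral)
  have "?p ^ 2 * ?q ^ 2 - 4 * ?q ^ 3 - 4 * ?p ^ 3 * ?r + 18 * ?p * ?q * ?r - 27 * ?r ^ 2 =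
      ((\<alpha> - \<beta>) * (\<beta> - \<gamma>) * (\<alpha> - \<gamma>)) ^ 2"
    by (simp add: algebra_simps eval_nat_numeral)
  then have "(\<alpha> - \<beta>) * (\<beta> - \<gamma>) * (\<alpha> - \<gamma>) \<noteq> 0"
    using cubic_root_if_discriminant_0[OF k pqr] no_root unfolding f Q poly_cubic_roots by force
  moreover have "\<alpha> \<noteq> 0 \<and> \<beta> \<noteq> 0 \<and> \<gamma> \<noteq> 0"
    using no_root[OF cl(1)] unfolding Q poly_cubic_roots by auto
  ultimately show ?thesis using that[OF Q a0] by auto
qed

lemma CU_fraction:
  assumes "t \<in> CU"
  obtains A B where "t = U_poly A / U_poly B" "B \<noteq> 0" "coprime A B"
proof -
  obtain p r where pr: "coeffs_in Cx p" "coeffs_in Cx r" "r \<noteq> 0" "t = poly p U_var / poly r U_var"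
    using assms unfolding adjoin_rational_functions[OF subfield_Cx transcendental_U] by blast
  obtain A where A: "coeffs_in UNIV A" "p = map_poly const A" using pr(1) by (rule coeffs_in_const_image) simp
  obtain B where B: "coeffs_in UNIV B" "r = map_poly const B" using pr(2) by (rule coeffs_in_const_image) simp
  have B0: "B \<noteq> 0" using pr(3) B(2) by auto
  then have g0: "gcd A B \<noteq> 0" by simp
  obtain A' B' where AB: "A = A' * gcd A B" "B = B' * gcd A B" "coprime A' B'"
    using gcd_coprime_exists[OF g0] by blast
  have "t = U_poly A / U_poly B" using pr(4) unfolding A(2) B(2) poly_const_U .
  also have "\<dots> = (U_poly A' * U_poly (gcd A B)) / (U_poly B' * U_poly (gcd A B))"
    unfolding U_poly_simps(4)[symmetric] AB(1,2)[symmetric] ..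
  also have "\<dots> = U_poly A' / U_poly B'" using g0 by simp
  finally show ?thesis using AB B0 that by (metis mult_zero_left)
qed

lemma no_twist_points_CU:
  assumes a: "a \<noteq> 0" and dist: "\<alpha> \<noteq> \<beta>" "\<beta> \<noteq> \<gamma>" "\<alpha> \<noteq> \<gamma>"
    and t: "t \<in> CU" and y: "y \<in> CU" and eq: "y ^ 2 = U_var * poly (map_poly const (cubic a \<alpha> \<beta> \<gamma>)) t"
  shows "y = 0"
proof -
  obtain A B where AB: "t = U_poly A / U_poly B" "B \<noteq> 0" "coprime A B" using CU_fraction[OF t] .
  obtain C D where CD: "y = U_poly C / U_poly D" "D \<noteq> 0" "coprime C D" using CU_fraction[OF y] .
  have ev: "poly (map_poly const (cubic a \<alpha> \<beta> \<gamma>)) t = const a * ((t - const \<alpha>) * (t - const \<beta>) * (t - const \<gamma>))"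
    unfolding cubic_def map_poly_const_simps(2,4) poly_smult poly_mult by (simp add: map_poly_pCons)
  have l: "U_poly B * (t - const c) = U_poly (A - smult c B)" for c
  proof -
    have "smult c B = [:c:] * B" by simp
    then have "U_poly (smult c B) = const c * U_poly B" unfolding U_poly_const[symmetric]
      by (simp only: U_poly_simps)
    then show ?thesis using AB by (simp add: right_diff_distrib)
  qed
  \<comment> \<open>Multiplying by the fourth power of the denominator \<open>B\<close> of
    \<open>t\<close>, rather than by the cube, keeps the left side of the equation a square. The
    additional factor \<open>B\<close> accounts for the branch point at infinity.\<close>
  let ?F = "smult a (B * (A - smult \<alpha> B) * (A - smult \<beta> B) * (A - smult \<gamma> B))"
  have aF: "?F = [:a:] * (B * (A - smult \<alpha> B) * (A - smult \<beta> B) * (A - smult \<gamma> B))" by simp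
  have F: "U_poly ?F = U_poly B ^ 4 * poly (map_poly const (cubic a \<alpha> \<beta> \<gamma>)) t"
    unfolding aF U_poly_simps U_poly_const ev l[symmetric] by (simp add: eval_nat_numeral algebra_simps)
  have "U_poly ((C * B ^ 2) ^ 2) = U_poly D ^ 2 * (U_poly B ^ 4 * y ^ 2)"
    unfolding CD(1) using CD(2) by (simp add: power_mult_distrib power_divide power_mult[symmetric])
  also have "\<dots> = U_poly (D ^ 2 * ([:0, 1:] * ?F))"
    unfolding U_poly_simps U_poly_power F U_poly_var eq by (simp only: ac_simps)
  finally have e: "(C * B ^ 2) ^ 2 = D ^ 2 * ([:0, 1:] * ?F)" unfolding U_poly_simps(6) .
  then have "D ^ 2 dvd (C * B ^ 2) ^ 2" by (metis dvd_triv_left)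
  then have "D dvd C * B ^ 2" by simp
  then obtain w where w: "C * B ^ 2 = D * w" by (rule dvdE)
  have "D ^ 2 * w ^ 2 = D ^ 2 * ([:0, 1:] * ?F)" using e unfolding w by (simp only: power_mult_distrib)
  then have "w ^ 2 = [:0, 1:] * ?F" using CD(2) by (metis mult_cancel_left power_not_zero)
  from no_nonconstant_twist_point[OF AB(3,2) a dist this] have "C * B ^ 2 = 0" unfolding w by simp
  then show ?thesis using AB(2) CD(1) by simp
qed

lemma no_square_factor:
  fixes R :: "'a::field poly"
  assumes "\<And>c. poly R c = 0 \<Longrightarrow> poly (pderiv R) c \<noteq> 0"
  shows "\<not> [:- c, 1:] ^ 2 dvd R"
proof
  assume "[:- c, 1:] ^ 2 dvd R"
  then obtain S where "R = [:- c, 1:] ^ 2 * S" by (rule dvdE)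
  then have R: "R = [:- c, 1:] * ([:- c, 1:] * S)" unfolding power2_eq_square mult.assoc .
  have "poly R c = 0" unfolding R poly_mult by simp
  moreover have "poly (pderiv R) c = 0" unfolding R pderiv_mult poly_add poly_mult by simp
  ultimately show False using assms by blast
qed

lemma compositum_quad_ext:
  assumes L: "subfield L (univ_ring :: 'a::field ring)" and L': "subfield L' univ_ring" and z: "z ^ 2 \<in> L"
    and sub: "L \<subseteq> L'" "S \<subseteq> L'" "L' \<subseteq> adjoin L S"
  shows "adjoin (quad_ext L z) S = quad_ext L' z"
proof (rule adjoin_eqI)
  have z': "z ^ 2 \<in> L'" using z sub by blast
  show "subfield (quad_ext L' z) univ_ring" by (rule subfield_quad_ext[OF L' z'])
  have bs: "L' \<subseteq> quad_ext L' z" by (rule base_subset_quad_ext[OF L' z'])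
  show "quad_ext L z \<subseteq> quad_ext L' z" using sub(1) unfolding quad_ext_def by blast
  show "S \<subseteq> quad_ext L' z" using sub(2) bs by blast
  have "adjoin L S \<subseteq> adjoin (quad_ext L z) S"
    using adjoin_superset[of "quad_ext L z" S] base_subset_quad_ext[OF L z]
    by (intro adjoin_least adjoin_subfield) auto
  then show "quad_ext L' z \<subseteq> adjoin (quad_ext L z) S"
    using sub(3) root_in_quad_ext[OF L z] adjoin_superset[of "quad_ext L z" S]
    by (intro quad_ext_least[OF L' z'] subfield_subring[OF adjoin_subfield]) auto
qed

text \<open>\<open>u = 1\<close> gives the extension \<open>F\<close> and \<open>u = U_var\<close>
  the cover \<open>N\<close>, each with its constants extended to \<open>K\<close>.\<close>

locale cubic_twist =
  fixes K :: "ambient set" and u Z :: ambient and a \<alpha> \<beta> \<gamma> :: complex and q :: "ambient poly"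
  assumes K: "subfield K univ_ring" and T: "transcendental_over K T_var"
    and q_def: "q = map_poly const (cubic a \<alpha> \<beta> \<gamma>)"
    and q: "coeffs_in K q" and u: "u \<in> K" "u \<noteq> 0" and a: "a \<noteq> 0"
    and dist: "\<alpha> \<noteq> \<beta>" "\<beta> \<noteq> \<gamma>" "\<alpha> \<noteq> \<gamma>" and nz: "\<alpha> \<noteq> 0" "\<beta> \<noteq> 0" "\<gamma> \<noteq> 0"
    and Z: "Z ^ 2 = u * poly q T_var"
begin

text \<open>This is \<open>x ^ 4\<close> times the value of \<open>q\<close> at
  \<open>1 / x\<close>. The exponent 3 is rounded up to the even number 4 so that
  \<open>Z / T_var ^ 2\<close> is a square root of \<open>u * q_inf\<close> at
  \<open>1 / T_var\<close>; the factor \<open>x\<close> thus gained makes infinity a branch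
  point.\<close>

definition q_inf :: "ambient poly" where
  "q_inf = smult (const a) ([:0, 1:] * [:1, - const \<alpha>:] * [:1, - const \<beta>:] * [:1, - const \<gamma>:])"

lemma q_eq: "q = smult (const a) ([:- const \<alpha>, 1:] * [:- const \<beta>, 1:] * [:- const \<gamma>, 1:])"
  unfolding q_def cubic_def map_poly_const_simps(2,4) by (simp add: map_poly_pCons)

lemma poly_q: "poly q x = const a * ((x - const \<alpha>) * (x - const \<beta>) * (x - const \<gamma>))"
  unfolding q_eq by (simp only: poly_smult poly_mult) simp

lemma poly_q_inf: "poly q_inf x = const a * (x * (1 - const \<alpha> * x) * (1 - const \<beta> * x) * (1 - const \<gamma> * x))"
  unfolding q_inf_def by (simp only: poly_smult poly_mult) (simp add: mult.commute)

lemma poly_q_inf_inverse: "x \<noteq> 0 \<Longrightarrow> poly q_inf x = x ^ 4 * poly q (inverse x)"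
  unfolding poly_q poly_q_inf by (simp add: field_simps eval_nat_numeral)

lemma degree_q: "degree q = 3"
  unfolding q_eq using a by (simp add: degree_mult_eq)

lemma coeffs_q_inf: "coeffs_in K q_inf"
proof -
  have r: "reflect_poly [:- const c, 1:] = [:1, - const c:]" for c
    by (simp add: reflect_poly_def)
  have "q_inf = [:0, 1:] * reflect_poly q"
    unfolding q_eq reflect_poly_smult reflect_poly_mult r q_inf_def by (simp only: mult_smult_right mult.assoc)
  moreover have "coeffs_in K (reflect_poly q)"
    using q subfield_closed(1)[OF K] unfolding coeffs_in_def coeff_reflect_poly by simp
  moreover have "coeffs_in K [:0, 1:]" using subfield_closed(1,2)[OF K] by simp
  ultimately show ?thesis using coeffs_in_closed(6)[OF subfield_subring[OF K]] by simp
qed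

lemma T_nonzero: "T_var \<noteq> 0"
  using transcendental_not_in[OF subfield_subring[OF K] T] subfield_closed(1)[OF K] by metis

lemma sqfree: "\<not> [:- c, 1:] ^ 2 dvd smult u q"
proof (rule no_square_factor)
  fix c assume "poly (smult u q) c = 0"
  then have "c = const \<alpha> \<or> c = const \<beta> \<or> c = const \<gamma>" using u a by (auto simp: poly_q)
  moreover have "poly (pderiv (smult u q)) c = u * (const a * ((c - const \<beta>) * (c - const \<gamma>) +
      (c - const \<alpha>) * (c - const \<gamma>) + (c - const \<alpha>) * (c - const \<beta>)))"
    unfolding q_eq by (simp only: pderiv_smult pderiv_mult poly_smult poly_mult poly_add
      pderiv_pCons) (simp add: algebra_simps)
  ultimately show "poly (pderiv (smult u q)) c \<noteq> 0" using u a dist by auto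
qed

lemma sqfree_inf: "\<not> [:- c, 1:] ^ 2 dvd smult u q_inf"
proof (rule no_square_factor)
  fix c assume r: "poly (smult u q_inf) c = 0"
  let ?l = "\<lambda>e. 1 - const e * c"
  have d: "poly (pderiv (smult u q_inf)) c = u * (const a * (?l \<alpha> * ?l \<beta> * ?l \<gamma> - const \<alpha> * c * ?l \<beta> * ?l \<gamma>
      - const \<beta> * c * ?l \<alpha> * ?l \<gamma> - const \<gamma> * c * ?l \<alpha> * ?l \<beta>))"
    unfolding q_inf_def by (simp only: pderiv_smult pderiv_mult poly_smult poly_mult poly_add
      pderiv_pCons) (simp add: algebra_simps)
  have l: "?l e \<noteq> 0" if "?l f = 0" "e \<noteq> f" for e f
  proof
    assume "?l e = 0"
    with that(1) have "const e * c = const f * c" "c \<noteq> 0" by auto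
    then show False using that(2) by simp
  qed
  have "c = 0 \<or> ?l \<alpha> = 0 \<or> ?l \<beta> = 0 \<or> ?l \<gamma> = 0" using r u a by (auto simp: poly_q_inf)
  then show "poly (pderiv (smult u q_inf)) c \<noteq> 0"
  proof (elim disjE)
    assume "c = 0"
    then show ?thesis using u a unfolding d by simp
  next
    assume e: "?l \<alpha> = 0"
    then have "const \<alpha> * c = 1" by simp
    then show ?thesis using l[OF e, of \<beta>] l[OF e, of \<gamma>] dist u a unfolding d by auto
  next
    assume e: "?l \<beta> = 0"
    then have "const \<beta> * c = 1" by simp
    then show ?thesis using l[OF e, of \<alpha>] l[OF e, of \<gamma>] dist u a unfolding d by auto
  next
    assume e: "?l \<gamma> = 0"
    then have "const \<gamma> * c = 1" by simp
    then show ?thesis using l[OF e, of \<alpha>] l[OF e, of \<beta>] dist u a unfolding d by auto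
  qed
qed

lemma transcendental_inverse_T: "transcendental_over K (inverse T_var)"
  unfolding transcendental_over_def
proof (intro allI impI)
  fix p assume p: "coeffs_in K p" "poly p (inverse T_var) = 0"
  have "coeffs_in K (reflect_poly p)"
    using p(1) subfield_closed(1)[OF K] unfolding coeffs_in_def coeff_reflect_poly by simp
  moreover have "poly (reflect_poly p) T_var = 0" using T_nonzero p(2) by (simp add: poly_reflect_poly_nz)
  ultimately have "reflect_poly p = 0" by (rule transcendental_overD[OF T])
  then show "p = 0" by simp
qed

sublocale aff: quadratic_function_field K T_var Z "smult u q"
proof (rule quadratic_function_field.intro)
  show "coeffs_in K (smult u q)" by (rule coeffs_in_closed(8)[OF subfield_subring[OF K] u(1) q])
  show "0 < degree (smult u q)" using u degree_q by simp
  show "Z ^ 2 = poly (smult u q) T_var" using Z by simp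
qed (rule K T sqfree two_ambient)+

sublocale inf: quadratic_function_field K "inverse T_var" "Z / T_var ^ 2" "smult u q_inf"
proof (rule quadratic_function_field.intro)
  show "coeffs_in K (smult u q_inf)" by (rule coeffs_in_closed(8)[OF subfield_subring[OF K] u(1) coeffs_q_inf])
  show "0 < degree (smult u q_inf)"
    using u a nz unfolding q_inf_def by (simp add: degree_mult_eq del: mult_pCons_left)
  show "(Z / T_var ^ 2) ^ 2 = poly (smult u q_inf) (inverse T_var)"
    using T_nonzero by (simp add: poly_q_inf_inverse power_divide Z power_mult[symmetric] field_simps)
qed (rule K transcendental_inverse_T sqfree_inf two_ambient)+

lemma adjoin_inverse_T: "adjoin K {inverse T_var} = adjoin K {T_var}"
proof -
  have "inverse y \<in> adjoin K {y}" for y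
    using subfield_closed(10)[OF adjoin_subfield, of y] adjoin_superset[of K "{y}"] by blast
  then have "adjoin K {inverse y} \<subseteq> adjoin K {y}" for y
    using adjoin_superset[of K "{y}"] by (intro adjoin_least adjoin_subfield) auto
  from this[of T_var] this[of "inverse T_var"] show ?thesis by simp
qed

text \<open>\<open>T_var ^ 2\<close> lies in the base field, so the generators of the two charts
  differ by a scalar and both charts belong to one function field.\<close>

lemma inf_M: "inf.M = aff.M"
proof -
  note F = subfield_quad_ext[OF aff.Kx aff.RKx]
  have T: "T_var \<in> aff.Kx" using adjoin_superset[of K "{T_var}"] by blast
  have ZZ: "Z / T_var ^ 2 = 0 + inverse (T_var ^ 2) * Z"
    by (simp add: field_class.field_divide_inverse mult.commute)
  have c: "inverse (T_var ^ 2) \<in> aff.Kx" "T_var ^ 2 \<in> aff.Kx" "0 \<in> aff.Kx"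
    by (intro subfield_closed[OF aff.Kx] T)+
  have RK: "(Z / T_var ^ 2) ^ 2 \<in> aff.Kx" using inf.RKx unfolding adjoin_inverse_T .
  have 1: "Z / T_var ^ 2 \<in> aff.M" unfolding ZZ by (intro quad_extI c)
  have 2: "Z \<in> quad_ext aff.Kx (Z / T_var ^ 2)"
    using quad_extI[OF c(3,2), of "Z / T_var ^ 2"] T_nonzero by simp
  show ?thesis unfolding adjoin_inverse_T
    by (intro equalityI quad_ext_least[OF aff.Kx RK subfield_subring[OF F] base_subset_quad_ext[OF
      aff.Kx aff.RKx] 1]
      quad_ext_least[OF aff.Kx aff.RKx subfield_subring[OF subfield_quad_ext[OF aff.Kx RK]]
        base_subset_quad_ext[OF aff.Kx RK] 2])
qed

lemma chart_closure_Affine: "chart_closure K T_var aff.M (Affine t) = aff.B"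
  unfolding chart_closure_def by (simp add: aff.integral_closure_M)

lemma chart_closure_Infty: "chart_closure K T_var aff.M Infty = inf.B"
  unfolding chart_closure_def using inf.integral_closure_M unfolding inf_M by simp

text \<open>The alternative \<open>z = 0\<close> records infinity, where \<open>q_inf\<close>
  vanishes and the residue field is \<open>K\<close> itself.\<close>

lemma specialization_cases:
  assumes spec: "is_specialization K T_var aff.M t E" and t: "t \<in> proj_line K"
  shows "\<exists>z. E = quad_ext K z \<and> (z = 0 \<or> (\<exists>t0\<in>K. z ^ 2 = u * poly q t0))"
proof (cases t)
  case (Affine t0)
  then have t0: "t0 \<in> K" using t unfolding proj_line_def by auto
  obtain h where h: "h \<in> Ring.ring_hom (on aff.B) (on E)" "h ` aff.B = E" "\<And>c. c \<in> K \<Longrightarrow> h c = c"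
    "T_var - t0 \<in> aff.B" "h (T_var - t0) = 0"
    using is_specialization_hom[OF spec] unfolding Affine chart_closure_Affine
      by (metis local_parameter.simps(1))
  have "h ((T_var - t0) + t0) = h (T_var - t0) + h t0"
    using h(1,4) t0 aff.K_subset_B unfolding ring_hom_on_iff by blast
  then have hT: "h T_var = t0" using h(5) h(3)[OF t0] by simp
  have "E = quad_ext K (h Z)" using aff.hom_image[OF h(1,3) _ h(2)] t0 hT by simp
  moreover have "h Z ^ 2 = u * poly q t0" using aff.hom_Z[OF h(1,3)] hT by simp
  ultimately show ?thesis using t0 by blast
next
  case Infty
  obtain h where h: "h \<in> Ring.ring_hom (on inf.B) (on E)" "h ` inf.B = E" "\<And>c. c \<in> K \<Longrightarrow> h c = c"
    "h (inverse T_var) = 0"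
    using is_specialization_hom[OF spec] unfolding Infty chart_closure_Infty by (metis local_parameter.simps(2))
  have "E = quad_ext K (h (Z / T_var ^ 2))" using inf.hom_image[OF h(1,3) _ h(2)] h(4)
    subfield_closed(1)[OF K] by simp
  moreover have "h (Z / T_var ^ 2) ^ 2 = 0" using inf.hom_Z[OF h(1,3)] h(4) by (simp add: poly_q_inf)
  ultimately show ?thesis by auto
qed

lemma specialization_exists:
  assumes t0: "t0 \<in> K" and z: "z ^ 2 = u * poly q t0"
  shows "is_specialization K T_var aff.M (Affine t0) (quad_ext K z)"
proof -
  have z2: "z ^ 2 \<in> K" unfolding z by (intro subfield_closed[OF K] u poly_in_subring[OF
    subfield_subring[OF K] q t0])
  have z': "z ^ 2 = poly (smult u q) t0" using z by simp
  note ev = aff.eval_B_hom[OF z' t0 refl]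
  have co: "coeffs_in K [:- t0, 1:]" "coeffs_in K 0"
    using subfield_closed(1,2)[OF K] subfield_closed(3)[OF K t0] by simp_all
  have lp: "T_var - t0 = poly [:- t0, 1:] T_var + poly 0 T_var * Z" by simp
  show ?thesis
  proof (rule is_specializationI[where \<Psi> = "aff.eval_B t0 z"], unfold chart_closure_Affine
    local_parameter.simps)
    show "subfield (quad_ext K z) univ_ring" by (rule subfield_quad_ext[OF K z2])
    show "K \<subseteq> quad_ext K z" by (rule base_subset_quad_ext[OF K z2])
    show "subring aff.B univ_ring" "K \<subseteq> aff.B" by (rule aff.subring_B aff.K_subset_B)+
    show "T_var - t0 \<in> aff.B" unfolding lp by (rule aff.B_I[OF co])
    show "aff.eval_B t0 z (T_var - t0) = 0" unfolding lp aff.eval_B_eq[OF co] by simp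
  qed (use ev in auto)
qed

lemma not_ramified:
  assumes "t0 \<in> K" "z \<in> K" "z \<noteq> 0" "z ^ 2 = u * poly q t0"
  shows "\<not> ramified_at K T_var aff.M (Affine t0)"
  unfolding ramified_at_def chart_closure_Affine
  using aff.generates_locally_unramified[of _ t0 z] assms by auto

text \<open>A rational point of the chart at \<open>T\<close> solves
  \<open>y ^ 2 = u * q(t)\<close>, so \<open>y = 0\<close> and it is ramified. A point
  \<open>(x, z)\<close> of the chart at infinity corresponds to \<open>(1 / x, z / x ^ 2)\<close> if
  \<open>x \<noteq> 0\<close>, and for \<open>x = 0\<close> it is the branch point at
  infinity.\<close>

lemma hom_point:
  assumes x: "(x, W, R) \<in> {(T_var, Z, smult u q), (inverse T_var, Z / T_var ^ 2, smult u q_inf)}"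
    and h: "h \<in> Ring.ring_hom (on (integral_closure (poly_ring K x) aff.M)) (on K)" "\<And>c. c \<in> K \<Longrightarrow> h c = c"
    and no_points: "\<And>t y. t \<in> K \<Longrightarrow> y \<in> K \<Longrightarrow> y ^ 2 = u * poly q t \<Longrightarrow> y = 0"
  shows "\<not> generates_locally (integral_closure (poly_ring K x) aff.M) (a_kernel (on
    (integral_closure (poly_ring K x) aff.M)) (on K) h) {x - h x}"
proof (cases "x = T_var")
  case True
  note h = h[unfolded True aff.integral_closure_M]
  have K': "h T_var \<in> K" "h Z \<in> K" using h(1) aff.x_in_B aff.Z_in_B unfolding ring_hom_on_iff by auto
  have "h Z = 0" using no_points[OF K'] aff.hom_Z[OF h] by simp
  then show ?thesis using aff.not_generates_locally_ramified[OF h K'(1)]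
    unfolding True aff.integral_closure_M by blast
next
  case False
  then have x: "x = inverse T_var" using x by auto
  note ic = inf.integral_closure_M[unfolded inf_M]
  note h = h[unfolded x ic]
  let ?x = "h (inverse T_var)" and ?z = "h (Z / T_var ^ 2)"
  have K': "?x \<in> K" "?z \<in> K" using h(1) inf.x_in_B inf.Z_in_B unfolding ring_hom_on_iff by auto
  have e: "?z ^ 2 = u * poly q_inf ?x" using inf.hom_Z[OF h] by simp
  have "?z = 0"
  proof (cases "?x = 0")
    case True
    then show ?thesis using e by (simp add: poly_q_inf)
  next
    case nz: False
    have "(?z / ?x ^ 2) ^ 2 = u * poly q (inverse ?x)"
      using e nz unfolding poly_q_inf_inverse[OF nz] by (simp add: power_divide power_mult[symmetric])
    from no_points[OF _ _ this] have "?z / ?x ^ 2 = 0" using K' subfield_closed(7,10,11)[OF K] by blast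
    then show ?thesis using nz by simp
  qed
  then show ?thesis using inf.not_generates_locally_ramified[OF h K'(1)] unfolding x ic by blast
qed

end

section \<open>Reduction at a point of the line\<close>

lemma split_off_root_power:
  assumes K: "subfield K (univ_ring :: 'a::field ring)" and c: "c \<in> K"
  shows "coeffs_in K r \<Longrightarrow> r \<noteq> 0 \<Longrightarrow> \<exists>e s. coeffs_in K s \<and> r = [:- c, 1:] ^ e * s \<and> poly s c \<noteq> 0"
proof (induction "degree r" arbitrary: r rule: less_induct)
  case less
  show ?case
  proof (cases "poly r c = 0")
    case False
    then show ?thesis using less.prems by (intro exI[of _ 0] exI[of _ r]) simp
  next
    case True
    let ?s = "synthetic_div r c"
    have r: "r = [:- c, 1:] * ?s" using synthetic_div_correct'[of c r] True by simp
    have s: "coeffs_in K ?s" by (rule coeffs_in_synthetic_div[OF subfield_subring[OF K] c less.prems(1)])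
    have s0: "?s \<noteq> 0" using r less.prems(2) by auto
    have "degree r \<noteq> 0"
    proof
      assume "degree r = 0"
      then obtain e where "r = [:e:]" by (rule degree_eq_zeroE)
      then show False using True less.prems(2) by simp
    qed
    then have "degree ?s < degree r" by (simp add: degree_synthetic_div)
    from less.hyps[OF this s s0] obtain e s' where *: "coeffs_in K s'" "?s = [:- c, 1:] ^ e * s'"
      "poly s' c \<noteq> 0" by blast
    have "r = [:- c, 1:] ^ Suc e * s'" using r unfolding *(2) power_Suc mult.assoc .
    then show ?thesis using *(1,3) by blast
  qed
qed

text \<open>\<open>(t, y)\<close> is a point with \<open>y \<noteq> 0\<close> of the curve at
  \<open>U = u0\<close>; the aim is a homomorphism from a chart of the model to \<open>k0\<close>
  realizing it.\<close>

locale twist_reduction = cubic_twist "adjoin k0 {U_var}" U_var Z a \<alpha> \<beta> \<gamma> q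
  for k0 :: "ambient set" and Z a \<alpha> \<beta> \<gamma> q +
  fixes u0 t y :: ambient
  assumes k0: "subfield k0 univ_ring" and k0_Cx: "k0 \<subseteq> Cx" and qk: "coeffs_in k0 q"
    and u0: "u0 \<in> k0" and t: "t \<in> k0" and y: "y \<in> k0" "y \<noteq> 0" "y ^ 2 = u0 * poly q t"
begin

abbreviation "kU \<equiv> adjoin k0 {U_var}"
abbreviation "A \<equiv> base_local_ring k0 u0"
abbreviation "AT \<equiv> poly_ring A T_var"
abbreviation "\<pi> \<equiv> U_var - u0"

lemmas k0cl = subfield_closed[OF k0]
lemmas k0r = subfield_subring[OF k0]
lemmas k0p = coeffs_in_closed[OF k0r]

lemma transcendental_U_k0: "transcendental_over k0 U_var"
  by (rule transcendental_over_mono[OF transcendental_U k0_Cx])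

lemma k0_kU: "k0 \<subseteq> kU" and U_kU: "U_var \<in> kU" using adjoin_superset[of k0 "{U_var}"] by auto

lemma A_I: "coeffs_in k0 p \<Longrightarrow> coeffs_in k0 r \<Longrightarrow> poly r u0 \<noteq> 0 \<Longrightarrow> poly p U_var / poly r U_var \<in> A"
  unfolding base_local_ring_def by blast

lemma A_E:
  assumes "x \<in> A"
  obtains p r where "coeffs_in k0 p" "coeffs_in k0 r" "poly r u0 \<noteq> 0" "x = poly p U_var / poly r
    U_var" "poly r U_var \<noteq> 0"
proof -
  obtain p r where pr: "coeffs_in k0 p" "coeffs_in k0 r" "poly r u0 \<noteq> 0" "x = poly p U_var / poly r U_var"
    using assms unfolding base_local_ring_def by blast
  have "poly r U_var \<noteq> 0" using transcendental_overD[OF transcendental_U_k0 pr(2)] pr(3) by auto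
  then show ?thesis using pr that by blast
qed

lemma A_poly: "coeffs_in k0 p \<Longrightarrow> poly p U_var \<in> A"
  using A_I[of p 1] k0p(2) by simp

lemma k0_A: "k0 \<subseteq> A"
proof
  fix c assume "c \<in> k0"
  then show "c \<in> A" using A_poly[of "[:c:]"] k0cl(1) by simp
qed

lemma U_A: "U_var \<in> A" using A_poly[of "[:0, 1:]"] k0cl(1,2) by simp

lemma A_kU: "A \<subseteq> kU"
proof
  fix x assume "x \<in> A"
  then obtain p r where pr: "coeffs_in k0 p" "coeffs_in k0 r" "x = poly p U_var / poly r U_var" by (rule A_E)
  show "x \<in> kU" unfolding pr(3)
    by (intro subfield_closed(11)[OF K] poly_in_subring[OF subfield_subring[OF K]]
      coeffs_in_mono[OF pr(1) k0_kU] coeffs_in_mono[OF pr(2) k0_kU] U_kU)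
qed

lemma A_ops:
  assumes "x \<in> A" "z \<in> A" shows "x + z \<in> A" "x * z \<in> A"
proof -
  obtain p r where x: "coeffs_in k0 p" "coeffs_in k0 r" "poly r u0 \<noteq> 0" "x = poly p U_var / poly r
    U_var" "poly r U_var \<noteq> 0"
    using assms(1) by (rule A_E)
  obtain p' r' where z: "coeffs_in k0 p'" "coeffs_in k0 r'" "poly r' u0 \<noteq> 0" "z = poly p' U_var /
    poly r' U_var" "poly r' U_var \<noteq> 0"
    using assms(2) by (rule A_E)
  have n: "poly (r * r') u0 \<noteq> 0" using x z by simp
  have "x + z = poly (p * r' + p' * r) U_var / poly (r * r') U_var"
    unfolding x(4) z(4) using x(5) z(5) by (simp add: add_frac_eq)
  then show "x + z \<in> A" using A_I[OF k0p(4)[OF k0p(6)[OF x(1) z(2)] k0p(6)[OF z(1) x(2)]] k0p(6)[OF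
    x(2) z(2)] n] by simp
  have "x * z = poly (p * p') U_var / poly (r * r') U_var" unfolding x(4) z(4) by simp
  then show "x * z \<in> A" using A_I[OF k0p(6)[OF x(1) z(1)] k0p(6)[OF x(2) z(2)] n] by simp
qed

lemma subring_A: "subring A univ_ring"
  unfolding subring_univ_iff
proof (intro conjI ballI)
  show "1 \<in> A" using k0_A k0cl(2) by blast
  show "- x \<in> A" if "x \<in> A" for x using A_ops(2)[OF subsetD[OF k0_A k0cl(3)[OF k0cl(2)]] that] by simp
qed (use A_ops in auto)

lemmas Acl = subring_closed[OF subring_A]
lemmas Ap = coeffs_in_closed[OF subring_A]

text \<open>The residue map of the local ring \<open>A\<close>, evaluation at \<open>U = u0\<close>;
  its kernel is generated by \<pi>.\<close>

definition red :: "ambient \<Rightarrow> ambient" where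
  "red x = (THE v. \<exists>p r. coeffs_in k0 p \<and> coeffs_in k0 r \<and> poly r u0 \<noteq> 0 \<and>
     x = poly p U_var / poly r U_var \<and> v = poly p u0 / poly r u0)"

lemma red_eq:
  assumes "coeffs_in k0 p" "coeffs_in k0 r" "poly r u0 \<noteq> 0"
  shows "red (poly p U_var / poly r U_var) = poly p u0 / poly r u0"
  unfolding red_def
proof (rule the_equality)
  fix v assume "\<exists>p' r'. coeffs_in k0 p' \<and> coeffs_in k0 r' \<and> poly r' u0 \<noteq> 0 \<and>
     poly p U_var / poly r U_var = poly p' U_var / poly r' U_var \<and> v = poly p' u0 / poly r' u0"
  then obtain p' r' where *: "coeffs_in k0 p'" "coeffs_in k0 r'" "poly r' u0 \<noteq> 0"
    "poly p U_var / poly r U_var = poly p' U_var / poly r' U_var" "v = poly p' u0 / poly r' u0" by blast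
  have "r \<noteq> 0" "r' \<noteq> 0" using assms(3) *(3) by auto
  then have "poly r U_var \<noteq> 0" "poly r' U_var \<noteq> 0"
    using transcendental_overD[OF transcendental_U_k0 assms(2)] transcendental_overD[OF
      transcendental_U_k0 *(2)] by blast+
  then have "poly (p * r') U_var = poly (p' * r) U_var" using *(4) by (simp add: frac_eq_eq)
  then have "p * r' = p' * r"
    by (rule transcendental_over_eqD[OF k0r transcendental_U_k0 k0p(6)[OF assms(1) *(2)] k0p(6)[OF
      *(1) assms(2)]])
  then have "poly p u0 * poly r' u0 = poly p' u0 * poly r u0" by (metis poly_mult)
  then show "v = poly p u0 / poly r u0" using assms(3) *(3) unfolding *(5) by (simp add: frac_eq_eq)
qed (use assms in blast)

lemma red_poly: "coeffs_in k0 p \<Longrightarrow> red (poly p U_var) = poly p u0"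
  using red_eq[of p 1] k0p(2) by simp

lemma red_const: "c \<in> k0 \<Longrightarrow> red c = c"
  using red_poly[of "[:c:]"] k0cl(1) by simp

lemma red_U: "red U_var = u0"
  using red_poly[of "[:0, 1:]"] k0cl(1,2) by simp

lemma red_ops:
  assumes "x \<in> A" "z \<in> A"
  shows "red (x + z) = red x + red z" "red (x * z) = red x * red z" "red x \<in> k0"
proof -
  obtain p r where x: "coeffs_in k0 p" "coeffs_in k0 r" "poly r u0 \<noteq> 0" "x = poly p U_var / poly r
    U_var" "poly r U_var \<noteq> 0"
    using assms(1) by (rule A_E)
  obtain p' r' where z: "coeffs_in k0 p'" "coeffs_in k0 r'" "poly r' u0 \<noteq> 0" "z = poly p' U_var /
    poly r' U_var" "poly r' U_var \<noteq> 0"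
    using assms(2) by (rule A_E)
  have n: "poly (r * r') u0 \<noteq> 0" using x z by simp
  have s: "x + z = poly (p * r' + p' * r) U_var / poly (r * r') U_var"
    unfolding x(4) z(4) using x(5) z(5) by (simp add: add_frac_eq)
  show "red (x + z) = red x + red z"
    unfolding s red_eq[OF k0p(4)[OF k0p(6)[OF x(1) z(2)] k0p(6)[OF z(1) x(2)]] k0p(6)[OF x(2) z(2)] n]
    unfolding x(4) z(4) red_eq[OF x(1-3)] red_eq[OF z(1-3)] using x(3) z(3) by (simp add: add_frac_eq)
  have m: "x * z = poly (p * p') U_var / poly (r * r') U_var" unfolding x(4) z(4) by simp
  show "red (x * z) = red x * red z"
    unfolding m red_eq[OF k0p(6)[OF x(1) z(1)] k0p(6)[OF x(2) z(2)] n]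
    unfolding x(4) z(4) red_eq[OF x(1-3)] red_eq[OF z(1-3)] by simp
  show "red x \<in> k0" unfolding x(4) red_eq[OF x(1-3)] by (intro k0cl poly_in_subring[OF k0r _ u0] x)
qed

lemma \<pi>_A: "\<pi> \<in> A" using Acl(5)[OF U_A] u0 k0_A by blast

lemma \<pi>_nonzero: "\<pi> \<noteq> 0" using transcendental_not_in[OF k0r transcendental_U_k0] u0 by auto

lemma red_\<pi>: "red \<pi> = 0"
  using red_poly[of "[:- u0, 1:]"] k0cl(1,2) k0cl(3)[OF u0] by simp

lemma red_eq_0:
  assumes "x \<in> A" "red x = 0" obtains z where "z \<in> A" "x = \<pi> * z"
proof -
  obtain p r where x: "coeffs_in k0 p" "coeffs_in k0 r" "poly r u0 \<noteq> 0" "x = poly p U_var / poly r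
    U_var" "poly r U_var \<noteq> 0"
    using assms(1) by (rule A_E)
  have "poly p u0 = 0" using assms(2) x(3) unfolding x(4) red_eq[OF x(1-3)] by simp
  then have "poly p U_var = \<pi> * poly (synthetic_div p u0) U_var" using poly_split_at[of p U_var u0] by simp
  then have "x = \<pi> * (poly (synthetic_div p u0) U_var / poly r U_var)" unfolding x(4) by simp
  then show ?thesis using A_I[OF coeffs_in_synthetic_div[OF k0r u0 x(1)] x(2,3)] that by blast
qed

text \<open>Only powers of \<open>U - u0\<close> have to be cleared: the remaining part of the
  denominator is nonzero at \<open>u0\<close>, hence a unit of \<open>A\<close>.\<close>

lemma clear_denominator:
  assumes "c \<in> kU" shows "\<exists>e. \<pi> ^ e * c \<in> A"
proof -
  obtain p r where pr: "coeffs_in k0 p" "coeffs_in k0 r" "r \<noteq> 0" "c = poly p U_var / poly r U_var"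
    using assms unfolding adjoin_rational_functions[OF k0 transcendental_U_k0] by blast
  obtain e s where s: "coeffs_in k0 s" "r = [:- u0, 1:] ^ e * s" "poly s u0 \<noteq> 0"
    using split_off_root_power[OF k0 u0 pr(2,3)] by blast
  have "poly r U_var = \<pi> ^ e * poly s U_var" unfolding s(2) by simp
  then have "\<pi> ^ e * c = poly p U_var / poly s U_var" unfolding pr(4) using \<pi>_nonzero by simp
  then show ?thesis using A_I[OF pr(1) s(1,3)] by metis
qed

lemma clear_denominators:
  "coeffs_in kU p \<Longrightarrow> \<exists>e. coeffs_in A (smult (\<pi> ^ e) p)"
proof (induction p)
  case 0
  then show ?case using Acl(1) by simp
next
  case (pCons c p)
  then obtain e1 e2 where e: "\<pi> ^ e1 * c \<in> A" "coeffs_in A (smult (\<pi> ^ e2) p)"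
    using clear_denominator[of c] by auto
  have "\<pi> ^ (e1 + e2) * c = \<pi> ^ e2 * (\<pi> ^ e1 * c)" by (simp add: power_add)
  then have 1: "\<pi> ^ (e1 + e2) * c \<in> A" by (simp only: Acl(6)[OF Acl(7)[OF \<pi>_A] e(1)])
  have "smult (\<pi> ^ (e1 + e2)) p = smult (\<pi> ^ e1) (smult (\<pi> ^ e2) p)" by (simp add: power_add)
  then have "coeffs_in A (smult (\<pi> ^ (e1 + e2)) p)" using Ap(8)[OF Acl(7)[OF \<pi>_A] e(2)] by simp
  then show ?case using 1 by (intro exI[of _ "e1 + e2"]) simp
qed

lemma red_0: "red 0 = 0" by (rule red_const[OF k0cl(1)])

lemma coeff_map_red [simp]: "coeff (map_poly red p) i = red (coeff p i)"
  by (simp add: coeff_map_poly red_0)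

lemma map_red_mult:
  assumes "coeffs_in A p" "coeffs_in A r" shows "map_poly red (p * r) = map_poly red p * map_poly red r"
proof (rule poly_eqI)
  fix n
  have c: "coeff p i * coeff r j \<in> A" "coeff p i \<in> A" "coeff r j \<in> A" for i j
    using assms unfolding coeffs_in_def by (auto intro: Acl)
  have sum: "finite I \<Longrightarrow> sum f I \<in> A \<and> red (sum f I) = (\<Sum>i\<in>I. red (f i))" if "\<And>i. f i \<in> A" for f
    and I :: "nat set"
    by (induction I rule: finite_induct) (auto simp: red_ops red_0 that intro: Acl)
  show "coeff (map_poly red (p * r)) n = coeff (map_poly red p * map_poly red r) n"
    unfolding coeff_mult coeff_map_red
    using sum[of "\<lambda>i. coeff p i * coeff r (n - i)" "{..n}"] c by (simp add: red_ops)
qed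

lemma map_red_power: "coeffs_in A p \<Longrightarrow> map_poly red (p ^ n) = map_poly red p ^ n"
proof (induction n)
  case 0
  have "map_poly red 1 = 1" by (rule poly_eqI) (simp add: red_0 red_const[OF k0cl(2)])
  then show ?case by simp
next
  case (Suc n)
  then show ?case using map_red_mult[OF Suc.prems Ap(7)[OF Suc.prems, of n]] by simp
qed

lemma AT_poly_ring: "AT \<subseteq> poly_ring kU T_var"
  unfolding poly_ring_def using coeffs_in_mono[OF _ A_kU] by blast

lemma subring_AT: "subring AT univ_ring" by (rule subring_poly_ring[OF subring_A])

lemmas ATcl = subring_closed[OF subring_AT]

lemma A_AT: "A \<subseteq> AT" using const_in_poly_ring Acl(1) by blast

lemma T_AT: "T_var \<in> AT" using var_in_poly_ring Acl(1,2) by blast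

lemma AT_Kx: "AT \<subseteq> aff.Kx" using AT_poly_ring aff.prK by blast

lemma transcendental_T_A: "transcendental_over A T_var"
  by (rule transcendental_over_mono[OF T A_kU])

text \<open>Gauss's lemma at the prime \<open>U - u0\<close>, in terms of the reduction \<open>red\<close> of the coefficients.\<close>

lemma AT_integrally_closed:
  assumes f: "f \<in> integral_closure AT aff.Kx" shows "f \<in> AT"
proof -
  have "f \<in> poly_ring kU T_var"
    using f integral_closure_mono[OF AT_poly_ring order_refl] aff.integral_closure_Kx by blast
  then obtain p where p: "coeffs_in kU p" "f = poly p T_var" by (rule poly_ringE)
  \<comment> \<open>The least power of \<pi> clearing the denominators of \<open>p\<close>. If it is
    positive, the integral equation shows that a power of the reduction of \<open>f0\<close>
    vanishes; then \<pi> divides \<open>f0\<close>, and a smaller power would do.\<close>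
  define e where "e = (LEAST e. coeffs_in A (smult (\<pi> ^ e) p))"
  have e: "coeffs_in A (smult (\<pi> ^ e) p)" unfolding e_def by (rule LeastI_ex[OF clear_denominators[OF p(1)]])
  show ?thesis
  proof (cases e)
    case 0
    then have "coeffs_in A p" using e by simp
    then show ?thesis unfolding p(2) by (rule poly_ringI)
  next
    case (Suc m)
    define f0 where "f0 = smult (\<pi> ^ e) p"
    have f0: "coeffs_in A f0" unfolding f0_def by (rule e)
    obtain P where P: "lead_coeff P = 1" "coeffs_in AT P" "poly P f = 0" using f
      unfolding integral_closure_def by blast
    have "\<forall>i. \<exists>a. coeffs_in A a \<and> coeff P i = poly a T_var" using P(2)
      unfolding coeffs_in_def poly_ring_def by blast
    then obtain c where c: "\<And>i. coeffs_in A (c i)" "\<And>i. coeff P i = poly (c i) T_var" by metis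
    define n where "n = degree P"
    \<comment> \<open>For \<open>i < n\<close> the exponent \<open>e * (n - i)\<close> is at least
      1; one factor \<pi> is set aside so that all lower terms together become
      \<open>smult \<pi> S\<close>.\<close>
    define S where "S = (\<Sum>i<n. smult (\<pi> ^ (e * (n - i) - 1)) (c i * f0 ^ i))"
    have S: "coeffs_in A S" unfolding S_def by (intro coeffs_in_sum[OF subring_A] Ap Acl(7) \<pi>_A c f0)
    have tm: "\<pi> ^ (e * n) * (coeff P i * f ^ i) = poly (smult \<pi> (smult (\<pi> ^ (e * (n - i) - 1)) (c i
      * f0 ^ i))) T_var"
      if "i < n" for i
    proof -
      have "e * (n - i) \<noteq> 0" using that Suc by simp
      moreover have "n = i + (n - i)" using that by simp
      then have "e * n = e * i + e * (n - i)" by (metis add_mult_distrib2)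
      ultimately have "e * n = e * i + Suc (e * (n - i) - 1)" by linarith
      then have "\<pi> ^ (e * n) = (\<pi> ^ e) ^ i * (\<pi> * \<pi> ^ (e * (n - i) - 1))" by (simp add: power_add power_mult)
      then show ?thesis unfolding c(2) f0_def p(2) by (simp add: power_mult_distrib)
    qed
    have "0 = \<pi> ^ (e * n) * (\<Sum>i\<le>n. coeff P i * f ^ i)" using P(3) unfolding poly_altdef n_def by simp
    also have "\<dots> = (\<Sum>i<n. \<pi> ^ (e * n) * (coeff P i * f ^ i)) + \<pi> ^ (e * n) * f ^ n"
      using P(1) unfolding n_def lessThan_Suc_atMost[symmetric] by (simp add: distrib_left sum_distrib_left)
    also have "(\<Sum>i<n. \<pi> ^ (e * n) * (coeff P i * f ^ i)) = poly (smult \<pi> S) T_var"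
      unfolding S_def smult_sum2 poly_sum by (intro sum.cong refl tm) simp
    also have "\<pi> ^ (e * n) * f ^ n = poly (f0 ^ n) T_var"
      unfolding f0_def p(2) by (simp add: power_mult power_mult_distrib)
    finally have "poly (smult \<pi> S + f0 ^ n) T_var = 0" by simp
    then have "smult \<pi> S + f0 ^ n = 0"
      by (rule transcendental_overD[OF transcendental_T_A Ap(4)[OF Ap(8)[OF \<pi>_A S] Ap(7)[OF f0]]])
    then have f0n: "f0 ^ n = smult \<pi> (- S)" by (simp add: add_eq_0_iff)
    have "map_poly red (smult \<pi> (- S)) = 0"
    proof (rule poly_eqI)
      fix i
      have "coeff (- S) i \<in> A" using Ap(3)[OF S] unfolding coeffs_in_def by blast
      from red_ops(2)[OF \<pi>_A this] show "coeff (map_poly red (smult \<pi> (- S))) i = coeff 0 i"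
        unfolding coeff_map_red coeff_smult by (simp only: red_\<pi> mult_zero_left coeff_0)
    qed
    then have "map_poly red f0 ^ n = 0" unfolding map_red_power[OF f0, symmetric] f0n .
    then have z: "map_poly red f0 = 0" by (metis power_not_zero)
    have "coeff (smult (\<pi> ^ m) p) i \<in> A" for i
    proof -
      have "red (coeff f0 i) = 0" using z by (metis coeff_0 coeff_map_red)
      moreover have "coeff f0 i \<in> A" using f0 unfolding coeffs_in_def by blast
      ultimately obtain v where "v \<in> A" "coeff f0 i = \<pi> * v" using red_eq_0 by metis
      then show ?thesis using \<pi>_nonzero unfolding f0_def Suc by simp
    qed
    then have "coeffs_in A (smult (\<pi> ^ m) p)" unfolding coeffs_in_def by blast
    then have "e \<le> m" unfolding e_def by (rule Least_le)
    then show ?thesis using Suc by simp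
  qed
qed

text \<open>The residue map of \<open>A[T]\<close> at the point \<open>U = u0\<close>,
  \<open>T = t\<close> of the plane: first \<open>T = t\<close>, then \<open>red\<close>.\<close>

definition ev :: "ambient \<Rightarrow> ambient" where
  "ev f = (THE v. \<exists>p. coeffs_in A p \<and> f = poly p T_var \<and> v = red (poly p t))"

lemma t_A: "t \<in> A" using t k0_A by blast

lemma ev_eq:
  assumes "coeffs_in A p" shows "ev (poly p T_var) = red (poly p t)"
  unfolding ev_def
proof (rule the_equality)
  fix v assume "\<exists>p'. coeffs_in A p' \<and> poly p T_var = poly p' T_var \<and> v = red (poly p' t)"
  then obtain p' where p': "coeffs_in A p'" "poly p T_var = poly p' T_var" "v = red (poly p' t)" by blast
  then show "v = red (poly p t)" using transcendental_over_eqD[OF subring_A transcendental_T_A assms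
    p'(1,2)] by simp
qed (use assms in blast)

lemma ev_ops:
  assumes "f \<in> AT" "g \<in> AT"
  shows "ev (f + g) = ev f + ev g" "ev (f * g) = ev f * ev g" "ev f \<in> k0"
proof -
  obtain p where p: "coeffs_in A p" "f = poly p T_var" using assms(1) by (rule poly_ringE)
  obtain r where r: "coeffs_in A r" "g = poly r T_var" using assms(2) by (rule poly_ringE)
  have in_A: "poly p t \<in> A" "poly r t \<in> A" by (intro poly_in_subring[OF subring_A _ t_A] p r)+
  show "ev (f + g) = ev f + ev g"
    using ev_eq[OF Ap(4)[OF p(1) r(1)]] unfolding p(2) r(2) ev_eq[OF p(1)] ev_eq[OF r(1)]
      by (simp add: red_ops in_A)
  show "ev (f * g) = ev f * ev g"
    using ev_eq[OF Ap(6)[OF p(1) r(1)]] unfolding p(2) r(2) ev_eq[OF p(1)] ev_eq[OF r(1)]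
      by (simp add: red_ops in_A)
  show "ev f \<in> k0" unfolding p(2) ev_eq[OF p(1)] using red_ops(3)[OF in_A(1) in_A(1)] .
qed

lemma ev_A: "c \<in> A \<Longrightarrow> ev c = red c"
  using ev_eq[of "[:c:]"] Acl(1) by simp

lemma ev_T: "ev T_var = t"
  using ev_eq[of "[:0, 1:]"] Acl(1,2) red_const[OF t] by simp

text \<open>Division by \<open>T_var - t\<close> leaves the value in \<open>A\<close>, which differs
  from its reduction by a multiple of \<pi>; so \<pi> and \<open>T_var - t\<close> generate the
  kernel of \<open>ev\<close>.\<close>

lemma ev_remainder:
  assumes "f \<in> AT"
  obtains v w where "v \<in> AT" "w \<in> AT" "f = ev f + \<pi> * v + (T_var - t) * w"
proof -
  obtain p where p: "coeffs_in A p" "f = poly p T_var" using assms by (rule poly_ringE)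
  have pt: "poly p t \<in> A" by (rule poly_in_subring[OF subring_A p(1) t_A])
  have r: "red (poly p t) \<in> k0" using red_ops(3)[OF pt pt] .
  let ?d = "poly p t + - red (poly p t)"
  have nr: "- red (poly p t) \<in> k0" by (rule k0cl(3)[OF r])
  then have "?d \<in> A" using Acl(4)[OF pt] k0_A by blast
  moreover have "red ?d = 0" using red_ops(1)[OF pt subsetD[OF k0_A nr]] red_const[OF nr] by simp
  ultimately obtain v where v: "v \<in> A" "?d = \<pi> * v" by (rule red_eq_0)
  have "f = ev f + \<pi> * v + (T_var - t) * poly (synthetic_div p t) T_var"
    unfolding v(2)[symmetric] unfolding p(2) ev_eq[OF p(1)] using poly_split_at[of p T_var t] by simp
  then show ?thesis using that v(1) A_AT poly_ringI[OF coeffs_in_synthetic_div[OF subring_A t_A p(1)]] by blast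
qed

definition D :: ambient where "D = U_var * poly q T_var"

lemma D_AT: "D \<in> AT" and ev_D: "ev D = y ^ 2" and D_nonzero: "D \<noteq> 0" and Z_D: "Z ^ 2 = D"
proof -
  have qA: "coeffs_in A (smult U_var q)" by (rule Ap(8)[OF U_A coeffs_in_mono[OF qk k0_A]])
  have D: "D = poly (smult U_var q) T_var" by (simp add: D_def)
  show "D \<in> AT" unfolding D by (rule poly_ringI[OF qA])
  have qt: "poly q t \<in> k0" by (rule poly_in_subring[OF k0r qk t])
  show "ev D = y ^ 2" unfolding D ev_eq[OF qA] y(3)
    using red_ops(2)[OF U_A subsetD[OF k0_A qt]] by (simp add: red_U red_const[OF qt])
  show Z: "Z ^ 2 = D" using aff.Z by (simp add: D_def)
  show "D \<noteq> 0"
  proof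
    assume "D = 0"
    then have "Z = 0" using Z by simp
    then show False using aff.Z_notin subfield_closed(1)[OF aff.Kx] by simp
  qed
qed

abbreviation "BB \<equiv> integral_closure AT aff.M"

lemma AT_M: "AT \<subseteq> aff.M" using AT_Kx base_subset_quad_ext[OF aff.Kx aff.RKx] by blast

lemma subring_BB: "subring BB univ_ring"
  by (rule subring_integral_closure[OF subring_AT aff.Mr AT_M])

lemmas BBcl = subring_closed[OF subring_BB]

lemma AT_BB: "AT \<subseteq> BB" by (rule subset_integral_closure[OF subring_AT AT_M])

lemma sqrt_integral:
  assumes "w ^ 2 \<in> AT" "w \<in> E" shows "w \<in> integral_closure AT E"
  unfolding integral_closure_def
proof (intro CollectI conjI exI)
  show "coeffs_in AT [:- (w ^ 2), 0, 1:]" using assms(1) ATcl(1-3) by simp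
qed (use assms(2) in \<open>auto simp: power2_eq_square\<close>)

lemma Z_BB: "Z \<in> BB"
  using sqrt_integral[of Z aff.M] root_in_quad_ext[OF aff.Kx aff.RKx] D_AT unfolding Z_D by blast

text \<open>Elements of \<open>BB\<close> are written with denominator \<open>D\<close>, which is a unit at the point \<open>(t, y)\<close>.\<close>

lemma BB_E:
  assumes "b \<in> BB" obtains f g where "f \<in> AT" "g \<in> AT" "b = f + g / D * Z"
proof -
  have "b \<in> aff.M" using assms unfolding integral_closure_def by blast
  then obtain f g where fg: "f \<in> aff.Kx" "g \<in> aff.Kx" "b = f + g * Z" by (rule quad_extE)
  have "inverse 2 \<in> k0" by (rule k0cl(10)[OF k0cl(9)])
  then have half: "inverse 2 \<in> AT" using k0_A A_AT by blast
  have D: "poly (smult U_var q) T_var = D" by (simp add: D_def)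
  note tn = aff.integral_trace_norm[OF subring_AT AT_Kx half fg(1,2) assms[unfolded fg(3)], unfolded D]
  \<comment> \<open>The trace and norm argument controls only \<open>g ^ 2 * D\<close>; multiplying
    by \<open>D\<close> makes it the square of \<open>g * D\<close>, which is therefore
    integral.\<close>
  have "(g * D) ^ 2 = (g ^ 2 * D) * D" by (simp add: power2_eq_square)
  then have "(g * D) ^ 2 \<in> AT" using ATcl(6)[OF AT_integrally_closed[OF tn(3)] D_AT] by simp
  moreover have "g * D \<in> aff.Kx" using subfield_closed(6)[OF aff.Kx fg(2)] D_AT AT_Kx by blast
  ultimately have "g * D \<in> AT" using AT_integrally_closed sqrt_integral by blast
  moreover have "b = f + g * D / D * Z" using fg(3) D_nonzero by simp
  ultimately show ?thesis using that AT_integrally_closed[OF tn(1)] by blast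
qed

lemma BB_unique:
  assumes "f \<in> AT" "g \<in> aff.Kx" "f' \<in> AT" "g' \<in> aff.Kx" "f + g / D * Z = f' + g' / D * Z"
  shows "f = f'" "g = g'"
proof -
  have DK: "D \<in> aff.Kx" using D_AT AT_Kx by blast
  have "g / D \<in> aff.Kx" "g' / D \<in> aff.Kx" by (intro subfield_closed(11)[OF aff.Kx] assms DK)+
  from quad_coords_unique[OF aff.Kx aff.RKx aff.Z_notin subsetD[OF AT_Kx assms(1)] this(1)
    subsetD[OF AT_Kx assms(3)] this(2) assms(5)]
  show "f = f'" "g = g'" using D_nonzero by auto
qed

text \<open>The value at \<open>(t, y)\<close>: \<open>D\<close> goes to \<open>y ^ 2\<close> and
  \<open>Z\<close> to \<open>y\<close>, so \<open>g / D * Z\<close> goes to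
  \<open>ev g / y ^ 2 * y\<close>.\<close>

definition \<phi> :: "ambient \<Rightarrow> ambient" where
  "\<phi> b = (THE v. \<exists>f\<in>AT. \<exists>g\<in>AT. b = f + g / D * Z \<and> v = ev f + ev g / y)"

lemma \<phi>_eq:
  assumes "f \<in> AT" "g \<in> AT" shows "\<phi> (f + g / D * Z) = ev f + ev g / y"
  unfolding \<phi>_def
proof (rule the_equality)
  fix v assume "\<exists>f'\<in>AT. \<exists>g'\<in>AT. f + g / D * Z = f' + g' / D * Z \<and> v = ev f' + ev g' / y"
  then obtain f' g' where *: "f' \<in> AT" "g' \<in> AT" "f + g / D * Z = f' + g' / D * Z" "v = ev f' + ev
    g' / y" by blast
  then show "v = ev f + ev g / y"
    using BB_unique[OF assms(1) subsetD[OF AT_Kx assms(2)] *(1) subsetD[OF AT_Kx *(2)] *(3)] by simp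
qed (use assms in blast)

lemma ev_0: "ev 0 = 0" using ev_A[OF Acl(1)] red_0 by simp

lemma \<phi>_AT: "f \<in> AT \<Longrightarrow> \<phi> f = ev f"
  using \<phi>_eq[of f 0] ATcl(1) ev_0 by simp

lemma \<phi>_Z: "\<phi> Z = y"
  using \<phi>_eq[OF ATcl(1) D_AT] D_nonzero ev_D y(2) ev_0 by (simp add: power2_eq_square)

lemma \<phi>_hom: "\<phi> \<in> Ring.ring_hom (on BB) (on k0)"
  unfolding ring_hom_on_iff
proof (intro conjI ballI)
  show "\<phi> ` BB \<subseteq> k0"
  proof
    fix v assume "v \<in> \<phi> ` BB"
    then obtain b where b: "b \<in> BB" "v = \<phi> b" by blast
    obtain f g where fg: "f \<in> AT" "g \<in> AT" "b = f + g / D * Z" using b(1) by (rule BB_E)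
    show "v \<in> k0" unfolding b(2) fg(3) \<phi>_eq[OF fg(1,2)]
      by (intro k0cl ev_ops(3)[OF fg(1,1)] ev_ops(3)[OF fg(2,2)] y)
  qed
  show "\<phi> 1 = 1" using \<phi>_AT[OF ATcl(2)] ev_A[OF Acl(2)] red_const[OF k0cl(2)] by simp
  fix b c assume b: "b \<in> BB" and c: "c \<in> BB"
  obtain f g where fg: "f \<in> AT" "g \<in> AT" "b = f + g / D * Z" using b by (rule BB_E)
  obtain f' g' where fg': "f' \<in> AT" "g' \<in> AT" "c = f' + g' / D * Z" using c by (rule BB_E)
  have s: "b + c = (f + f') + (g + g') / D * Z" unfolding fg fg' by (simp add: algebra_simps add_divide_distrib)
  show "\<phi> (b + c) = \<phi> b + \<phi> c"
    unfolding s \<phi>_eq[OF ATcl(4)[OF fg(1) fg'(1)] ATcl(4)[OF fg(2) fg'(2)]]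
    unfolding fg(3) fg'(3) \<phi>_eq[OF fg(1,2)] \<phi>_eq[OF fg'(1,2)] ev_ops(1)[OF fg(1) fg'(1)]
      ev_ops(1)[OF fg(2) fg'(2)]
    by (simp add: add_divide_distrib)
  \<comment> \<open>Multiplying out produces \<open>g * g' / D\<close>, which is not visibly in
    \<open>AT\<close>. Comparison with the coordinates of \<open>b * c\<close>, which exist because
    \<open>BB\<close> is a ring, shows that it is.\<close>
  obtain f'' g'' where fg'': "f'' \<in> AT" "g'' \<in> AT" "b * c = f'' + g'' / D * Z" using BBcl(6)[OF b c]
    by (rule BB_E)
  have gg: "g / D * Z * (g' / D * Z) = g * g' / D"
    using D_nonzero Z_D by (simp add: power2_eq_square mult.assoc mult.left_commute[of Z])
  have m: "b * c = (f * f' + g * g' / D) + (f * g' + f' * g) / D * Z"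
    unfolding fg(3) fg'(3) using gg by (simp add: algebra_simps add_divide_distrib)
  have DK: "D \<in> aff.Kx" using D_AT AT_Kx by blast
  note KA = subsetD[OF AT_Kx]
  have inK: "f'' \<in> aff.Kx" "g'' / D \<in> aff.Kx" "f * f' + g * g' / D \<in> aff.Kx" "(f * g' + f' * g) / D \<in> aff.Kx"
    by (intro subfield_closed[OF aff.Kx] KA fg fg' fg'' D_AT)+
  have e: "f'' = f * f' + g * g' / D" "g'' / D = (f * g' + f' * g) / D"
    using quad_coords_unique[OF aff.Kx aff.RKx aff.Z_notin inK] fg''(3) m by simp_all
  define h where "h = g * g' / D"
  have "h = f'' - f * f'" unfolding h_def e(1) by simp
  then have h: "h \<in> AT" using ATcl(5)[OF fg''(1) ATcl(6)[OF fg(1) fg'(1)]] by simp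
  have "h * D = g * g'" using D_nonzero by (simp add: h_def)
  then have "ev h * y ^ 2 = ev g * ev g'" using ev_ops(2)[OF h D_AT] ev_ops(2)[OF fg(2) fg'(2)] ev_D by simp
  then have evh: "ev h = (ev g / y) * (ev g' / y)" using y(2) by (simp add: field_simps power2_eq_square)
  have ff: "f * f' \<in> AT" "f * g' \<in> AT" "f' * g \<in> AT" by (intro ATcl fg fg')+
  have "\<phi> (b * c) = ev (f * f' + h) + ev (f * g' + f' * g) / y"
    unfolding m h_def[symmetric] by (intro \<phi>_eq ATcl(4) ff h)
  also have "\<dots> = (ev f + ev g / y) * (ev f' + ev g' / y)"
    unfolding ev_ops(1)[OF ff(1) h] ev_ops(1)[OF ff(2,3)] ev_ops(2)[OF fg(1) fg'(1)] ev_ops(2)[OF fg(1) fg'(2)]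
      ev_ops(2)[OF fg'(1) fg(2)] evh by (simp add: algebra_simps add_divide_distrib)
  finally show "\<phi> (b * c) = \<phi> b * \<phi> c" unfolding fg(3) fg'(3) \<phi>_eq[OF fg(1,2)] \<phi>_eq[OF fg'(1,2)] .
qed

text \<open>The local unit is \<open>D * (Z + y)\<close>: \<open>D\<close> clears the denominator of
  \<open>b\<close>, and \<open>(Z + y) * (Z - y) = D - y ^ 2\<close> is a combination of \<pi> and
  \<open>T_var - t\<close> because \<open>ev D = y ^ 2\<close>.\<close>

lemma generates_locally_BB:
  "generates_locally BB (a_kernel (on BB) (on k0) \<phi>) {\<pi>, T_var - t}"
proof -
  have kA: "k0 \<subseteq> AT" "k0 \<subseteq> BB" using k0_A A_AT AT_BB by blast+
  have \<pi>T: "\<pi> \<in> AT" "T_var - t \<in> AT" using \<pi>_A A_AT ATcl(5)[OF T_AT] t kA by blast+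
  have "ev \<pi> = 0" using ev_A[OF \<pi>_A] red_\<pi> by simp
  moreover have "ev (T_var - t) = 0"
  proof -
    have nt: "- t \<in> k0" by (rule k0cl(3)[OF t])
    have "ev (T_var + - t) = 0"
      using ev_ops(1)[OF T_AT subsetD[OF kA(1) nt]] ev_T ev_A[OF subsetD[OF k0_A nt]] red_const[OF nt] by simp
    then show ?thesis by simp
  qed
  ultimately have gen: "\<pi> \<in> a_kernel (on BB) (on k0) \<phi>" "T_var - t \<in> a_kernel (on BB) (on k0) \<phi>"
    using \<pi>T AT_BB unfolding a_kernel_on by (auto simp: \<phi>_AT)
  have yB: "y \<in> BB" using y kA by blast
  have ZyB: "Z + y \<in> BB" by (rule BBcl(4)[OF Z_BB yB])
  have hom: "\<And>b c. b \<in> BB \<Longrightarrow> c \<in> BB \<Longrightarrow> \<phi> (b * c) = \<phi> b * \<phi> c" "\<And>b c. b \<in> BB \<Longrightarrow> c \<in> BB \<Longrightarrow> \<phi> (b + c) = \<phi> b + \<phi> c"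
    using \<phi>_hom unfolding ring_hom_on_iff by blast+
  have DB: "D \<in> BB" using D_AT AT_BB by blast
  have \<phi>y: "\<phi> y = y" using \<phi>_AT[OF subsetD[OF kA(1) y(1)]] ev_A[OF subsetD[OF k0_A y(1)]]
    red_const[OF y(1)] by simp
  have "\<phi> (D * (Z + y)) = y ^ 2 * (y + y)"
    using hom(1)[OF DB ZyB] hom(2)[OF Z_BB yB] \<phi>_AT[OF D_AT] ev_D \<phi>_Z \<phi>y by simp
  moreover have "y + y = 2 * y" by simp
  ultimately have s: "D * (Z + y) \<in> BB - a_kernel (on BB) (on k0) \<phi>"
    using BBcl(6)[OF DB ZyB] y(2) two_ambient unfolding a_kernel_on by simp
  have "D * (Z + y) * b \<in> genideal (on BB) {\<pi>, T_var - t}" if b: "b \<in> a_kernel (on BB) (on k0) \<phi>" for b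
  proof -
    have b': "b \<in> BB" "\<phi> b = 0" using b unfolding a_kernel_on by auto
    obtain f g where fg: "f \<in> AT" "g \<in> AT" "b = f + g / D * Z" using b'(1) by (rule BB_E)
    have Df: "D * f \<in> AT" by (rule ATcl(6)[OF D_AT fg(1)])
    obtain v1 w1 where 1: "v1 \<in> AT" "w1 \<in> AT" "D * f = ev (D * f) + \<pi> * v1 + (T_var - t) * w1"
      using Df by (rule ev_remainder)
    obtain v2 w2 where 2: "v2 \<in> AT" "w2 \<in> AT" "g = ev g + \<pi> * v2 + (T_var - t) * w2" using fg(2)
      by (rule ev_remainder)
    obtain v3 w3 where 3: "v3 \<in> AT" "w3 \<in> AT" "D = y ^ 2 + \<pi> * v3 + (T_var - t) * w3"
      using ev_remainder[OF D_AT] unfolding ev_D .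
    \<comment> \<open>As \<open>\<phi> b = 0\<close>, the constant terms of \<open>D * f\<close> and
      \<open>g\<close> are \<open>- c2 * y\<close> and \<open>c2\<close>; so \<open>D * b\<close> is
      \<open>c2 * (Z - y)\<close> up to multiples of \<pi> and \<open>T_var - t\<close>.\<close>
    define c2 where "c2 = ev g"
    have "ev f + ev g / y = 0" using b'(2) unfolding fg(3) \<phi>_eq[OF fg(1,2)] .
    then have "ev f = - c2 / y" unfolding c2_def by (simp add: add_eq_0_iff)
    then have c1: "ev (D * f) = - c2 * y"
      using ev_ops(2)[OF D_AT fg(1)] ev_D y(2) by (simp add: power2_eq_square)
    have c2: "c2 \<in> BB" unfolding c2_def using ev_ops(3)[OF fg(2,2)] kA by blast
    have "D * b = D * f + g * Z" unfolding fg(3) using D_nonzero by (simp add: algebra_simps)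
    also have "\<dots> = (- c2 * y + \<pi> * v1 + (T_var - t) * w1) + (c2 + \<pi> * v2 + (T_var - t) * w2) * Z"
      using 1(3) 2(3) unfolding c1 c2_def by simp
    finally have Db: "D * b = (- c2 * y + \<pi> * v1 + (T_var - t) * w1) + (c2 + \<pi> * v2 + (T_var - t) * w2) * Z" .
    have "Z * Z = y * y + \<pi> * v3 + (T_var - t) * w3" using Z_D 3(3) by (simp add: power2_eq_square)
    then have ZZ: "(Z + y) * (Z - y) = \<pi> * v3 + (T_var - t) * w3" by (simp add: algebra_simps)
    have "D * (Z + y) * b = (Z + y) * (D * b)" by (simp only: ac_simps)
    also have "\<dots> = c2 * ((Z + y) * (Z - y)) + (Z + y) * (\<pi> * v1 + (T_var - t) * w1 + (\<pi> * v2 +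
      (T_var - t) * w2) * Z)"
      unfolding Db by (simp add: algebra_simps)
    also have "\<dots> = (c2 * v3 + (Z + y) * (v1 + v2 * Z)) * \<pi> + (c2 * w3 + (Z + y) * (w1 + w2 * Z)) * (T_var - t)"
      unfolding ZZ by (simp add: algebra_simps)
    also have "\<dots> \<in> genideal (on BB) {\<pi>, T_var - t}"
      by (intro combination_in_genideal[OF subring_BB] subsetD[OF AT_BB \<pi>T(1)] subsetD[OF AT_BB
        \<pi>T(2)] BBcl c2 Z_BB yB
        subsetD[OF AT_BB 1(1)] subsetD[OF AT_BB 1(2)] subsetD[OF AT_BB 2(1)] subsetD[OF AT_BB 2(2)]
          subsetD[OF AT_BB 3(1)] subsetD[OF AT_BB 3(2)])
    finally show ?thesis .
  qed
  then show ?thesis unfolding generates_locally_def using gen s by blast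
qed

lemma reduction_has_unramified_point: "reduction_has_unramified_point k0 u0 aff.M"
proof -
  have \<phi>A: "\<phi> c = red c" if "c \<in> A" for c using \<phi>_AT[OF subsetD[OF A_AT that]] ev_A[OF that] by simp
  have "\<phi> T_var = t" using \<phi>_AT[OF T_AT] ev_T by simp
  moreover have "\<phi> U_var = u0" using \<phi>A[OF U_A] red_U by simp
  moreover have "\<forall>c\<in>k0. \<phi> c = c" using \<phi>A k0_A red_const by auto
  ultimately show ?thesis
    unfolding reduction_has_unramified_point_def Let_def model_chart_def
    using \<phi>_hom generates_locally_BB by (intro bexI[of _ T_var] bexI[of _ \<phi>]) auto
qed

end

section \<open>The parametric extensions\<close>

text \<open>An integral element is a polynomial \<open>p\<close> in \<open>x\<close>, and an
  equation for it makes a composition with \<open>p\<close> vanish identically, so \<open>p\<close>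
  is constant.\<close>

lemma (in quadratic_function_field) integral_closure_constants: "integral_closure K Kx = K"
proof (intro equalityI subsetI)
  fix f assume f: "f \<in> integral_closure K Kx"
  have "K \<subseteq> poly_ring K x" using const_in_poly_ring subfield_closed(1)[OF K] by blast
  then have "f \<in> poly_ring K x" using f integral_closure_mono[of K "poly_ring K x" Kx Kx]
    integral_closure_Kx by blast
  then obtain p where p: "coeffs_in K p" "f = poly p x" by (rule poly_ringE)
  obtain P where P: "lead_coeff P = 1" "coeffs_in K P" "poly P f = 0" using f
    unfolding integral_closure_def by blast
  have comp: "coeffs_in K (pcompose P p)"
    using P(2)
  proof (induction P)
    case (pCons c P)
    then show ?case unfolding pcompose_pCons
      by (intro pcl(4,6) p) (use subfield_closed(1)[OF K] in auto)
  qed (use subfield_closed(1)[OF K] in simp)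
  have "poly (pcompose P p) x = 0" using P(3) unfolding p(2) poly_pcompose .
  then have "pcompose P p = 0" by (rule transcendental_overD[OF x comp])
  moreover have "P \<noteq> 0" using P(1) by auto
  ultimately have "degree p = 0" using pcompose_eq_0 by blast
  then obtain c where "p = [:c:]" by (rule degree_eq_zeroE)
  then show "f \<in> K" using p by simp
next
  fix c assume "c \<in> K"
  moreover have "K \<subseteq> Kx" using adjoin_superset[of K "{x}"] by blast
  ultimately show "c \<in> integral_closure K Kx" using subset_integral_closure[OF Kr] by blast
qed

text \<open>For an algebraic \<open>f + g * Z\<close> the norm argument makes
  \<open>g ^ 2 * R\<close> a constant; as \<open>R\<close> has positive degree,
  \<open>g = 0\<close>.\<close>

lemma (in quadratic_function_field) regular_M: "regular_over K M"
  unfolding regular_over_def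
proof (intro equalityI subsetI)
  have KKx: "K \<subseteq> Kx" using adjoin_superset[of K "{x}"] by blast
  fix b assume "b \<in> M \<inter> alg_closure_in K"
  then have b: "b \<in> M" "b \<in> integral_closure K M" unfolding alg_closure_in_eq[OF K] integral_closure_def by auto
  obtain f g where fg: "f \<in> Kx" "g \<in> Kx" "b = f + g * Z" using b(1) by (rule quad_extE)
  have half: "inverse 2 \<in> K" by (rule subfield_closed(10)[OF K subfield_closed(9)[OF K]])
  note tn = integral_trace_norm[OF Kr KKx half fg(1,2) b(2)[unfolded fg(3)], unfolded
    integral_closure_constants]
  have "g ^ 2 * poly R x \<in> poly_ring K x" by (rule const_in_poly_ring[OF tn(3) subfield_closed(1)[OF K]])
  then obtain r where r: "coeffs_in K r" "g = poly r x" using square_in_poly_ring[OF fg(2)]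
    by (meson poly_ringE)
  let ?c = "g ^ 2 * poly R x"
  have cc: "coeffs_in K [:?c:]" using tn(3) subfield_closed(1)[OF K] by simp
  have "poly (r ^ 2 * R) x = poly [:?c:] x" unfolding r(2) by simp
  then have e: "r ^ 2 * R = [:?c:]" by (rule transcendental_over_eqD[OF Kr x pcl(6)[OF pcl(7)[OF r(1)] R] cc])
  have "r = 0"
  proof (rule ccontr)
    assume "r \<noteq> 0"
    then have "degree (r ^ 2 * R) = degree (r ^ 2) + degree R" using R0 by (intro degree_mult_eq) auto
    then show False using deg_R unfolding e by simp
  qed
  then show "b \<in> K" using tn(1) unfolding fg(3) r(2) by simp
next
  fix b assume "b \<in> K"
  then show "b \<in> M \<inter> alg_closure_in K"
    using adjoin_superset[of K "{x}"] base_subset_quad_ext[OF Kx RKx] subset_alg_closure_in[OF K] by blast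
qed

lemma quad_ext_scale:
  assumes L: "subfield L (univ_ring :: 'a::field ring)" and c: "c \<in> L" "c \<noteq> 0"
  shows "quad_ext L (c * z) = quad_ext L z"
proof (intro equalityI subsetI)
  note cl = subfield_closed[OF L]
  fix v assume "v \<in> quad_ext L (c * z)"
  then obtain a b where ab: "a \<in> L" "b \<in> L" "v = a + b * (c * z)" by (rule quad_extE)
  show "v \<in> quad_ext L z" using quad_extI[OF ab(1) cl(6)[OF ab(2) c(1)], of z] ab(3) by (simp add: mult.assoc)
next
  note cl = subfield_closed[OF L]
  fix v assume "v \<in> quad_ext L z"
  then obtain a b where ab: "a \<in> L" "b \<in> L" "v = a + b * z" by (rule quad_extE)
  show "v \<in> quad_ext L (c * z)" using quad_extI[OF ab(1) cl(11)[OF ab(2) c(1)], of "c * z"] ab(3) c(2) by simp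
qed

text \<open>The square of \<open>c + e * s\<close> has \<open>s\<close>-coordinate
  \<open>2 * c * e\<close>, so \<open>c\<close> or \<open>e\<close> vanishes, and
  \<open>e = 0\<close> would put \<open>z\<close> into \<open>L\<close>.\<close>

lemma square_in_quad_ext:
  assumes L: "subfield L (univ_ring :: 'a::field ring)" and two: "(2::'a) \<noteq> 0" and s: "s ^ 2 \<in> L" "s \<notin> L"
    and z: "z \<in> quad_ext L s" "z ^ 2 \<in> L" "z \<notin> L"
  obtains e where "e \<in> L" "z = e * s"
proof -
  note cl = subfield_closed[OF L]
  obtain c e where ce: "c \<in> L" "e \<in> L" "z = c + e * s" using z(1) by (rule quad_extE)
  have "z ^ 2 = (c ^ 2 + e ^ 2 * s ^ 2) + (2 * c * e) * s" unfolding ce(3)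
    by (simp add: algebra_simps power2_eq_square)
  then have "z ^ 2 + 0 * s = (c ^ 2 + e ^ 2 * s ^ 2) + (2 * c * e) * s" by simp
  moreover have "c ^ 2 + e ^ 2 * s ^ 2 \<in> L" "2 * c * e \<in> L" by (intro cl ce s)+
  ultimately have "0 = 2 * c * e" using quad_coords_unique(2)[OF L s z(2) cl(1)] by blast
  then have "c = 0 \<or> e = 0" using two by simp
  then show ?thesis using that ce z(3) by auto
qed

lemma splitting_field_sqrt:
  "splitting_field L (eval_inner [:- q, 0, 1:] t) = adjoin L {y. y ^ 2 = poly q (t :: 'a::field)}"
proof -
  have "eval_inner [:- q, 0, 1:] t = [:- poly q t, 0, 1:]"
    unfolding eval_inner_def by (rule poly_eqI) (simp add: coeff_map_poly coeff_pCons split: nat.split)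
  then have "{y. poly (eval_inner [:- q, 0, 1:] t) y = 0} = {y. y ^ 2 = poly q t}"
    by (auto simp: power2_eq_square)
  then show ?thesis unfolding splitting_field_def by simp
qed

theorem theorem4p3:
  fixes k :: "complex set" and Q :: "complex poly"
    and k\<^sub>0 kU F N :: "ambient set" and q :: "ambient poly"
    and P :: "ambient \<Rightarrow> ambient \<Rightarrow> ambient \<Rightarrow> ambient"
  assumes "number_field k"
    and "degree Q = 3" and "irreducible_over k Q"
    and "root_number k (cubic_curve Q) = -1"
    and "\<And>L. quadratic_extension k L \<Longrightarrow> root_number L (cubic_curve Q) = 1"
    and BSD_conjecture
    and "k\<^sub>0 = const ` k" and "kU = adjoin k\<^sub>0 {U_var}" and "q = map_poly const Q"
    and "F = adjoin (adjoin k\<^sub>0 {T_var}) {y. y ^ 2 = poly q T_var}"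
    and "P = (\<lambda>u t y. y ^ 2 - u * poly q t)"
    and "N = adjoin (adjoin kU {T_var}) {y. P U_var T_var y = 0}"
  shows
    "(strongly_parametric_ext k\<^sub>0 k\<^sub>0 T_var F \<and>
      \<not> weakly_parametric_ext k\<^sub>0 F \<and>
      \<not> parametric_ext k\<^sub>0 kU T_var F) \<and>
     (strongly_parametric_poly k\<^sub>0 k\<^sub>0 T_var [:- q, 0, 1:] \<and>
      \<not> parametric_poly k\<^sub>0 kU T_var [:- q, 0, 1:]) \<and>
     (finite {u0 :: int. \<not> (\<exists>t\<in>k\<^sub>0. \<exists>y\<in>k\<^sub>0. P (of_int u0) t y = 0)} \<and>
      \<not> (\<exists>t\<in>kU. \<exists>y\<in>kU. P U_var t y = 0)) \<and>
     (regular_cover kU T_var N \<and> galois_extension (adjoin kU {T_var}) N \<and>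
      \<not> WH k\<^sub>0 [N])"
proof -
  have k: "subfield k univ_ring" using assms(1) unfolding number_field_def by blast
  have k0: "subfield k\<^sub>0 univ_ring" unfolding assms(7) by (rule subfield_const_image[OF k])
  have k0_Cx: "k\<^sub>0 \<subseteq> Cx" unfolding assms(7) by blast
  have kU: "subfield kU univ_ring" unfolding assms(8) by (rule adjoin_subfield)
  have CU: "subfield CU univ_ring" by (rule adjoin_subfield)
  have k0_kU: "k\<^sub>0 \<subseteq> kU" and U_kU: "U_var \<in> kU" unfolding assms(8)
    using adjoin_superset[of k\<^sub>0 "{U_var}"] by auto
  have Cx_CU: "Cx \<subseteq> CU" and U_CU: "U_var \<in> CU" using adjoin_superset[of Cx "{U_var}"] by auto
  have kU_CU: "kU \<subseteq> CU" unfolding assms(8) using k0_Cx Cx_CU U_CU by (intro adjoin_least CU) auto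
  obtain a \<alpha> \<beta> \<gamma> where Q: "Q = cubic a \<alpha> \<beta> \<gamma>" and roots: "a \<noteq> 0" "\<alpha> \<noteq> \<beta>" "\<beta> \<noteq> \<gamma>" "\<alpha> \<noteq> \<gamma>" "\<alpha> \<noteq> 0" "\<beta> \<noteq> 0" "\<gamma> \<noteq> 0"
    using irreducible_cubic_roots[OF k assms(3,2)] .
  have qk: "coeffs_in k\<^sub>0 q" using assms(3) unfolding assms(7,9) irreducible_over_def coeffs_in_def by simp
  have q_roots: "q = map_poly const (cubic a \<alpha> \<beta> \<gamma>)" unfolding assms(9) Q ..
  have U0: "U_var \<noteq> 0" using transcendental_not_in[OF subfield_subring[OF subfield_Cx] transcendental_U]
    subfield_closed(1)[OF subfield_Cx] by metis
  obtain Y :: ambient where Y: "Y ^ 2 = poly q T_var" using nth_root_exists[of 2 "poly q T_var"] by auto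
  obtain Z :: ambient where Z: "Z ^ 2 = U_var * poly q T_var"
    using nth_root_exists[of 2 "U_var * poly q T_var"] by auto
  obtain s :: ambient where s: "s ^ 2 = U_var" using nth_root_exists[of 2 U_var] by auto
  let ?kb = "alg_closure_in k\<^sub>0"
  have kb: "subfield ?kb univ_ring" by (rule subfield_alg_closure_in[OF k0])
  have kb_CU: "?kb \<subseteq> CU"
    using algebraic_over_Cx coeffs_in_mono[OF _ k0_Cx] Cx_CU unfolding alg_closure_in_def by blast
  have k0_kb: "k\<^sub>0 \<subseteq> ?kb" by (rule subset_alg_closure_in[OF k0])
  have k0_CU: "k\<^sub>0 \<subseteq> CU" using k0_Cx Cx_CU by blast
  \<comment> \<open>Every field between \<open>k\<^sub>0\<close> and \<open>CU\<close> qualifies,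
    because \<open>T_var\<close> is transcendental over \<open>CU\<close>. The instance over
    \<open>?kb\<close> is there for the branch points.\<close>
  have twist: "cubic_twist L u z a \<alpha> \<beta> \<gamma> q"
    if "subfield L univ_ring" "k\<^sub>0 \<subseteq> L" "L \<subseteq> CU" "u \<in> L" "u \<noteq> 0" "z ^ 2 = u * poly q T_var" for L u z
    by (rule cubic_twist.intro[OF that(1) transcendental_over_mono[OF transcendental_T that(3)] q_roots
        coeffs_in_mono[OF qk that(2)] that(4,5) roots that(6)])
  have Y': "Y ^ 2 = 1 * poly q T_var" using Y by simp
  note one = subfield_closed(2)
  interpret Fk: cubic_twist k\<^sub>0 1 Y a \<alpha> \<beta> \<gamma> q by (rule twist[OF k0 order_refl k0_CU one[OF k0] one_neq_zero Y'])
  interpret Fb: cubic_twist ?kb 1 Y a \<alpha> \<beta> \<gamma> q by (rule twist[OF kb k0_kb kb_CU one[OF kb] one_neq_zero Y'])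
  interpret FU: cubic_twist kU 1 Y a \<alpha> \<beta> \<gamma> q by (rule twist[OF kU k0_kU kU_CU one[OF kU] one_neq_zero Y'])
  interpret FC: cubic_twist CU 1 Y a \<alpha> \<beta> \<gamma> q by (rule twist[OF CU k0_CU order_refl one[OF CU] one_neq_zero Y'])
  interpret NU: cubic_twist kU U_var Z a \<alpha> \<beta> \<gamma> q by (rule twist[OF kU k0_kU kU_CU U_kU U0 Z])
  interpret NC: cubic_twist CU U_var Z a \<alpha> \<beta> \<gamma> q by (rule twist[OF CU k0_CU order_refl U_CU U0 Z])

  \<comment> \<open>The extension F, the cover N and their base changes\<close>
  have F: "F = Fk.aff.M"
    unfolding assms(10) Y[symmetric] by (rule adjoin_sqrt_eq_quad_ext[OF Fk.aff.Kx Fk.aff.RKx])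
  have "{y. P U_var T_var y = 0} = {y. y ^ 2 = Z ^ 2}" unfolding assms(11) Z by auto
  then have N: "N = NU.aff.M"
    unfolding assms(12) by (simp only: adjoin_sqrt_eq_quad_ext[OF NU.aff.Kx NU.aff.RKx])
  let ?G = "Gal F (adjoin k\<^sub>0 {T_var})"
  have G: "group ?G" "card (carrier ?G) = 2"
    unfolding F
    by (rule group_Gal_quad_ext[OF Fk.aff.Kx Fk.aff.RKx Fk.aff.Z_notin two_ambient]
        card_Gal_quad_ext[OF Fk.aff.Kx Fk.aff.RKx Fk.aff.Z_notin two_ambient])+
  have comp_F: "compositum F L = quad_ext (adjoin L {T_var}) Y" if L: "subfield L univ_ring" "k\<^sub>0 \<subseteq> L" for L
    unfolding F
  proof (rule compositum_quad_ext[OF Fk.aff.Kx adjoin_subfield Fk.aff.RKx])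
    note sup = adjoin_superset[of L "{T_var}"] adjoin_superset[of Fk.aff.Kx L] adjoin_superset[of k\<^sub>0 "{T_var}"]
    show "Fk.aff.Kx \<subseteq> adjoin L {T_var}" using sup L by (intro adjoin_least adjoin_subfield) auto
    show "L \<subseteq> adjoin L {T_var}" using sup by blast
    show "adjoin L {T_var} \<subseteq> adjoin Fk.aff.Kx L" using sup by (intro adjoin_least adjoin_subfield) auto
  qed
  have comp_N: "compositum N Cx = NC.aff.M"
    unfolding N
  proof (rule compositum_quad_ext[OF NU.aff.Kx NC.aff.Kx NU.aff.RKx])
    note sup = adjoin_superset[of CU "{T_var}"] adjoin_superset[of NU.aff.Kx Cx] adjoin_superset[of
      kU "{T_var}"]
    show "NU.aff.Kx \<subseteq> NC.aff.Kx" using sup kU_CU by (intro adjoin_least adjoin_subfield) auto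
    show "Cx \<subseteq> NC.aff.Kx" using sup Cx_CU by blast
    have "CU \<subseteq> adjoin NU.aff.Kx Cx" using sup U_kU by (intro adjoin_least adjoin_subfield) auto
    moreover have "{T_var} \<subseteq> adjoin NU.aff.Kx Cx" using sup by blast
    ultimately show "NC.aff.Kx \<subseteq> adjoin NU.aff.Kx Cx" by (rule adjoin_least[OF adjoin_subfield])
  qed

  \<comment> \<open>Points of the twists over the number field and over C(U)\<close>
  have tw: "\<exists>t\<in>k\<^sub>0. \<exists>y\<in>k\<^sub>0. y ^ 2 = d * poly q t" if dk: "d \<in> k\<^sub>0" and d0: "d \<noteq> 0" for d
  proof -
    obtain d' where d': "d' \<in> k" "d = const d'" using dk unfolding assms(7) by blast
    then have "d' \<noteq> 0" using d0 by auto
    then obtain t y where "t \<in> k" "y \<in> k" "y ^ 2 = d' * poly Q t"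
      using twist_has_point[OF assms(1-6) d'(1)] by blast
    then have "const y ^ 2 = d * poly q (const t)" "const t \<in> k\<^sub>0" "const y \<in> k\<^sub>0"
      unfolding d'(2) assms(7,9) poly_map_const by (auto simp flip: const_power const_simps)
    then show ?thesis by blast
  qed
  have no_root: "poly q t \<noteq> 0" if tk: "t \<in> k\<^sub>0" for t
  proof -
    obtain t' where t': "t' \<in> k" "t = const t'" using tk unfolding assms(7) by blast
    show ?thesis using irreducible_over_no_root[OF k assms(3) _ t'(1)] assms(2)
      unfolding t'(2) assms(9) poly_map_const by simp
  qed
  have no_points: "y = 0" if "t \<in> CU" "y \<in> CU" "y ^ 2 = U_var * poly q t" for t y
    using no_twist_points_CU[OF roots(1-4) that(1,2)] that(3) unfolding q_roots by blast
  have sqrt_points: "\<exists>t\<in>k\<^sub>0. \<exists>w. w \<noteq> 0 \<and> w ^ 2 = poly q t \<and> quad_ext k\<^sub>0 w = quad_ext k\<^sub>0 z"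
    if z: "z ^ 2 \<in> k\<^sub>0" for z
  proof (cases "z \<in> k\<^sub>0")
    case True
    obtain t y where ty: "t \<in> k\<^sub>0" "y \<in> k\<^sub>0" "y ^ 2 = poly q t" using tw[OF one[OF k0] one_neq_zero] by auto
    have "y ^ 2 \<in> k\<^sub>0" using subfield_closed(7)[OF k0 ty(2)] .
    then have "quad_ext k\<^sub>0 y = quad_ext k\<^sub>0 z" using quad_ext_trivial[OF k0 _ ty(2)]
      quad_ext_trivial[OF k0 z True] by simp
    moreover have "y \<noteq> 0" using no_root[OF ty(1)] ty(3) by auto
    ultimately show ?thesis using ty by blast
  next
    case False
    then have z0: "z \<noteq> 0" using subfield_closed(1)[OF k0] by auto
    then obtain t y where ty: "t \<in> k\<^sub>0" "y \<in> k\<^sub>0" "y ^ 2 = z ^ 2 * poly q t" using tw[OF z] by auto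
    have y0: "y \<noteq> 0" using no_root[OF ty(1)] ty(3) z0 by auto
    \<comment> \<open>This is \<open>y / z\<close>, a square root of \<open>poly q t\<close>,
      written as a multiple of \<open>z\<close> by an element of \<open>k\<^sub>0\<close> so that it
      visibly generates the same extension.\<close>
    let ?w = "y / z ^ 2 * z"
    have c: "y / z ^ 2 \<in> k\<^sub>0" "y / z ^ 2 \<noteq> 0" using subfield_closed(11)[OF k0 ty(2) z] y0 z0 by auto
    have w: "?w = y / z" using z0 by (simp add: power2_eq_square)
    have "?w ^ 2 = poly q t" unfolding w power_divide ty(3) using z0 by simp
    moreover have "?w \<noteq> 0" using y0 z0 by simp
    ultimately show ?thesis using ty(1) quad_ext_scale[OF k0 c, of z] by blast
  qed

  \<comment> \<open>The extension generated by a square root of U\<close>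
  interpret S: quadratic_function_field Cx U_var s "[:0, 1:]"
  proof (rule quadratic_function_field.intro[OF subfield_Cx transcendental_U])
    show "coeffs_in Cx [:0, 1:]" using subfield_closed(1,2)[OF subfield_Cx] by simp
    show "\<not> [:- c, 1:] ^ 2 dvd ([:0, 1:] :: ambient poly)" for c
      by (rule no_square_factor) (simp add: pderiv_pCons)
  qed (use s two_ambient in auto)
  have s_CU: "s \<notin> CU" by (rule S.Z_notin)
  then have s_kU: "s \<notin> kU" using kU_CU by blast
  \<comment> \<open>If \<open>z\<close> generates the same extension of \<open>L\<close> as
    \<open>s\<close>, then \<open>z = c * s\<close>, and \<open>(t, U_var * c)\<close> is a point of
    the twist by \<open>U_var\<close>; hence \<open>c = 0\<close>, although
    \<open>z \<notin> L\<close>. Both \<open>kU\<close> and \<open>CU\<close> will serve as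
    \<open>L\<close>.\<close>
  have no_sqrt_U: False
    if L: "subfield L univ_ring" "k\<^sub>0 \<subseteq> L" "L \<subseteq> CU" "U_var \<in> L"
      and z: "z = 0 \<or> (\<exists>t\<in>L. z ^ 2 = poly q t)" and e: "quad_ext L s = quad_ext L z" for L z
  proof -
    have s2: "s ^ 2 \<in> L" "s \<notin> L" using L s s_CU by auto
    have z2: "z ^ 2 \<in> L" using z poly_in_subring[OF subfield_subring[OF L(1)] coeffs_in_mono[OF qk
      L(2)]] subfield_closed(1)[OF L(1)] by auto
    have zL: "z \<notin> L"
    proof
      assume "z \<in> L"
      then have "quad_ext L s = L" using quad_ext_trivial[OF L(1) z2] e by simp
      then show False using root_in_quad_ext[OF L(1) s2(1)] s2(2) by simp
    qed
    then obtain t where t: "t \<in> L" "z ^ 2 = poly q t" using z subfield_closed(1)[OF L(1)] by auto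
    have "z \<in> quad_ext L s" unfolding e by (rule root_in_quad_ext[OF L(1) z2])
    then obtain c where c: "c \<in> L" "z = c * s" using square_in_quad_ext[OF L(1) two_ambient s2 _ z2 zL] by blast
    have "(U_var * c) ^ 2 = U_var * poly q t" unfolding t(2)[symmetric] c(2) power_mult_distrib s
      by (simp add: power2_eq_square)
    moreover have "U_var * c \<in> CU" "t \<in> CU" using L(3) subfield_closed(6)[OF L(1) L(4) c(1)] t(1) by blast+
    ultimately have "U_var * c = 0" using no_points by blast
    then show False using U0 c(2) zL subfield_closed(1)[OF L(1)] by auto
  qed

  \<comment> \<open>Parametricity of the extension F\<close>
  have strong: "strongly_parametric_ext k\<^sub>0 k\<^sub>0 T_var F"
    unfolding strongly_parametric_ext_def R_le_two[OF G k0 two_ambient] comp_F[OF k0 order_refl]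
  proof (intro equalityI subsetI)
    fix E assume "E \<in> SP k\<^sub>0 T_var Fk.aff.M"
    then obtain t where "t \<in> proj_line k\<^sub>0" "is_specialization k\<^sub>0 T_var Fk.aff.M t E" unfolding SP_def by blast
    then obtain z where z: "E = quad_ext k\<^sub>0 z" "z = 0 \<or> (\<exists>t0\<in>k\<^sub>0. z ^ 2 = 1 * poly q t0)"
      using Fk.specialization_cases by blast
    have "z ^ 2 \<in> k\<^sub>0" using z(2) poly_in_subring[OF subfield_subring[OF k0] qk]
      subfield_closed(1)[OF k0] by auto
    then show "E \<in> {quad_ext k\<^sub>0 z | z. z ^ 2 \<in> k\<^sub>0}" using z(1) by blast
  next
    fix E assume "E \<in> {quad_ext k\<^sub>0 z | z. z ^ 2 \<in> k\<^sub>0}"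
    then obtain z where z: "z ^ 2 \<in> k\<^sub>0" "E = quad_ext k\<^sub>0 z" by blast
    obtain t w where tw: "t \<in> k\<^sub>0" "w \<noteq> 0" "w ^ 2 = poly q t" "quad_ext k\<^sub>0 w = quad_ext k\<^sub>0 z"
      using sqrt_points[OF z(1)] by blast
    have w: "w ^ 2 = 1 * poly q t" using tw(3) by simp
    have "is_specialization k\<^sub>0 T_var Fk.aff.M (Affine t) E"
      using Fk.specialization_exists[OF tw(1) w] unfolding tw(4) z(2) .
    moreover have "Affine t \<in> proj_line k\<^sub>0" using tw(1) unfolding proj_line_def by blast
    moreover have "Affine t \<notin> branch_points k\<^sub>0 T_var Fk.aff.M"
    proof -
      \<comment> \<open>Branch points are tested over the algebraic closure \<open>?kb\<close>,
        which contains the nonzero square root \<open>w\<close> of \<open>poly q t\<close>.\<close>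
      have "poly q t \<in> k\<^sub>0" by (rule poly_in_subring[OF subfield_subring[OF k0] qk tw(1)])
      then have co: "coeffs_in k\<^sub>0 [:- poly q t, 0, 1:]" using subfield_closed(1-3)[OF k0] by simp
      moreover have "poly [:- poly q t, 0, 1:] w = 0" using tw(3) by (simp add: power2_eq_square)
      moreover have "[:- poly q t, 0, 1:] \<noteq> 0" by simp
      ultimately have "w \<in> ?kb" unfolding alg_closure_in_def by blast
      then have "\<not> ramified_at ?kb T_var Fb.aff.M (Affine t)"
        using Fb.not_ramified[OF subsetD[OF k0_kb tw(1)] _ tw(2) w] by blast
      then show ?thesis unfolding branch_points_def F[symmetric] comp_F[OF kb k0_kb] by blast
    qed
    ultimately show "E \<in> SP k\<^sub>0 T_var Fk.aff.M" unfolding SP_def by blast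
  qed

  have E_R: "quad_ext kU s \<in> R_eq ?G kU"
    unfolding R_eq_two[OF G kU two_ambient] using s s_kU U_kU by auto

  have not_SP: "quad_ext L s \<notin> SP L T_var (compositum F L)"
    if L: "subfield L univ_ring" "k\<^sub>0 \<subseteq> L" "L \<subseteq> CU" "U_var \<in> L" for L
  proof
    interpret FL: cubic_twist L 1 Y a \<alpha> \<beta> \<gamma> q by (rule twist[OF L(1-3) one[OF L(1)] one_neq_zero Y'])
    assume "quad_ext L s \<in> SP L T_var (compositum F L)"
    then obtain t where "t \<in> proj_line L" "is_specialization L T_var FL.aff.M t (quad_ext L s)"
      unfolding SP_def comp_F[OF L(1,2)] by blast
    then obtain z where e: "quad_ext L s = quad_ext L z" and z: "z = 0 \<or> (\<exists>t0\<in>L. z ^ 2 = 1 * poly q t0)"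
      using FL.specialization_cases by blast
    show False by (rule no_sqrt_U[OF L z[unfolded mult_1] e])
  qed

  have not_param: "\<not> parametric_ext k\<^sub>0 kU T_var F"
    unfolding parametric_ext_def using E_R not_SP[OF kU k0_kU kU_CU U_kU] by blast

  have not_weak: "\<not> weakly_parametric_ext k\<^sub>0 F"
  proof
    assume weak: "weakly_parametric_ext k\<^sub>0 F"
    have s2: "s ^ 2 \<in> kU" "s ^ 2 \<in> CU" using s U_kU U_CU by auto
    \<comment> \<open>An element algebraic over \<open>k\<^sub>0\<close> is a complex constant; its
      coordinates over \<open>CU\<close> show that it lies in \<open>kU\<close>, and a constant in
      \<open>kU\<close> lies in \<open>k\<^sub>0\<close>.\<close>
    have "regular_over k\<^sub>0 (quad_ext kU s)"
      unfolding regular_over_def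
    proof (intro equalityI subsetI)
      fix b assume b: "b \<in> quad_ext kU s \<inter> ?kb"
      then have "b \<in> Cx" using algebraic_over_Cx coeffs_in_mono[OF _ k0_Cx]
        unfolding alg_closure_in_def by blast
      then obtain c where c: "b = const c" by blast
      obtain f g where fg: "f \<in> kU" "g \<in> kU" "b = f + g * s" using b quad_extE by blast
      have "b \<in> CU" using \<open>b \<in> Cx\<close> Cx_CU by blast
      moreover have "b + 0 * s = f + g * s" using fg(3) by simp
      ultimately have "b = f"
        using quad_coords_unique(1)[OF CU s2(2) s_CU _ subfield_closed(1)[OF CU]] fg(1,2) kU_CU by blast
      then have "const c \<in> adjoin (const ` k) {U_var}" using fg(1) c unfolding assms(7,8) by simp
      then show "b \<in> k\<^sub>0" using const_in_adjoin_U[OF k] unfolding c assms(7) by blast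
    next
      fix b assume "b \<in> k\<^sub>0"
      then show "b \<in> quad_ext kU s \<inter> ?kb" using k0_kU k0_kb base_subset_quad_ext[OF kU s2(1)] by blast
    qed
    then have "compositum (quad_ext kU s) Cx \<in> SP CU T_var (compositum F CU)"
      using weak E_R unfolding weakly_parametric_ext_def assms(8) by blast
    moreover have "compositum (quad_ext kU s) Cx = quad_ext CU s"
    proof (rule compositum_quad_ext[OF kU CU s2(1) kU_CU Cx_CU])
      show "CU \<subseteq> adjoin kU Cx" using adjoin_superset[of kU Cx] U_kU by (intro adjoin_least adjoin_subfield) auto
    qed
    ultimately show False using not_SP[OF CU k0_CU order_refl U_CU] by simp
  qed

  \<comment> \<open>Parametricity of the polynomial\<close>
  have pg: "poly_group k\<^sub>0 T_var [:- q, 0, 1:] = ?G"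
    unfolding poly_group_def splitting_field_sqrt assms(10) ..
  have split: "splitting_field L (eval_inner [:- q, 0, 1:] t) = quad_ext L w"
    if "subfield L univ_ring" "w ^ 2 \<in> L" "w ^ 2 = poly q t" for L t w
    unfolding splitting_field_sqrt that(3)[symmetric] by (rule adjoin_sqrt_eq_quad_ext[OF that(1,2)])

  have strong_poly: "strongly_parametric_poly k\<^sub>0 k\<^sub>0 T_var [:- q, 0, 1:]"
    unfolding strongly_parametric_poly_def pg R_le_two[OF G k0 two_ambient]
  proof
    fix E assume "E \<in> {quad_ext k\<^sub>0 z | z. z ^ 2 \<in> k\<^sub>0}"
    then obtain z where z: "z ^ 2 \<in> k\<^sub>0" "E = quad_ext k\<^sub>0 z" by blast
    obtain t w where tw: "t \<in> k\<^sub>0" "w ^ 2 = poly q t" "quad_ext k\<^sub>0 w = quad_ext k\<^sub>0 z"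
      using sqrt_points[OF z(1)] by blast
    have "w ^ 2 \<in> k\<^sub>0" unfolding tw(2) by (rule poly_in_subring[OF subfield_subring[OF k0] qk tw(1)])
    then show "\<exists>t0\<in>k\<^sub>0. E = splitting_field k\<^sub>0 (eval_inner [:- q, 0, 1:] t0)"
      using split[OF k0 _ tw(2)] tw(1,3) z(2) by auto
  qed

  have not_poly: "\<not> parametric_poly k\<^sub>0 kU T_var [:- q, 0, 1:]"
  proof
    assume "parametric_poly k\<^sub>0 kU T_var [:- q, 0, 1:]"
    then obtain t where t: "t \<in> kU" "quad_ext kU s = splitting_field kU (eval_inner [:- q, 0, 1:] t)"
      using E_R unfolding parametric_poly_def pg by blast
    obtain w :: ambient where w: "w ^ 2 = poly q t" using nth_root_exists[of 2 "poly q t"] by auto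
    have "w ^ 2 \<in> kU" unfolding w by (rule poly_in_subring[OF subfield_subring[OF kU]
      coeffs_in_mono[OF qk k0_kU] t(1)])
    then have "quad_ext kU s = quad_ext kU w" using split[OF kU _ w] t(2) by simp
    then show False using no_sqrt_U[OF kU k0_kU kU_CU U_kU] w t(1) by blast
  qed

  \<comment> \<open>Zeros of P for integral values of U and over k(U)\<close>
  have "{u0 :: int. \<not> (\<exists>t\<in>k\<^sub>0. \<exists>y\<in>k\<^sub>0. P (of_int u0) t y = 0)} \<subseteq> {0}"
  proof
    fix u0 :: int assume u0: "u0 \<in> {u0. \<not> (\<exists>t\<in>k\<^sub>0. \<exists>y\<in>k\<^sub>0. P (of_int u0) t y = 0)}"
    show "u0 \<in> {0}"
    proof (rule ccontr)
      assume "u0 \<notin> {0}"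
      have "of_nat n \<in> k\<^sub>0" "- of_nat n \<in> k\<^sub>0" for n
        using subfield_closed(8)[OF k0] subfield_closed(3)[OF k0] by blast+
      then have "of_int u0 \<in> k\<^sub>0" by (cases u0) (auto simp del: of_nat_Suc)
      moreover have "(of_int u0 :: ambient) \<noteq> 0"
        using \<open>u0 \<notin> {0}\<close> const_simps(8)[of "of_int u0"] by simp
      ultimately show False using tw[of "of_int u0"] u0 unfolding assms(11) by auto
    qed
  qed
  then have fin: "finite {u0 :: int. \<not> (\<exists>t\<in>k\<^sub>0. \<exists>y\<in>k\<^sub>0. P (of_int u0) t y = 0)}" by (rule finite_subset) simp

  have no_zero: "\<not> (\<exists>t\<in>kU. \<exists>y\<in>kU. P U_var t y = 0)"
  proof
    assume "\<exists>t\<in>kU. \<exists>y\<in>kU. P U_var t y = 0"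
    then obtain t y where ty: "t \<in> kU" "y \<in> kU" "y ^ 2 = U_var * poly q t" unfolding assms(11) by auto
    then have "y = 0" using no_points kU_CU by blast
    \<comment> \<open>With \<open>y = 0\<close> the remaining possibility is a root \<open>t\<close>
      of \<open>q\<close>. Such a root is constant, and a constant in \<open>kU\<close> lies in
      \<open>k\<^sub>0\<close>, where \<open>q\<close> has no root.\<close>
    then have "poly q t = 0" using ty(3) U0 by simp
    then have "t = const \<alpha> \<or> t = const \<beta> \<or> t = const \<gamma>" using roots(1) by (auto simp: Fk.poly_q)
    then obtain c where c: "t = const c" by blast
    then have "c \<in> k" using const_in_adjoin_U[OF k] ty(1) unfolding assms(7,8) by blast
    then have "t \<in> k\<^sub>0" unfolding c assms(7) by blast
    then show False using no_root \<open>poly q t = 0\<close> by blast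
  qed

  \<comment> \<open>Failure of hypothesis (WH)\<close>
  have reg: "regular_cover kU T_var N"
    unfolding regular_cover_def N
    by (intro conjI kU NU.aff.M base_subset_quad_ext[OF NU.aff.Kx NU.aff.RKx]
        finite_dimension_quad_ext[OF NU.aff.Kx NU.aff.RKx] NU.aff.regular_M)
  have gal: "galois_extension (adjoin kU {T_var}) N"
    unfolding N by (rule galois_extension_quad_ext[OF NU.aff.Kx NU.aff.RKx NU.aff.Z_notin two_ambient])

  have "\<not> has_unramified_point CU T_var NC.aff.M"
  proof
    assume "has_unramified_point CU T_var NC.aff.M"
    then obtain x h where x: "x \<in> {T_var, inverse T_var}"
      and h: "h \<in> Ring.ring_hom (on (integral_closure (poly_ring CU x) NC.aff.M)) (on CU)" "\<And>c. c \<in>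
        CU \<Longrightarrow> h c = c"
      and gl: "generates_locally (integral_closure (poly_ring CU x) NC.aff.M)
        (a_kernel (on (integral_closure (poly_ring CU x) NC.aff.M)) (on CU) h) {x - h x}"
      unfolding has_unramified_point_def Let_def by blast
    obtain W R where "(x, W, R) \<in> {(T_var, Z, smult U_var q), (inverse T_var, Z / T_var ^ 2, smult
      U_var NC.q_inf)}"
      using x by blast
    from NC.hom_point[OF this h no_points] gl show False by (rule notE)
  qed
  \<comment> \<open>For \<open>u0 \<noteq> 0\<close> in \<open>k\<^sub>0\<close> the twist by
    \<open>u0\<close> has a point with \<open>y \<noteq> 0\<close>, which lifts to an unramified
    point of the reduction.\<close>
  moreover have "{u0 \<in> k\<^sub>0. \<forall>M \<in> set [N]. good_reduction k\<^sub>0 u0 M \<and> \<not> reduction_has_unramified_point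
    k\<^sub>0 u0 M} \<subseteq> {0}"
  proof
    fix u0 assume u0: "u0 \<in> {u0 \<in> k\<^sub>0. \<forall>M \<in> set [N]. good_reduction k\<^sub>0 u0 M \<and> \<not>
      reduction_has_unramified_point k\<^sub>0 u0 M}"
    show "u0 \<in> {0}"
    proof (rule ccontr)
      assume "u0 \<notin> {0}"
      then obtain t y where ty: "t \<in> k\<^sub>0" "y \<in> k\<^sub>0" "y ^ 2 = u0 * poly q t" using tw[of u0] u0 by auto
      have y0: "y \<noteq> 0" using no_root[OF ty(1)] ty(3) \<open>u0 \<notin> {0}\<close> by auto
      have "cubic_twist (adjoin k\<^sub>0 {U_var}) U_var Z a \<alpha> \<beta> \<gamma> q"
        using NU.cubic_twist_axioms unfolding assms(8) .
      then interpret W: twist_reduction k\<^sub>0 Z a \<alpha> \<beta> \<gamma> q u0 t y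
        using u0 ty y0 k0 k0_Cx qk by (intro twist_reduction.intro twist_reduction_axioms.intro) auto
      show False using W.reduction_has_unramified_point u0 unfolding N assms(8) by simp
    qed
  qed
  then have "finite {u0 \<in> k\<^sub>0. \<forall>M \<in> set [N]. good_reduction k\<^sub>0 u0 M \<and> \<not>
    reduction_has_unramified_point k\<^sub>0 u0 M}"
    by (rule finite_subset) simp
  \<comment> \<open>The negated implication carries both halves of the claim: its premise, no
    unramified point over \<open>CU\<close>, holds, and its conclusion fails.\<close>
  ultimately have WH: "\<not> WH k\<^sub>0 [N]" unfolding WH_def comp_N[symmetric] by simp

  show ?thesis
    by (intro conjI strong not_weak not_param strong_poly not_poly fin no_zero reg gal WH)
qed

end
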